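(* Let $G$ be a finite simple group. A surjective generalized subgroup $c:X\twoheadrightarrow G$ is a cellular cover if and only if the subgroup $H_2(c)(H_2(X))\subseteq H_2(G)$ is invariant under $H_2(h)$ for every automorphism $h$ of $G$. Consequently, the assignment $c\mapsto H_2(c)(H_2(X))$ is a bijection between the set of equivalence classes of surjective cellular covers of $G$ and the set of $\mathrm{Aut}(G)$-invariant subgroups of $H_2(G)$.
   Context: A homomorphism $c:X\to G$ is a generalized subgroup of $G$ if $\mathrm{Hom}(X,X)\to\mathrm{Hom}(X,G)$, $f\mapsto cf$, is injective, and a cellular cover if this map is bijective; $c:X\to G$ and $d:Y\to G$ are equivalent if $dh=c$ for some isomorphism $h:X\to Y$. $H_2(G)$ denotes the Schur multiplier, on which $\mathrm{Aut}(G)$ acts by functoriality; a subgroup is $\mathrm{Aut}(G)$-invariant if $H_2(h)$ maps it onto itself for all $h\in\mathrm{Aut}(G)$. *)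

theory Defs
  imports "HOL-Algebra.Algebra"
begin

section \<open>Schur multiplier H_2(G; Z) via the inhomogeneous bar complex\<close>

definition chains2 :: "('a, 'm) monoid_scheme \<Rightarrow> ('a \<times> 'a \<Rightarrow> int) set" where
  "chains2 G = {z. finite {p. z p \<noteq> 0} \<and> (\<forall>p. z p \<noteq> 0 \<longrightarrow> p \<in> carrier G \<times> carrier G)}"

definition chains3 :: "('a, 'm) monoid_scheme \<Rightarrow> ('a \<times> 'a \<times> 'a \<Rightarrow> int) set" where
  "chains3 G = {w. finite {q. w q \<noteq> 0} \<and>
      (\<forall>q. w q \<noteq> 0 \<longrightarrow> q \<in> carrier G \<times> carrier G \<times> carrier G)}"

definition ind :: "bool \<Rightarrow> int" where
  "ind b = (if b then 1 else 0)"

definition bd2 :: "('a, 'm) monoid_scheme \<Rightarrow> ('a \<times> 'a \<Rightarrow> int) \<Rightarrow> ('a \<Rightarrow> int)" where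
  "bd2 G z = (\<lambda>x. \<Sum>p\<in>{p. z p \<noteq> 0}. z p *
      (ind (snd p = x) - ind (fst p \<otimes>\<^bsub>G\<^esub> snd p = x) + ind (fst p = x)))"

definition bd3 :: "('a, 'm) monoid_scheme \<Rightarrow> ('a \<times> 'a \<times> 'a \<Rightarrow> int) \<Rightarrow> ('a \<times> 'a \<Rightarrow> int)" where
  "bd3 G w = (\<lambda>(a, b). \<Sum>q\<in>{q. w q \<noteq> 0}. w q *
      (case q of (g, h, k) \<Rightarrow>
         ind ((h, k) = (a, b)) - ind ((g \<otimes>\<^bsub>G\<^esub> h, k) = (a, b))
       + ind ((g, h \<otimes>\<^bsub>G\<^esub> k) = (a, b)) - ind ((g, h) = (a, b))))"

definition cycles2 :: "('a, 'm) monoid_scheme \<Rightarrow> ('a \<times> 'a \<Rightarrow> int) set" where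
  "cycles2 G = {z \<in> chains2 G. bd2 G z = (\<lambda>_. 0)}"

definition bounds2 :: "('a, 'm) monoid_scheme \<Rightarrow> ('a \<times> 'a \<Rightarrow> int) set" where
  "bounds2 G = bd3 G ` chains3 G"

definition Z2grp :: "('a, 'm) monoid_scheme \<Rightarrow> ('a \<times> 'a \<Rightarrow> int) monoid" where
  "Z2grp G = \<lparr>carrier = cycles2 G, monoid.mult = (\<lambda>z w. \<lambda>p. z p + w p), monoid.one = (\<lambda>_. 0)\<rparr>"

definition H2 :: "('a, 'm) monoid_scheme \<Rightarrow> ('a \<times> 'a \<Rightarrow> int) set monoid" where
  "H2 G = Z2grp G Mod bounds2 G"

definition push2 :: "('b \<Rightarrow> 'a) \<Rightarrow> ('b \<times> 'b \<Rightarrow> int) \<Rightarrow> ('a \<times> 'a \<Rightarrow> int)" where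
  "push2 f z = (\<lambda>q. \<Sum>p\<in>{p. z p \<noteq> 0 \<and> (f (fst p), f (snd p)) = q}. z p)"

definition H2map :: "('a, 'm) monoid_scheme \<Rightarrow> ('b \<Rightarrow> 'a)
    \<Rightarrow> ('b \<times> 'b \<Rightarrow> int) set \<Rightarrow> ('a \<times> 'a \<Rightarrow> int) set" where
  "H2map G f C = r_coset (Z2grp G) (bounds2 G) (push2 f (SOME z. z \<in> C))"

definition H2image :: "('b, 'n) monoid_scheme \<Rightarrow> ('a, 'm) monoid_scheme \<Rightarrow> ('b \<Rightarrow> 'a)
    \<Rightarrow> ('a \<times> 'a \<Rightarrow> int) set set" where
  "H2image Y G c = H2map G c ` carrier (H2 Y)"

definition Aut_invariant :: "('a, 'm) monoid_scheme \<Rightarrow> ('a \<times> 'a \<Rightarrow> int) set set \<Rightarrow> bool" where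
  "Aut_invariant G S \<longleftrightarrow> (\<forall>h \<in> iso G G. H2map G h ` S = S)"

text \<open>Homomorphisms are identified when they agree on the carrier.\<close>
definition gen_subgroup :: "('b, 'n) monoid_scheme \<Rightarrow> ('a, 'm) monoid_scheme \<Rightarrow> ('b \<Rightarrow> 'a) \<Rightarrow> bool" where
  "gen_subgroup K G c \<longleftrightarrow> c \<in> hom K G \<and>
     (\<forall>f \<in> hom K K. \<forall>g \<in> hom K K.
        (\<forall>x \<in> carrier K. c (f x) = c (g x)) \<longrightarrow> (\<forall>x \<in> carrier K. f x = g x))"

definition cellular_cover :: "('b, 'n) monoid_scheme \<Rightarrow> ('a, 'm) monoid_scheme \<Rightarrow> ('b \<Rightarrow> 'a) \<Rightarrow> bool" where
  "cellular_cover K G c \<longleftrightarrow> gen_subgroup K G c \<and>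
     (\<forall>\<phi> \<in> hom K G. \<exists>f \<in> hom K K. \<forall>x \<in> carrier K. c (f x) = \<phi> x)"

definition cover_equiv :: "('b, 'n) monoid_scheme \<times> ('b \<Rightarrow> 'a) \<Rightarrow> ('b, 'n) monoid_scheme \<times> ('b \<Rightarrow> 'a) \<Rightarrow> bool" where
  "cover_equiv p q \<longleftrightarrow> (\<exists>h \<in> iso (fst p) (fst q). \<forall>x \<in> carrier (fst p). snd q (h x) = snd p x)"

definition surj_cellular_covers :: "('a, 'm) monoid_scheme \<Rightarrow> (('b monoid) \<times> ('b \<Rightarrow> 'a)) set" where
  "surj_cellular_covers G = {(K, c). group K \<and> cellular_cover K G c \<and> c ` carrier K = carrier G}"

definition cover_equiv_rel :: "('a, 'm) monoid_scheme \<Rightarrow> (('b monoid \<times> ('b \<Rightarrow> 'a)) \<times> ('b monoid \<times> ('b \<Rightarrow> 'a))) set" where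
  "cover_equiv_rel G = {(p, q). p \<in> surj_cellular_covers G \<and> q \<in> surj_cellular_covers G \<and> cover_equiv p q}"

definition invariant_subgroups :: "('a, 'm) monoid_scheme \<Rightarrow> ('a \<times> 'a \<Rightarrow> int) set set set" where
  "invariant_subgroups G = {S. subgroup S (H2 G) \<and> Aut_invariant G S}"

definition class_image :: "('a, 'm) monoid_scheme \<Rightarrow> ('b monoid \<times> ('b \<Rightarrow> 'a)) set \<Rightarrow> ('a \<times> 'a \<Rightarrow> int) set set" where
  "class_image G K = (let p = (SOME p. p \<in> K) in H2image (fst p) G (snd p))"

end

(*
  Let c : K ->> G be a surjective generalized subgroup with kernel N. Conjugation by an element of N
  does not change c, so N is central, and injectivity of Hom(K,K) -> Hom(K,G) gives Hom(K,N) = 0.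
  Applied to the transfer K -> N, which is the |G|-th power map on N, this bounds the exponent of N.
  The simple group G is perfect or cyclic. If it is perfect, so is K, since otherwise N has a
  nontrivial endomorphism vanishing on the intersection of N with [K,K], which extends to K. If it is
  cyclic, c is an isomorphism and H_2(G) = 0.

  For perfect G, a nontrivial homomorphism K -> G is h c with h an automorphism of G. A homomorphism
  from a perfect group to G lifts along a central extension d : L ->> G if and only if its
  H_2-image lies in that of d: the factor set of d defines a homomorphism H_2(G) -> ker d that
  vanishes on the image of H_2(L), and a cocycle on a perfect group that vanishes on all 2-cycles is a
  coboundary because all 1-chains are boundaries. So h c lifts to K if and only if H_2(h) maps
  the image of H_2(c) into itself, and the same lifting criterion shows that covers with the same image
  are equivalent. Every subgroup S of H_2(G) is an image: take the central extension by H_2(G) / S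
  given by a retraction of the 2-chains onto the 2-cycles.
*)
theory Submission
  imports Defs "HOL-Library.Function_Algebras"
begin

section \<open>Finitely supported integral chains\<close>

text \<open>Nothing bounds the size of \<open>K\<close>, so its kernel may be infinite a priori, and
  a proper subgroup of an abelian group need not be killed by a nonzero endomorphism: no nonzero
  endomorphism of the rationals kills the integers. The bound on the exponent is what excludes this,
  since it provides a homomorphism onto Z/p and an element of order p for the same prime p. Lifting
  is treated on chains because a homomorphism out of a free abelian group may be prescribed on a
  basis; this replaces universal coefficients and the five-term sequence. The criterion gives one
  inclusion for each automorphism; invariance in the sense of equality comes from the inverse
  automorphism. When a subgroup S is realized, the construction only shows that the image lies in S.
  Computing the homology of the extension is avoided by comparing it with the cover attached to its
  actual image. Equivalence classes are formed over groups on one fixed carrier type. Since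
  \<open>G\<close> is finite, its cycles form a countable group, so every infinite type has room for
  the covers that are needed.\<close>

definition fin_chains :: "'p set \<Rightarrow> ('p \<Rightarrow> int) set" where
  "fin_chains S = {z. finite {p. z p \<noteq> 0} \<and> (\<forall>p. z p \<noteq> 0 \<longrightarrow> p \<in> S)}"

definition single :: "'p \<Rightarrow> 'p \<Rightarrow> int" where
  "single p = (\<lambda>q. ind (p = q))"

text \<open>Additive extension of \<open>E\<close> from basis elements to chains. Both boundary maps
  and the push-forward have this form, so identities between them reduce to basis elements.\<close>

definition chain_ext :: "('p \<Rightarrow> 'q \<Rightarrow> int) \<Rightarrow> ('p \<Rightarrow> int) \<Rightarrow> ('q \<Rightarrow> int)" where
  "chain_ext E z = (\<lambda>x. \<Sum>p\<in>{p. z p \<noteq> 0}. z p * E p x)"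

text \<open>As simp rules, these would rewrite the eta-expanded instances that \<open>chain_induct\<close> below produces.\<close>

lemmas fun_apply = plus_fun_apply zero_fun_apply uminus_apply minus_apply

declare fun_apply [simp del]

lemma single_apply: "single p q = (if p = q then 1 else 0)"
  by (simp add: single_def ind_def)

lemma fin_chains_finite: "z \<in> fin_chains S \<Longrightarrow> finite {p. z p \<noteq> 0}"
  by (simp add: fin_chains_def)

lemma zero_in_fin_chains [simp]: "0 \<in> fin_chains S"
  by (simp add: fin_chains_def fun_apply)

lemma single_in_fin_chains [simp]: "single p \<in> fin_chains S \<longleftrightarrow> p \<in> S"
  by (auto simp: fin_chains_def single_apply)

lemma uminus_in_fin_chains [simp]: "- z \<in> fin_chains S \<longleftrightarrow> z \<in> fin_chains S"
  by (simp add: fin_chains_def fun_apply)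

lemma add_in_fin_chains [simp]:
  assumes "z \<in> fin_chains S" "w \<in> fin_chains S"
  shows "z + w \<in> fin_chains S"
proof -
  have "{p. (z + w) p \<noteq> 0} \<subseteq> {p. z p \<noteq> 0} \<union> {p. w p \<noteq> 0}"
    by (auto simp: fun_apply)
  moreover have "finite ({p. z p \<noteq> 0} \<union> {p. w p \<noteq> 0})"
    using assms by (simp add: fin_chains_def)
  ultimately have "finite {p. (z + w) p \<noteq> 0}"
    by (rule finite_subset)
  then show ?thesis
    using assms by (auto simp: fin_chains_def fun_apply) (metis add.right_neutral)
qed

lemma diff_in_fin_chains [simp]: "z \<in> fin_chains S \<Longrightarrow> w \<in> fin_chains S \<Longrightarrow> z - w \<in> fin_chains S"
  using add_in_fin_chains[of z S "- w"] by simp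

lemma chain_ext_superset:
  assumes "finite F" "{p. z p \<noteq> 0} \<subseteq> F"
  shows "chain_ext E z x = (\<Sum>p\<in>F. z p * E p x)"
  unfolding chain_ext_def using assms by (intro sum.mono_neutral_left) auto

lemma chain_ext_add:
  assumes "z \<in> fin_chains S" "w \<in> fin_chains S"
  shows "chain_ext E (z + w) = chain_ext E z + chain_ext E w"
proof
  fix x
  let ?F = "{p. z p \<noteq> 0} \<union> {p. w p \<noteq> 0}"
  have "finite ?F"
    using assms by (simp add: fin_chains_def)
  then have "chain_ext E (z + w) x = (\<Sum>p\<in>?F. (z + w) p * E p x)"
    "chain_ext E z x = (\<Sum>p\<in>?F. z p * E p x)" "chain_ext E w x = (\<Sum>p\<in>?F. w p * E p x)"
    by (intro chain_ext_superset; auto simp: fun_apply)+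
  then show "chain_ext E (z + w) x = (chain_ext E z + chain_ext E w) x"
    by (simp add: sum.distrib distrib_right fun_apply)
qed

lemma chain_ext_uminus: "chain_ext E (- z) = - chain_ext E z"
  by (simp add: chain_ext_def fun_eq_iff fun_apply sum_negf)

lemma chain_ext_zero [simp]: "chain_ext E 0 = 0"
  by (simp add: chain_ext_def fun_eq_iff fun_apply)

lemma chain_ext_diff:
  assumes "z \<in> fin_chains S" "w \<in> fin_chains S"
  shows "chain_ext E (z - w) = chain_ext E z - chain_ext E w"
  using chain_ext_add[of z S "- w" E] assms by (simp add: chain_ext_uminus)

lemma chain_ext_single [simp]: "chain_ext E (single p) = E p"
proof
  fix x
  have "chain_ext E (single p) x = (\<Sum>q\<in>{p}. single p q * E q x)"
    by (rule chain_ext_superset) (auto simp: single_apply)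
  then show "chain_ext E (single p) x = E p x"
    by (simp add: single_apply)
qed

text \<open>Addition and negation already generate all integer multiples, so no case for scalars is
  needed and additive maps pass through every case.\<close>

lemma chain_induct [consumes 1, case_names zero single add uminus]:
  assumes z: "z \<in> fin_chains S"
    and zero: "P 0"
    and single: "\<And>p. p \<in> S \<Longrightarrow> P (single p)"
    and add: "\<And>z w. z \<in> fin_chains S \<Longrightarrow> w \<in> fin_chains S \<Longrightarrow> P z \<Longrightarrow> P w \<Longrightarrow> P (z + w)"
    and uminus: "\<And>z. z \<in> fin_chains S \<Longrightarrow> P z \<Longrightarrow> P (- z)"
  shows "P z"
proof -
  have mult: "(\<lambda>q. of_nat n * single p q) \<in> fin_chains S \<and> P (\<lambda>q. of_nat n * single p q)"
    if "p \<in> S" for p n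
  proof (induction n)
    case 0
    then show ?case
      using zero zero_in_fin_chains[of S] by (simp add: zero_fun_def)
  next
    case (Suc n)
    have "(\<lambda>q. of_nat (Suc n) * single p q) = single p + (\<lambda>q. of_nat n * single p q)"
      by (simp add: fun_eq_iff fun_apply algebra_simps)
    then show ?case
      using Suc add[OF _ _ single] that by simp
  qed
  have imult: "(\<lambda>q. k * single p q) \<in> fin_chains S \<and> P (\<lambda>q. k * single p q)" if p: "p \<in> S" for p k
  proof (cases "k \<ge> 0")
    case True
    then show ?thesis
      using mult[OF p, of "nat k"] by simp
  next
    case False
    then have "(\<lambda>q. k * single p q) = - (\<lambda>q. of_nat (nat (- k)) * single p q)"
      by (simp add: fun_eq_iff fun_apply)
    then show ?thesis
      using mult[OF p, of "nat (- k)"] uminus by simp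
  qed
  show ?thesis
    using z
  proof (induction "card {p. z p \<noteq> 0}" arbitrary: z)
    case 0
    then have "z = 0"
      using fin_chains_finite[OF 0(2)] by (auto simp: fun_eq_iff fun_apply)
    then show ?case
      using zero by metis
  next
    case (Suc n)
    then obtain p where p: "z p \<noteq> 0"
      by (metis (mono_tags, lifting) Collect_empty_eq card.empty nat.distinct(1))
    then have pS: "p \<in> S"
      using Suc.prems by (simp add: fin_chains_def)
    let ?w = "z(p := 0)"
    have supp: "{q. ?w q \<noteq> 0} = {q. z q \<noteq> 0} - {p}"
      by auto
    have w: "?w \<in> fin_chains S"
      using Suc.prems supp by (auto simp: fin_chains_def)
    have "card {q. ?w q \<noteq> 0} = n"
      using Suc(2) p fin_chains_finite[OF Suc.prems] unfolding supp by simp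
    then have "P ?w"
      using Suc.hyps(1) w by metis
    moreover have "z = ?w + (\<lambda>q. z p * single p q)"
      by (auto simp: fun_eq_iff fun_apply single_apply)
    ultimately show ?case
      using add[OF w] imult[OF pS, of "z p"] by metis
  qed
qed

lemma chain_ext_in_fin_chains:
  assumes "z \<in> fin_chains S" "\<And>p. p \<in> S \<Longrightarrow> E p \<in> fin_chains T"
  shows "chain_ext E z \<in> fin_chains T"
  using assms(1)
  by (induction rule: chain_induct)
    (simp_all add: assms(2) chain_ext_add[where S=S] chain_ext_uminus)

lemma chain_ext_comp:
  assumes "z \<in> fin_chains S" "\<And>p. p \<in> S \<Longrightarrow> E p \<in> fin_chains T"
  shows "chain_ext E' (chain_ext E z) = chain_ext (\<lambda>p. chain_ext E' (E p)) z"
  using assms(1)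
proof (induction rule: chain_induct)
  case (add z w)
  then show ?case
    using chain_ext_in_fin_chains[of _ S E T] assms(2)
    by (simp add: chain_ext_add[where S=S] chain_ext_add[where S=T])
qed (simp_all add: chain_ext_uminus)

lemma chain_ext_cong:
  assumes "z \<in> fin_chains S" "\<And>p. p \<in> S \<Longrightarrow> E p = E' p"
  shows "chain_ext E z = chain_ext E' z"
  using assms(1)
  by (induction rule: chain_induct)
    (simp_all add: assms(2) chain_ext_add[where S=S] chain_ext_uminus)

lemma chain_ext_id: "z \<in> fin_chains S \<Longrightarrow> chain_ext single z = z"
  by (induction rule: chain_induct) (simp_all add: chain_ext_add[where S=S] chain_ext_uminus)

section \<open>Chains as a free abelian group and its universal property\<close>

definition chain_group :: "'p set \<Rightarrow> ('p \<Rightarrow> int) monoid" where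
  "chain_group S = \<lparr>carrier = fin_chains S, monoid.mult = (+), one = 0\<rparr>"

lemma chain_group_simps [simp]:
  "carrier (chain_group S) = fin_chains S" "monoid.mult (chain_group S) = (+)" "monoid.one (chain_group S) = 0"
  by (simp_all add: chain_group_def)

lemma comm_group_chain_group: "comm_group (chain_group S)"
proof (rule comm_groupI)
  fix z
  assume "z \<in> carrier (chain_group S)"
  then show "\<exists>w\<in>carrier (chain_group S). w \<otimes>\<^bsub>chain_group S\<^esub> z = \<one>\<^bsub>chain_group S\<^esub>"
    by (intro bexI[of _ "- z"]) simp_all
qed (simp_all add: algebra_simps)

lemma group_chain_group [simp]: "group (chain_group S)"
  by (rule comm_group.axioms(2)[OF comm_group_chain_group])

lemma chain_group_inv [simp]: "z \<in> fin_chains S \<Longrightarrow> inv\<^bsub>chain_group S\<^esub> z = - z"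
  by (rule group.inv_equality[OF comm_group.axioms(2)[OF comm_group_chain_group]]) simp_all

lemma chain_hom_uminus:
  assumes "group A" "\<alpha> \<in> hom (chain_group S) A" "z \<in> fin_chains S"
  shows "\<alpha> (- z) = inv\<^bsub>A\<^esub> (\<alpha> z)"
proof -
  interpret group_hom "chain_group S" A \<alpha>
    using assms comm_group_chain_group[of S]
    by (simp add: group_hom_def group_hom_axioms_def comm_group_def)
  show ?thesis
    using hom_inv[of z] assms by simp
qed

lemma chain_hom_add:
  "\<alpha> \<in> hom (chain_group S) A \<Longrightarrow> z \<in> fin_chains S \<Longrightarrow> w \<in> fin_chains S \<Longrightarrow> \<alpha> (z + w) = \<alpha> z \<otimes>\<^bsub>A\<^esub> \<alpha> w"
  using hom_mult[of \<alpha> "chain_group S" A z w] by simp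

lemma chain_hom_diff:
  assumes "group A" "\<alpha> \<in> hom (chain_group S) A" "z \<in> fin_chains S" "w \<in> fin_chains S"
  shows "\<alpha> (z - w) = \<alpha> z \<otimes>\<^bsub>A\<^esub> inv\<^bsub>A\<^esub> (\<alpha> w)"
  using chain_hom_add[OF assms(2), of z "- w"] chain_hom_uminus[OF assms(1,2,4)] assms(3,4) by simp

lemma chain_hom_zero:
  assumes "group A" "\<alpha> \<in> hom (chain_group S) A"
  shows "\<alpha> 0 = \<one>\<^bsub>A\<^esub>"
  using hom_one[OF assms(2) _ assms(1)] comm_group_chain_group[of S]
  by (simp add: comm_group_def)

lemma chain_hom_eq:
  assumes "group A" "\<alpha> \<in> hom (chain_group S) A" "\<beta> \<in> hom (chain_group S) A"
    and "\<And>p. p \<in> S \<Longrightarrow> \<alpha> (single p) = \<beta> (single p)" and "z \<in> fin_chains S"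
  shows "\<alpha> z = \<beta> z"
  using assms(5)
proof (induction rule: chain_induct)
  case zero
  then show ?case
    using chain_hom_zero[OF assms(1)] assms(2,3) by metis
next
  case (add z w)
  then show ?case
    using hom_mult[OF assms(2)] hom_mult[OF assms(3)] by simp
next
  case (uminus z)
  then show ?case
    using chain_hom_uminus[OF assms(1)] assms(2,3) by metis
qed (rule assms(4))

lemma chain_ext_hom:
  assumes "\<And>p. p \<in> S \<Longrightarrow> E p \<in> fin_chains T"
  shows "chain_ext E \<in> hom (chain_group S) (chain_group T)"
  by (rule homI) (simp_all add: chain_ext_in_fin_chains[where S=S] assms chain_ext_add[where S=S])

text \<open>The universal property of a free abelian group: only finitely many exponents are
  nonzero, so the product of the \<open>a p [^] z p\<close> makes sense.\<close>

lemma (in comm_group) ex_chain_hom: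
  assumes a: "\<And>p. p \<in> S \<Longrightarrow> a p \<in> carrier G"
  shows "\<exists>\<alpha>\<in>hom (chain_group S) G. \<forall>p\<in>S. \<alpha> (single p) = a p"
proof -
  define \<alpha> where "\<alpha> z = (\<Otimes>p\<in>{p. z p \<noteq> 0}. a p [^] (z p :: int))" for z
  \<comment> \<open>Factors with exponent 0 are trivial, so two chains can be evaluated over one
    common finite index set, where additivity holds factor by factor.\<close>
  have sup: "\<alpha> z = (\<Otimes>p\<in>F. a p [^] z p)" if "finite F" "F \<subseteq> S" "{p. z p \<noteq> 0} \<subseteq> F" for F z
    unfolding \<alpha>_def using that a by (intro finprod_mono_neutral_cong_left) auto
  show ?thesis
  proof (intro bexI ballI)
    fix p
    assume p: "p \<in> S"
    have "\<alpha> (single p) = (\<Otimes>q\<in>{p}. a q [^] single p q)"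
      using p by (intro sup) (auto simp: single_apply)
    also have "\<dots> = a p"
      using a[OF p] by (subst finprod_insert) (auto simp: single_apply)
    finally show "\<alpha> (single p) = a p" .
  next
    show "\<alpha> \<in> hom (chain_group S) G"
    proof (rule homI)
      fix z
      assume "z \<in> carrier (chain_group S)"
      then show "\<alpha> z \<in> carrier G"
        unfolding \<alpha>_def using a by (intro finprod_closed) (auto simp: fin_chains_def)
    next
      fix z w
      assume zw: "z \<in> carrier (chain_group S)" "w \<in> carrier (chain_group S)"
      let ?F = "{p. z p \<noteq> 0} \<union> {p. w p \<noteq> 0}"
      have F: "finite ?F" "?F \<subseteq> S"
        using zw by (auto simp: fin_chains_def)
      then have aF: "a p \<in> carrier G" if "p \<in> ?F" for p
        using a that by blast
      have "\<alpha> (z + w) = (\<Otimes>p\<in>?F. a p [^] (z + w) p)"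
        using F by (intro sup) (auto simp: fun_apply)
      also have "\<dots> = (\<Otimes>p\<in>?F. a p [^] z p \<otimes> a p [^] w p)"
        using aF by (intro finprod_cong') (auto simp: int_pow_mult fun_apply)
      also have "\<dots> = (\<Otimes>p\<in>?F. a p [^] z p) \<otimes> (\<Otimes>p\<in>?F. a p [^] w p)"
        using aF by (intro finprod_multf) auto
      also have "\<dots> = \<alpha> z \<otimes> \<alpha> w"
        using F sup[of ?F z] sup[of ?F w] by simp
      finally show "\<alpha> (z \<otimes>\<^bsub>chain_group S\<^esub> w) = \<alpha> z \<otimes> \<alpha> w"
        by simp
    qed
  qed
qed

section \<open>The bar complex and functoriality of the Schur multiplier\<close>

text \<open>Boundaries of basis elements, split off so that \<open>bd2\<close>, and with
  \<open>bar3\<close> also \<open>bd3\<close>, become instances of \<open>chain_ext\<close>.\<close>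

definition bar2 :: "('a, 'm) monoid_scheme \<Rightarrow> 'a \<times> 'a \<Rightarrow> 'a \<Rightarrow> int" where
  "bar2 G p = single (snd p) - single (fst p \<otimes>\<^bsub>G\<^esub> snd p) + single (fst p)"

definition bar3 :: "('a, 'm) monoid_scheme \<Rightarrow> 'a \<times> 'a \<times> 'a \<Rightarrow> 'a \<times> 'a \<Rightarrow> int" where
  "bar3 G q = (case q of (g, h, k) \<Rightarrow>
     single (h, k) - single (g \<otimes>\<^bsub>G\<^esub> h, k) + single (g, h \<otimes>\<^bsub>G\<^esub> k) - single (g, h))"

lemma chains2_eq: "chains2 G = fin_chains (carrier G \<times> carrier G)"
  by (simp add: chains2_def fin_chains_def)

lemma chains3_eq: "chains3 G = fin_chains (carrier G \<times> carrier G \<times> carrier G)"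
  by (simp add: chains3_def fin_chains_def)

lemma bd2_eq: "bd2 G = chain_ext (bar2 G)"
  by (simp add: fun_eq_iff bd2_def chain_ext_def bar2_def single_def fun_apply)

lemma bd3_eq: "bd3 G = chain_ext (bar3 G)"
  by (simp add: fun_eq_iff bd3_def chain_ext_def bar3_def single_def fun_apply case_prod_unfold prod_eq_iff)

lemma push2_eq:
  assumes "z \<in> fin_chains S"
  shows "push2 f z = chain_ext (\<lambda>p. single (f (fst p), f (snd p))) z"
proof
  fix q
  have "push2 f z q = sum z {p \<in> {p. z p \<noteq> 0}. (f (fst p), f (snd p)) = q}"
    by (simp add: push2_def)
  also have "\<dots> = (\<Sum>p\<in>{p. z p \<noteq> 0}. if (f (fst p), f (snd p)) = q then z p else 0)"
    by (rule sum.inter_filter[OF fin_chains_finite[OF assms]])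
  also have "\<dots> = chain_ext (\<lambda>p. single (f (fst p), f (snd p))) z q"
    unfolding chain_ext_def single_apply by (intro sum.cong) auto
  finally show "push2 f z q = chain_ext (\<lambda>p. single (f (fst p), f (snd p))) z q" .
qed

lemma push2_single [simp]: "push2 f (single p) = single (f (fst p), f (snd p))"
  using push2_eq[of "single p" UNIV] by simp

lemma push2_zero [simp]: "push2 f 0 = 0"
  using push2_eq[of 0 UNIV] by simp

lemma push2_add: "z \<in> fin_chains S \<Longrightarrow> w \<in> fin_chains S \<Longrightarrow> push2 f (z + w) = push2 f z + push2 f w"
  by (simp add: push2_eq[where S=S] chain_ext_add[where S=S])

lemma push2_diff: "z \<in> fin_chains S \<Longrightarrow> w \<in> fin_chains S \<Longrightarrow> push2 f (z - w) = push2 f z - push2 f w"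
  by (simp add: push2_eq[where S=S] chain_ext_diff[where S=S])

lemma push2_in_chains2:
  assumes "z \<in> chains2 K" "\<And>x. x \<in> carrier K \<Longrightarrow> f x \<in> carrier G"
  shows "push2 f z \<in> chains2 G"
  using assms unfolding chains2_eq push2_eq[OF assms(1)[unfolded chains2_eq]]
  by (intro chain_ext_in_fin_chains[OF assms(1)[unfolded chains2_eq]]) auto

lemma push2_hom:
  fixes K :: "('b, 'n) monoid_scheme" and G :: "('a, 'm) monoid_scheme"
  assumes "\<And>x. x \<in> carrier K \<Longrightarrow> f x \<in> carrier G"
  shows "push2 f \<in> hom (chain_group (carrier K \<times> carrier K)) (chain_group (carrier G \<times> carrier G))"
  using push2_in_chains2[where K=K and f=f and G=G] assms
  by (intro homI) (auto simp: chains2_eq push2_add)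

lemma push2_comp:
  assumes "z \<in> chains2 K" "\<And>x. x \<in> carrier K \<Longrightarrow> d (f x) = c x"
  shows "push2 d (push2 f z) = push2 c z"
proof -
  have z: "z \<in> fin_chains (carrier K \<times> carrier K)"
    using assms(1) by (simp add: chains2_eq)
  have fz: "push2 f z \<in> fin_chains UNIV"
    unfolding push2_eq[OF z] by (rule chain_ext_in_fin_chains[OF z]) simp
  show ?thesis
    unfolding push2_eq[OF fz] unfolding push2_eq[OF z]
    by (subst chain_ext_comp[OF z, where T=UNIV])
      (auto intro!: chain_ext_cong[OF z] simp: assms(2))
qed

lemma bar2_in_fin_chains: "group G \<Longrightarrow> p \<in> carrier G \<times> carrier G \<Longrightarrow> bar2 G p \<in> fin_chains (carrier G)"
  by (auto simp: bar2_def group.subgroup_self subgroup.m_closed)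

lemma bar3_in_fin_chains:
  "group G \<Longrightarrow> q \<in> carrier G \<times> carrier G \<times> carrier G \<Longrightarrow> bar3 G q \<in> fin_chains (carrier G \<times> carrier G)"
  by (auto simp: bar3_def group.subgroup_self subgroup.m_closed)

lemma bd2_in_fin_chains: "group G \<Longrightarrow> z \<in> chains2 G \<Longrightarrow> bd2 G z \<in> fin_chains (carrier G)"
  unfolding bd2_eq chains2_eq
  by (erule chain_ext_in_fin_chains) (rule bar2_in_fin_chains)

lemma bd2_hom: "group G \<Longrightarrow> bd2 G \<in> hom (chain_group (carrier G \<times> carrier G)) (chain_group (carrier G))"
  unfolding bd2_eq by (intro chain_ext_hom bar2_in_fin_chains)

lemma bd2_add: "z \<in> chains2 G \<Longrightarrow> w \<in> chains2 G \<Longrightarrow> bd2 G (z + w) = bd2 G z + bd2 G w"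
  unfolding bd2_eq chains2_eq by (rule chain_ext_add)

lemma bd2_diff: "z \<in> chains2 G \<Longrightarrow> w \<in> chains2 G \<Longrightarrow> bd2 G (z - w) = bd2 G z - bd2 G w"
  unfolding bd2_eq chains2_eq by (rule chain_ext_diff)

lemma bd2_uminus: "bd2 G (- z) = - bd2 G z"
  unfolding bd2_eq by (rule chain_ext_uminus)

lemma bd2_zero [simp]: "bd2 G 0 = 0"
  unfolding bd2_eq by simp

lemma bd2_single: "bd2 G (single p) = bar2 G p"
  unfolding bd2_eq by simp

lemma bd3_single: "bd3 G (single q) = bar3 G q"
  unfolding bd3_eq by simp

lemma bd3_in_chains2: "group G \<Longrightarrow> w \<in> chains3 G \<Longrightarrow> bd3 G w \<in> chains2 G"
  unfolding bd3_eq chains2_eq chains3_eq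
  by (erule chain_ext_in_fin_chains) (rule bar3_in_fin_chains)

lemma bd2_push2:
  assumes "group K" "group G" "c \<in> hom K G" "z \<in> chains2 K"
  shows "bd2 G (push2 c z) = chain_ext (\<lambda>x. single (c x)) (bd2 K z)"
proof -
  have z: "z \<in> fin_chains (carrier K \<times> carrier K)"
    using assms(4) by (simp add: chains2_eq)
  have sub: "chain_ext (bar2 G) (single (c (fst p), c (snd p))) = chain_ext (\<lambda>x. single (c x)) (bar2 K p)"
    if "p \<in> carrier K \<times> carrier K" for p
    using that assms(1) hom_mult[OF assms(3)]
    by (auto simp: bar2_def chain_ext_add[where S=UNIV] chain_ext_diff[where S=UNIV])
  have c: "c x \<in> carrier G" if "x \<in> carrier K" for x
    using hom_in_carrier[OF assms(3) that] .
  have "chain_ext (bar2 G) (chain_ext (\<lambda>p. single (c (fst p), c (snd p))) z) =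
      chain_ext (\<lambda>p. chain_ext (bar2 G) (single (c (fst p), c (snd p)))) z"
    by (rule chain_ext_comp[OF z, where T="carrier G \<times> carrier G"]) (use c in auto)
  also have "\<dots> = chain_ext (\<lambda>p. chain_ext (\<lambda>x. single (c x)) (bar2 K p)) z"
    by (rule chain_ext_cong[OF z sub])
  also have "\<dots> = chain_ext (\<lambda>x. single (c x)) (chain_ext (bar2 K) z)"
    by (rule chain_ext_comp[OF z bar2_in_fin_chains[OF assms(1)], symmetric])
  finally show ?thesis
    unfolding push2_eq[OF z] bd2_eq .
qed

lemma push2_bd3:
  assumes "group K" "group G" "c \<in> hom K G" "w \<in> chains3 K"
  shows "push2 c (bd3 K w) \<in> bounds2 G"
proof -
  have w: "w \<in> fin_chains (carrier K \<times> carrier K \<times> carrier K)"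
    using assms(4) by (simp add: chains3_eq)
  have c: "c x \<in> carrier G" if "x \<in> carrier K" for x
    using hom_in_carrier[OF assms(3) that] .
  let ?c3 = "\<lambda>q. single (c (fst q), c (fst (snd q)), c (snd (snd q)))"
  have sub: "chain_ext (\<lambda>p. single (c (fst p), c (snd p))) (bar3 K q) = chain_ext (bar3 G) (?c3 q)"
    if "q \<in> carrier K \<times> carrier K \<times> carrier K" for q
    using that hom_mult[OF assms(3)]
    by (auto simp: bar3_def chain_ext_add[where S=UNIV] chain_ext_diff[where S=UNIV])
  let ?P = "\<lambda>p. single (c (fst p), c (snd p))"
  have "chain_ext ?P (chain_ext (bar3 K) w) = chain_ext (\<lambda>q. chain_ext ?P (bar3 K q)) w"
    by (rule chain_ext_comp[OF w bar3_in_fin_chains[OF assms(1)]])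
  also have "\<dots> = chain_ext (\<lambda>q. chain_ext (bar3 G) (?c3 q)) w"
    by (rule chain_ext_cong[OF w sub])
  also have "\<dots> = chain_ext (bar3 G) (chain_ext ?c3 w)"
    by (rule chain_ext_comp[OF w, where T="carrier G \<times> carrier G \<times> carrier G", symmetric])
      (use c in auto)
  finally have "push2 c (bd3 K w) = bd3 G (chain_ext ?c3 w)"
    unfolding push2_eq[OF bd3_in_chains2[OF assms(1,4), unfolded chains2_eq]] unfolding bd3_eq .
  moreover have "chain_ext ?c3 w \<in> chains3 G"
    unfolding chains3_eq by (rule chain_ext_in_fin_chains[OF w]) (use c in force)
  ultimately show ?thesis
    unfolding bounds2_def by blast
qed

lemma bd2_bd3:
  assumes "group G" "w \<in> chains3 G"
  shows "bd2 G (bd3 G w) = 0"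
proof -
  interpret group G by fact
  have w: "w \<in> fin_chains (carrier G \<times> carrier G \<times> carrier G)"
    using assms by (simp add: chains3_eq)
  have "bd2 G (bd3 G w) = chain_ext (\<lambda>q. 0) w"
    unfolding bd2_eq bd3_eq
    by (subst chain_ext_comp[OF w bar3_in_fin_chains[OF assms(1)]])
      (auto intro!: chain_ext_cong[OF w]
        simp: bar3_def bar2_def chain_ext_add[where S=UNIV] chain_ext_diff[where S=UNIV] m_assoc)
  then show ?thesis
    by (simp add: chain_ext_def fun_eq_iff fun_apply)
qed

section \<open>Cycles, boundaries and homology classes\<close>

lemma cycles2_eq: "cycles2 G = {z \<in> chains2 G. bd2 G z = 0}"
  by (simp add: cycles2_def zero_fun_def)

lemma cycles2_closed:
  "0 \<in> cycles2 G" "z \<in> cycles2 G \<Longrightarrow> w \<in> cycles2 G \<Longrightarrow> z + w \<in> cycles2 G"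
  "z \<in> cycles2 G \<Longrightarrow> - z \<in> cycles2 G"
  "z \<in> cycles2 G \<Longrightarrow> w \<in> cycles2 G \<Longrightarrow> z - w \<in> cycles2 G"
  by (simp_all add: cycles2_eq bd2_add bd2_diff bd2_uminus) (simp_all add: chains2_eq)

lemma bounds2_closed:
  "0 \<in> bounds2 G" "z \<in> bounds2 G \<Longrightarrow> w \<in> bounds2 G \<Longrightarrow> z + w \<in> bounds2 G"
  "z \<in> bounds2 G \<Longrightarrow> - z \<in> bounds2 G"
  "z \<in> bounds2 G \<Longrightarrow> w \<in> bounds2 G \<Longrightarrow> z - w \<in> bounds2 G"
proof -
  show "0 \<in> bounds2 G"
    unfolding bounds2_def chains3_eq bd3_eq by (rule image_eqI[of _ _ 0]) simp_all
  show un: "- z \<in> bounds2 G" if "z \<in> bounds2 G" for z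
  proof -
    from that obtain w where "w \<in> chains3 G" "z = bd3 G w"
      by (auto simp: bounds2_def)
    then show ?thesis
      unfolding bounds2_def chains3_eq bd3_eq
      by (intro image_eqI[of _ _ "- w"]) (simp_all add: chain_ext_uminus)
  qed
  show ad: "z + w \<in> bounds2 G" if "z \<in> bounds2 G" "w \<in> bounds2 G" for z w
  proof -
    from that obtain u v where "u \<in> chains3 G" "z = bd3 G u" "v \<in> chains3 G" "w = bd3 G v"
      by (auto simp: bounds2_def)
    then show ?thesis
      unfolding bounds2_def chains3_eq bd3_eq
      by (intro image_eqI[of _ _ "u + v"]) (simp_all add: chain_ext_add)
  qed
  show "z - w \<in> bounds2 G" if "z \<in> bounds2 G" "w \<in> bounds2 G" for z w
    using ad[OF that(1) un[OF that(2)]] by simp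
qed

lemma bounds2_subset_cycles2: "group G \<Longrightarrow> bounds2 G \<subseteq> cycles2 G"
  by (auto simp: bounds2_def cycles2_eq bd3_in_chains2 bd2_bd3)

lemma Z2grp_simps [simp]:
  "carrier (Z2grp G) = cycles2 G" "monoid.mult (Z2grp G) = (+)" "monoid.one (Z2grp G) = 0"
  by (simp_all add: Z2grp_def fun_eq_iff fun_apply zero_fun_def)

lemma comm_group_Z2grp: "comm_group (Z2grp G)"
proof (rule comm_groupI)
  fix z
  assume "z \<in> carrier (Z2grp G)"
  then show "\<exists>w\<in>carrier (Z2grp G). w \<otimes>\<^bsub>Z2grp G\<^esub> z = \<one>\<^bsub>Z2grp G\<^esub>"
    by (intro bexI[of _ "- z"]) (simp_all add: cycles2_closed)
qed (simp_all add: algebra_simps cycles2_closed)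

lemma group_Z2grp: "group (Z2grp G)"
  using comm_group_Z2grp by (rule comm_group.axioms(2))

lemma Z2grp_inv [simp]: "z \<in> cycles2 G \<Longrightarrow> inv\<^bsub>Z2grp G\<^esub> z = - z"
  by (rule group.inv_equality[OF group_Z2grp]) (simp_all add: cycles2_closed)

lemma subgroup_Z2grp_iff:
  "subgroup B (Z2grp G) \<longleftrightarrow> B \<subseteq> cycles2 G \<and> 0 \<in> B \<and> (\<forall>z\<in>B. \<forall>w\<in>B. z + w \<in> B) \<and> (\<forall>z\<in>B. - z \<in> B)"
  (is "_ \<longleftrightarrow> ?R")
proof
  assume "subgroup B (Z2grp G)"
  then interpret subgroup B "Z2grp G" .
  have "- z \<in> B" if "z \<in> B" for z
    using m_inv_closed[OF that] mem_carrier[OF that] by simp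
  then show ?R
    using subset one_closed m_closed by simp
next
  assume R: ?R
  then have "inv\<^bsub>Z2grp G\<^esub> z \<in> B" if "z \<in> B" for z
    using that by (metis Z2grp_inv subsetD)
  with R show "subgroup B (Z2grp G)"
    by (intro subgroup.intro) auto
qed

lemma subgroup_bounds2: "group G \<Longrightarrow> subgroup (bounds2 G) (Z2grp G)"
  unfolding subgroup_Z2grp_iff using bounds2_subset_cycles2 bounds2_closed by blast

abbreviation hclass :: "('a, 'm) monoid_scheme \<Rightarrow> ('a \<times> 'a \<Rightarrow> int) \<Rightarrow> ('a \<times> 'a \<Rightarrow> int) set" where
  "hclass G z \<equiv> bounds2 G #>\<^bsub>Z2grp G\<^esub> z"

lemma (in group) r_coset_eq_iff:
  assumes "subgroup H G" "x \<in> carrier G" "y \<in> carrier G"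
  shows "H #> x = H #> y \<longleftrightarrow> x \<otimes> inv y \<in> H"
proof -
  have "H #> x = H #> y \<longleftrightarrow> x \<in> H #> y"
    using repr_independence[OF _ assms(3,1)] rcos_self[OF assms(2,1)] by auto
  also have "\<dots> \<longleftrightarrow> x \<otimes> inv y \<in> H"
    using subgroup.rcos_module[OF assms(1) is_group assms(3,2)] .
  finally show ?thesis .
qed

lemma Z2grp_coset_eq_iff:
  assumes "subgroup B (Z2grp G)" "z \<in> cycles2 G" "w \<in> cycles2 G"
  shows "B #>\<^bsub>Z2grp G\<^esub> z = B #>\<^bsub>Z2grp G\<^esub> w \<longleftrightarrow> z - w \<in> B"
  using group.r_coset_eq_iff[OF group_Z2grp assms(1), of z w] assms(2,3) by simp

lemma hclass_eq_iff:
  "group G \<Longrightarrow> z \<in> cycles2 G \<Longrightarrow> w \<in> cycles2 G \<Longrightarrow> hclass G z = hclass G w \<longleftrightarrow> z - w \<in> bounds2 G"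
  by (rule Z2grp_coset_eq_iff[OF subgroup_bounds2])

lemma carrier_H2: "carrier (H2 G) = hclass G ` cycles2 G"
  by (simp add: H2_def carrier_FactGroup)

lemma hclass_hom: "group G \<Longrightarrow> hclass G \<in> hom (Z2grp G) (H2 G)"
  unfolding H2_def
  by (rule normal.r_coset_hom_Mod) (rule comm_group.subgroup_imp_normal[OF comm_group_Z2grp subgroup_bounds2])

lemma group_H2: "group G \<Longrightarrow> group (H2 G)"
  unfolding H2_def
  by (rule normal.factorgroup_is_group) (rule comm_group.subgroup_imp_normal[OF comm_group_Z2grp subgroup_bounds2])

text \<open>Subgroups of \<open>H2 G\<close> correspond to groups of cycles that contain the
  boundaries. The covers are built from such a group of cycles, which spares a quotient of a
  quotient.\<close>

lemma subgroup_hclass_vimage: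
  assumes "group G" and S: "subgroup S (H2 G)"
  defines "B \<equiv> {z \<in> cycles2 G. hclass G z \<in> S}"
  shows "subgroup B (Z2grp G)" "bounds2 G \<subseteq> B" "hclass G ` B = S"
proof -
  interpret hc: group_hom "Z2grp G" "H2 G" "hclass G"
    using group_Z2grp group_H2[OF assms(1)] hclass_hom[OF assms(1)]
    by (simp add: group_hom_def group_hom_axioms_def)
  have zero: "0 \<in> B"
    using hc.hom_one subgroup.one_closed[OF S] by (simp add: B_def cycles2_closed)
  show "subgroup B (Z2grp G)"
  proof (rule hc.G.subgroupI)
    fix z w
    assume "z \<in> B" "w \<in> B"
    then have zw: "z \<in> cycles2 G" "w \<in> cycles2 G" "hclass G z \<in> S" "hclass G w \<in> S"
      by (simp_all add: B_def)
    have "hclass G (z \<otimes>\<^bsub>Z2grp G\<^esub> w) = hclass G z \<otimes>\<^bsub>H2 G\<^esub> hclass G w"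
      by (rule hc.hom_mult) (use zw in simp_all)
    then show "z \<otimes>\<^bsub>Z2grp G\<^esub> w \<in> B"
      using subgroup.m_closed[OF S zw(3,4)] zw(1,2) by (simp add: B_def cycles2_closed)
    have "hclass G (inv\<^bsub>Z2grp G\<^esub> z) = inv\<^bsub>H2 G\<^esub> hclass G z"
      by (rule hc.hom_inv) (use zw in simp)
    then show "inv\<^bsub>Z2grp G\<^esub> z \<in> B"
      using subgroup.m_inv_closed[OF S zw(3)] zw(1) by (simp add: B_def cycles2_closed)
  qed (use zero in \<open>auto simp: B_def\<close>)
  show "bounds2 G \<subseteq> B"
  proof
    fix b
    assume b: "b \<in> bounds2 G"
    then have cyc: "b \<in> cycles2 G"
      using bounds2_subset_cycles2[OF assms(1)] by blast
    then have "hclass G b = hclass G 0"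
      using hclass_eq_iff[OF assms(1) cyc cycles2_closed(1)] b by simp
    then show "b \<in> B"
      using cyc zero by (simp add: B_def)
  qed
  show "hclass G ` B = S"
    using subgroup.subset[OF S] unfolding carrier_H2 by (auto simp: B_def)
qed

section \<open>Induced maps on homology and their images\<close>

lemma push2_cycles2:
  assumes "group K" "group G" "c \<in> hom K G" "z \<in> cycles2 K"
  shows "push2 c z \<in> cycles2 G"
  using assms push2_in_chains2[where K=K and f=c and G=G] bd2_push2[OF assms(1-3)]
  by (auto simp: cycles2_eq hom_def)

lemma push2_bounds2:
  assumes "group K" "group G" "c \<in> hom K G" "z \<in> bounds2 K"
  shows "push2 c z \<in> bounds2 G"
  using assms push2_bd3 by (auto simp: bounds2_def)

text \<open>\<open>H2map\<close> evaluates at a chosen representative; any other one differs by a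
  boundary, which \<open>push2\<close> sends to a boundary.\<close>

lemma H2map_hclass:
  assumes "group K" "group G" "c \<in> hom K G" "z \<in> cycles2 K"
  shows "H2map G c (hclass K z) = hclass G (push2 c z)"
proof -
  define w where "w = (SOME w. w \<in> hclass K z)"
  have "z \<in> hclass K z"
    using group.rcos_self[OF group_Z2grp _ subgroup_bounds2[OF assms(1)]] assms(4) by simp
  then have "w \<in> hclass K z"
    unfolding w_def by (rule someI[of "\<lambda>w. w \<in> hclass K z"])
  then obtain b where b: "b \<in> bounds2 K" "w = b + z"
    by (auto simp: r_coset_def)
  then have w: "w \<in> cycles2 K"
    using bounds2_subset_cycles2[OF assms(1)] assms(4) cycles2_closed(2) by blast
  have "push2 c w - push2 c z = push2 c b"
    using push2_diff[of w "carrier K \<times> carrier K" z c] w assms(4) b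
    by (simp add: cycles2_eq chains2_eq)
  also have "\<dots> \<in> bounds2 G"
    using push2_bounds2[OF assms(1-3) b(1)] .
  finally have "hclass G (push2 c w) = hclass G (push2 c z)"
    using hclass_eq_iff[OF assms(2)] push2_cycles2[OF assms(1-3)] w assms(4) by blast
  then show ?thesis
    by (simp add: H2map_def w_def)
qed

lemma H2image_eq:
  assumes "group K" "group G" "c \<in> hom K G"
  shows "H2image K G c = (\<lambda>z. hclass G (push2 c z)) ` cycles2 K"
  unfolding H2image_def carrier_H2 using H2map_hclass[OF assms] by (auto simp: image_image)

lemma subgroup_H2image:
  assumes "group K" "group G" "c \<in> hom K G"
  shows "subgroup (H2image K G c) (H2 G)"
proof -
  have "push2 c \<in> hom (Z2grp K) (Z2grp G)"
    using push2_cycles2[OF assms] push2_add[of _ "carrier K \<times> carrier K"]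
    by (intro homI) (auto simp: cycles2_eq chains2_eq)
  then have "hclass G \<circ> push2 c \<in> hom (Z2grp K) (H2 G)"
    using hclass_hom[OF assms(2)] by (rule hom_compose)
  then interpret group_hom "Z2grp K" "H2 G" "hclass G \<circ> push2 c"
    using group_Z2grp group_H2[OF assms(2)] by (simp add: group_hom_def group_hom_axioms_def)
  show ?thesis
    using img_is_subgroup by (simp add: H2image_eq[OF assms] o_def)
qed

text \<open>Functoriality on cycles, and the necessity half of the lifting criterion. Only values on
  carriers enter, so with \<open>f\<close> the identity it also compares maps that agree on the
  carrier.\<close>

lemma H2image_factor:
  assumes "group K" "group Y" "group G" "c \<in> hom K G" "d \<in> hom Y G" "f \<in> hom K Y"
    and "\<And>x. x \<in> carrier K \<Longrightarrow> d (f x) = c x"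
  shows "H2image K G c \<subseteq> H2image Y G d"
proof -
  have "push2 c z = push2 d (push2 f z)" if "z \<in> cycles2 K" for z
    using push2_comp[of z K d f c] that assms(7) by (simp add: cycles2_eq)
  then show ?thesis
    using push2_cycles2[OF assms(1,2,6)]
    unfolding H2image_eq[OF assms(1,3,4)] H2image_eq[OF assms(2,3,5)] by auto
qed

lemma H2map_H2image:
  assumes "group K" "group G" "group L" "c \<in> hom K G" "h \<in> hom G L"
  shows "H2map L h ` H2image K G c = H2image K L (\<lambda>x. h (c x))"
proof -
  have hc: "(\<lambda>x. h (c x)) \<in> hom K L"
    using hom_compose[OF assms(4,5)] by (simp add: o_def)
  have "H2map L h (hclass G (push2 c z)) = hclass L (push2 (\<lambda>x. h (c x)) z)" if "z \<in> cycles2 K" for z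
    using H2map_hclass[OF assms(2,3,5) push2_cycles2[OF assms(1,2,4) that]]
      push2_comp[of z K h c] that by (simp add: cycles2_eq)
  then show ?thesis
    unfolding H2image_eq[OF assms(1,2,4)] H2image_eq[OF assms(1,3) hc] by (auto simp: image_image)
qed

section \<open>Perfect groups and central extensions\<close>

abbreviation perfect :: "('a, 'm) monoid_scheme \<Rightarrow> bool" where
  "perfect G \<equiv> derived G (carrier G) = carrier G"

lemma (in group_hom) derived_subset_kernel:
  assumes "\<And>x y. x \<in> carrier G \<Longrightarrow> y \<in> carrier G \<Longrightarrow> h x \<otimes>\<^bsub>H\<^esub> h y = h y \<otimes>\<^bsub>H\<^esub> h x"
  shows "derived G (carrier G) \<subseteq> kernel G H h"
  unfolding derived_def
proof (rule G.generate_subgroup_incl[OF _ subgroup_kernel], clarify)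
  fix x y
  assume xy: "x \<in> carrier G" "y \<in> carrier G"
  have "h (x \<otimes> y \<otimes> inv x \<otimes> inv y) = (h y \<otimes>\<^bsub>H\<^esub> h x) \<otimes>\<^bsub>H\<^esub> inv\<^bsub>H\<^esub> h x \<otimes>\<^bsub>H\<^esub> inv\<^bsub>H\<^esub> h y"
    using xy by (simp add: assms)
  also have "\<dots> = \<one>\<^bsub>H\<^esub>"
    using xy by (simp add: H.m_assoc)
  finally show "x \<otimes> y \<otimes> inv x \<otimes> inv y \<in> kernel G H h"
    using xy by (simp add: kernel_def)
qed

text \<open>Commutativity is asked of the image only, because the lemma is also applied to maps into
  the simple group itself.\<close>

lemma perfect_hom_trivial:
  assumes "group K" "group H" "f \<in> hom K H" "perfect K" "x \<in> carrier K"
    and "\<And>x y. x \<in> carrier K \<Longrightarrow> y \<in> carrier K \<Longrightarrow> f x \<otimes>\<^bsub>H\<^esub> f y = f y \<otimes>\<^bsub>H\<^esub> f x"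
  shows "f x = \<one>\<^bsub>H\<^esub>"
proof -
  interpret group_hom K H f
    using assms(1-3) by (simp add: group_hom_def group_hom_axioms_def)
  have "x \<in> kernel K H f"
    using derived_subset_kernel[OF assms(6)] assms(4,5) by auto
  then show ?thesis
    by (simp add: kernel_def)
qed

text \<open>Modulo the image of \<open>bd2\<close> the basis elements of the 1-chains multiply like the group, so this
  quotient receives a homomorphism from the group, which is trivial by perfectness.\<close>

lemma perfect_bd2_surj:
  assumes "group K" "perfect K" "x \<in> carrier K"
  shows "\<exists>z\<in>chains2 K. bd2 K z = single x"
proof -
  interpret K: group K by fact
  let ?C1 = "chain_group (carrier K)" and ?C2 = "chain_group (carrier K \<times> carrier K)"
  define B where "B = bd2 K ` chains2 K"
  interpret C1: comm_group ?C1 by (rule comm_group_chain_group)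
  interpret bd2: group_hom ?C2 ?C1 "bd2 K"
    using bd2_hom[OF assms(1)] by (simp add: group_hom_def group_hom_axioms_def)
  have B: "subgroup B ?C1"
    using bd2.img_is_subgroup by (simp add: B_def chains2_eq)
  interpret B: normal B ?C1
    using C1.subgroup_imp_normal[OF B] .
  interpret Q: comm_group "?C1 Mod B"
    using C1.abelian_FactGroup[OF B] .
  let ?q = "\<lambda>x. B #>\<^bsub>?C1\<^esub> single x"
  have hom: "?q \<in> hom K (?C1 Mod B)"
  proof (rule homI)
    fix x y
    assume xy: "x \<in> carrier K" "y \<in> carrier K"
    have "single (x, y) \<in> chains2 K"
      using xy by (simp add: chains2_eq)
    then have "- bar2 K (x, y) \<in> B"
      using B.m_inv_closed[of "bar2 K (x, y)"] bar2_in_fin_chains[OF assms(1), of "(x, y)"] xy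
      unfolding B_def bd2_single[symmetric] by auto
    then have "?q (x \<otimes>\<^bsub>K\<^esub> y) = B #>\<^bsub>?C1\<^esub> (single x + single y)"
      using xy by (subst C1.r_coset_eq_iff[OF B]) (simp_all add: bar2_def algebra_simps)
    then show "?q (x \<otimes>\<^bsub>K\<^esub> y) = ?q x \<otimes>\<^bsub>?C1 Mod B\<^esub> ?q y"
      using B.rcos_sum[of "single x" "single y"] xy by simp
  qed (use C1.rcosetsI[OF B.subset] in \<open>simp add: FactGroup_def\<close>)
  have "?q x = \<one>\<^bsub>?C1 Mod B\<^esub>"
    by (rule perfect_hom_trivial[OF assms(1) Q.is_group hom assms(2,3)])
      (intro Q.m_comm hom_in_carrier[OF hom])
  then have "?q x = B"
    by simp
  then have "single x \<in> B"
    using C1.rcos_self[of "single x" B] B assms(3) by simp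
  then show ?thesis
    by (auto simp: B_def)
qed

section \<open>Lifting homomorphisms along a central extension\<close>

locale central_ext = E: group E + G: group G
  for E (structure) and G (structure) +
  fixes \<pi>
  assumes \<pi>_hom: "\<pi> \<in> hom E G"
    and \<pi>_surj: "\<pi> ` carrier E = carrier G"
    and central: "n \<in> carrier E \<Longrightarrow> \<pi> n = \<one>\<^bsub>G\<^esub> \<Longrightarrow> x \<in> carrier E \<Longrightarrow> n \<otimes> x = x \<otimes> n"
begin

sublocale \<pi>: group_hom E G \<pi>
  using \<pi>_hom by unfold_locales

abbreviation "Ker \<equiv> E\<lparr>carrier := kernel E G \<pi>\<rparr>"

lemma in_Ker [simp]: "n \<in> kernel E G \<pi> \<longleftrightarrow> n \<in> carrier E \<and> \<pi> n = \<one>\<^bsub>G\<^esub>"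
  by (auto simp: kernel_def)

lemma comm_group_Ker: "comm_group Ker"
proof -
  interpret group Ker
    by (rule subgroup.subgroup_is_group[OF \<pi>.subgroup_kernel E.is_group])
  show ?thesis
    by (rule group_comm_groupI) (auto intro: central)
qed

lemma hom_Ker: "\<alpha> \<in> hom A Ker \<longleftrightarrow> \<alpha> \<in> hom A E \<and> (\<forall>z\<in>carrier A. \<pi> (\<alpha> z) = \<one>\<^bsub>G\<^esub>)"
  by (auto simp: hom_def Pi_def)

text \<open>Homomorphisms with central values act on all homomorphisms by multiplication. With
  \<open>f\<close> the identity, a map into the kernel yields a second endomorphism over
  \<open>\<pi>\<close>.\<close>

lemma hom_E_of_central:
  assumes "f \<in> hom K E" "\<theta> \<in> hom K E" "\<And>x. x \<in> carrier K \<Longrightarrow> \<pi> (\<theta> x) = \<one>\<^bsub>G\<^esub>"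
  shows "(\<lambda>x. \<theta> x \<otimes> f x) \<in> hom K E"
proof (rule homI)
  fix x y
  assume xy: "x \<in> carrier K" "y \<in> carrier K"
  have c: "f x \<in> carrier E" "f y \<in> carrier E" "\<theta> x \<in> carrier E" "\<theta> y \<in> carrier E"
    using xy assms(1,2) by (auto simp: hom_def)
  have "\<theta> x \<otimes> \<theta> y \<otimes> (f x \<otimes> f y) = \<theta> x \<otimes> (\<theta> y \<otimes> f x) \<otimes> f y"
    using c by (simp add: E.m_assoc)
  also have "\<theta> y \<otimes> f x = f x \<otimes> \<theta> y"
    using central[of "\<theta> y" "f x"] c assms(3) xy by simp
  finally show "\<theta> (x \<otimes>\<^bsub>K\<^esub> y) \<otimes> f (x \<otimes>\<^bsub>K\<^esub> y) = \<theta> x \<otimes> f x \<otimes> (\<theta> y \<otimes> f y)"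
    using c xy hom_mult[OF assms(1)] hom_mult[OF assms(2)] by (simp add: E.m_assoc)
qed (use assms in \<open>auto simp: hom_def\<close>)

lemma hom_diff_central:
  assumes "f \<in> hom K E" "g \<in> hom K E" "\<And>x. x \<in> carrier K \<Longrightarrow> \<pi> (f x) = \<pi> (g x)"
  shows "(\<lambda>x. f x \<otimes> inv (g x)) \<in> hom K Ker"
  unfolding hom_Ker
proof (intro conjI ballI)
  show "\<pi> (f x \<otimes> inv g x) = \<one>\<^bsub>G\<^esub>" if "x \<in> carrier K" for x
    using that assms by (auto simp: hom_def Pi_def)
  show "(\<lambda>x. f x \<otimes> inv g x) \<in> hom K E"
  proof (rule homI)
    fix x y
    assume xy: "x \<in> carrier K" "y \<in> carrier K"
    have c: "f x \<in> carrier E" "f y \<in> carrier E" "g x \<in> carrier E" "g y \<in> carrier E"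
      using xy assms(1,2) by (auto simp: hom_def)
    have "f x \<otimes> f y \<otimes> inv (g x \<otimes> g y) = f x \<otimes> ((f y \<otimes> inv g y) \<otimes> inv g x)"
      using c by (simp add: E.m_assoc E.inv_mult_group)
    also have "(f y \<otimes> inv g y) \<otimes> inv g x = inv g x \<otimes> (f y \<otimes> inv g y)"
      using c assms(3)[OF xy(2)] by (intro central) auto
    finally show "f (x \<otimes>\<^bsub>K\<^esub> y) \<otimes> inv g (x \<otimes>\<^bsub>K\<^esub> y) = f x \<otimes> inv g x \<otimes> (f y \<otimes> inv g y)"
      using c xy hom_mult[OF assms(1)] hom_mult[OF assms(2)] by (simp add: E.m_assoc)
  qed (use assms in \<open>auto simp: hom_def Pi_def\<close>)
qed

text \<open>Two lifts differ by a homomorphism into the abelian kernel, which is trivial on a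
  perfect group.\<close>

lemma lifts_unique:
  assumes "group K" "perfect K" "f \<in> hom K E" "g \<in> hom K E"
    and "\<And>x. x \<in> carrier K \<Longrightarrow> \<pi> (f x) = \<pi> (g x)" and x: "x \<in> carrier K"
  shows "f x = g x"
proof -
  interpret Ker: comm_group Ker by (rule comm_group_Ker)
  have h: "(\<lambda>x. f x \<otimes> inv (g x)) \<in> hom K Ker"
    by (rule hom_diff_central[OF assms(3-5)])
  have "f x \<otimes> inv (g x) = \<one>\<^bsub>Ker\<^esub>"
    by (rule perfect_hom_trivial[OF assms(1) Ker.is_group h assms(2) x])
      (intro Ker.m_comm hom_in_carrier[OF h])
  then show ?thesis
    using assms(3,4) x by (auto simp: hom_def Pi_def E.inv_solve_right' intro: E.inv_equality dest: E.right_cancel)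
qed

text \<open>\<open>\<alpha>\<close> is the linear extension of the factor set of the section \<open>s\<close>. If it vanishes on the
  cycles pushed forward from \<open>K\<close>, then \<open>\<alpha> \<circ> push2 c\<close> factors through \<open>bd2\<close>, which is onto the
  1-chains; this makes the factor set pulled back along \<open>c\<close> a coboundary.\<close>

lemma lift_if_factor_set_trivial:
  assumes K: "group K" "perfect K" and c: "c \<in> hom K G"
    and s: "\<And>g. g \<in> carrier G \<Longrightarrow> s g \<in> carrier E" "\<And>g. g \<in> carrier G \<Longrightarrow> \<pi> (s g) = g"
    and \<alpha>: "\<alpha> \<in> hom (chain_group (carrier G \<times> carrier G)) Ker"
    and \<alpha>_s: "\<And>g h. g \<in> carrier G \<Longrightarrow> h \<in> carrier G \<Longrightarrow> \<alpha> (single (g, h)) \<otimes> s (g \<otimes>\<^bsub>G\<^esub> h) = s g \<otimes> s h"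
    and triv: "\<And>z. z \<in> cycles2 K \<Longrightarrow> \<alpha> (push2 c z) = \<one>"
  shows "\<exists>f\<in>hom K E. \<forall>x\<in>carrier K. \<pi> (f x) = c x"
proof -
  interpret K: group K by fact
  have cc: "c x \<in> carrier G" if "x \<in> carrier K" for x
    using hom_in_carrier[OF c that] .
  obtain Z where Z: "\<And>x. x \<in> carrier K \<Longrightarrow> Z x \<in> chains2 K" "\<And>x. x \<in> carrier K \<Longrightarrow> bd2 K (Z x) = single x"
    using perfect_bd2_surj[OF K] by metis
  have \<alpha>E: "\<alpha> \<in> hom (chain_group (carrier G \<times> carrier G)) E"
    using \<alpha> unfolding hom_Ker by blast
  have \<alpha>p: "\<alpha> (push2 c z) \<in> carrier E" "\<pi> (\<alpha> (push2 c z)) = \<one>\<^bsub>G\<^esub>" if "z \<in> chains2 K" for z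
    using push2_in_chains2[OF that cc] \<alpha> unfolding hom_Ker by (auto simp: chains2_eq hom_def)
  have \<alpha>add: "\<alpha> (push2 c (z + w)) = \<alpha> (push2 c z) \<otimes> \<alpha> (push2 c w)"
    if "z \<in> chains2 K" "w \<in> chains2 K" for z w
    using push2_in_chains2[OF that(1) cc] push2_in_chains2[OF that(2) cc] that
      hom_mult[OF \<alpha>E] by (simp add: chains2_eq push2_add[where S="carrier K \<times> carrier K"])
  define \<beta> where "\<beta> x = \<alpha> (push2 c (Z x))" for x
  have \<beta>: "\<beta> x \<in> carrier E" "\<pi> (\<beta> x) = \<one>\<^bsub>G\<^esub>" if "x \<in> carrier K" for x
    using \<alpha>p Z(1)[OF that] by (simp_all add: \<beta>_def)
  \<comment> \<open>Both \<open>Z x + Z y\<close> and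
    \<open>Z (x \<otimes> y) + single (x, y)\<close> have boundary
    \<open>single x + single y\<close>. Their difference is a cycle, which \<open>\<alpha>\<close>
    kills after the push-forward.\<close>
  have \<beta>_mult: "\<beta> x \<otimes> \<beta> y = \<beta> (x \<otimes>\<^bsub>K\<^esub> y) \<otimes> \<alpha> (single (c x, c y))"
    if xy: "x \<in> carrier K" "y \<in> carrier K" for x y
  proof -
    let ?u = "Z (x \<otimes>\<^bsub>K\<^esub> y) + single (x, y)"
    have sxy: "single (x, y) \<in> chains2 K" and Zxy: "Z (x \<otimes>\<^bsub>K\<^esub> y) \<in> chains2 K"
      using xy Z(1) by (simp_all add: chains2_eq)
    then have u: "?u \<in> chains2 K" and w: "Z x + Z y \<in> chains2 K"
      using xy Z(1) by (simp_all add: chains2_eq)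
    have "bd2 K (Z x + Z y - ?u) = 0"
      using xy Z sxy Zxy u w by (simp add: bd2_add bd2_diff bd2_single bar2_def)
    then have cyc: "Z x + Z y - ?u \<in> cycles2 K"
      using u w by (simp add: cycles2_eq chains2_eq)
    have "\<alpha> (push2 c (Z x + Z y)) = \<alpha> (push2 c ((Z x + Z y - ?u) + ?u))"
      by simp
    also have "\<dots> = \<alpha> (push2 c ?u)"
      using \<alpha>add[of "Z x + Z y - ?u" ?u] triv[OF cyc] cyc u \<alpha>p(1)[OF u] by (simp add: cycles2_eq)
    finally show ?thesis
      using \<alpha>add[OF Zxy sxy] \<alpha>add[OF Z(1) Z(1)] xy by (simp add: \<beta>_def)
  qed
  \<comment> \<open>Dividing the set map \<open>s \<circ> c\<close> by \<open>\<beta>\<close>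
    removes its failure to be multiplicative.\<close>
  have f: "(\<lambda>x. inv (\<beta> x) \<otimes> s (c x)) \<in> hom K E"
  proof (rule homI)
    fix x y
    assume xy: "x \<in> carrier K" "y \<in> carrier K"
    let ?a = "\<alpha> (single (c x, c y))"
    have a: "?a \<in> carrier E" "\<pi> ?a = \<one>\<^bsub>G\<^esub>"
      using \<alpha>p[of "single (x, y)"] xy by (simp_all add: chains2_eq)
    note cl = \<beta>[OF xy(1)] \<beta>[OF xy(2)] \<beta>[OF K.m_closed[OF xy]] s[OF cc[OF xy(1)]] s[OF cc[OF xy(2)]]
      s[OF cc[OF K.m_closed[OF xy]]] a
    have "(inv \<beta> x \<otimes> s (c x)) \<otimes> (inv \<beta> y \<otimes> s (c y)) = inv \<beta> x \<otimes> (s (c x) \<otimes> inv \<beta> y) \<otimes> s (c y)"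
      using cl by (simp add: E.m_assoc)
    also have "s (c x) \<otimes> inv \<beta> y = inv \<beta> y \<otimes> s (c x)"
      using central[of "inv \<beta> y" "s (c x)"] cl by simp
    also have "inv \<beta> x \<otimes> (inv \<beta> y \<otimes> s (c x)) \<otimes> s (c y) = inv (\<beta> y \<otimes> \<beta> x) \<otimes> (s (c x) \<otimes> s (c y))"
      using cl by (simp add: E.m_assoc E.inv_mult_group)
    also have "\<beta> y \<otimes> \<beta> x = \<beta> x \<otimes> \<beta> y"
      using central[of "\<beta> y" "\<beta> x"] cl by simp
    also have "\<beta> x \<otimes> \<beta> y = \<beta> (x \<otimes>\<^bsub>K\<^esub> y) \<otimes> ?a"
      using \<beta>_mult[OF xy] .
    also have "\<beta> (x \<otimes>\<^bsub>K\<^esub> y) \<otimes> ?a = ?a \<otimes> \<beta> (x \<otimes>\<^bsub>K\<^esub> y)"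
      using central[OF a, of "\<beta> (x \<otimes>\<^bsub>K\<^esub> y)"] cl by simp
    also have "s (c x) \<otimes> s (c y) = ?a \<otimes> s (c (x \<otimes>\<^bsub>K\<^esub> y))"
      using \<alpha>_s[OF cc[OF xy(1)] cc[OF xy(2)]] hom_mult[OF c xy] by simp
    also have "inv (?a \<otimes> \<beta> (x \<otimes>\<^bsub>K\<^esub> y)) \<otimes> (?a \<otimes> s (c (x \<otimes>\<^bsub>K\<^esub> y))) =
        inv \<beta> (x \<otimes>\<^bsub>K\<^esub> y) \<otimes> (inv ?a \<otimes> ?a) \<otimes> s (c (x \<otimes>\<^bsub>K\<^esub> y))"
      using cl by (simp only: E.m_assoc E.inv_mult_group E.inv_closed E.m_closed)
    also have "\<dots> = inv \<beta> (x \<otimes>\<^bsub>K\<^esub> y) \<otimes> s (c (x \<otimes>\<^bsub>K\<^esub> y))"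
      using cl by simp
    finally show "inv \<beta> (x \<otimes>\<^bsub>K\<^esub> y) \<otimes> s (c (x \<otimes>\<^bsub>K\<^esub> y)) = (inv \<beta> x \<otimes> s (c x)) \<otimes> (inv \<beta> y \<otimes> s (c y))"
      by simp
  qed (use \<beta> s cc in simp)
  then show ?thesis
    by (rule bexI[rotated]) (use \<beta> s cc in simp)
qed

text \<open>Bracketing \<open>s x\<close>, \<open>s y\<close>, \<open>s z\<close> in two ways gives
  the cocycle identity for \<open>\<alpha>\<close>, and \<open>bar3\<close> is the combination of
  basis elements on which this identity makes \<open>\<alpha>\<close> vanish.\<close>

lemma factor_set_trivial_on_bounds2:
  assumes s: "\<And>g. g \<in> carrier G \<Longrightarrow> s g \<in> carrier E" "\<And>g. g \<in> carrier G \<Longrightarrow> \<pi> (s g) = g"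
    and \<alpha>: "\<alpha> \<in> hom (chain_group (carrier G \<times> carrier G)) Ker"
    and \<alpha>_s: "\<And>g h. g \<in> carrier G \<Longrightarrow> h \<in> carrier G \<Longrightarrow> \<alpha> (single (g, h)) \<otimes> s (g \<otimes>\<^bsub>G\<^esub> h) = s g \<otimes> s h"
    and b: "b \<in> bounds2 G"
  shows "\<alpha> b = \<one>"
proof -
  have \<alpha>E: "\<alpha> \<in> hom (chain_group (carrier G \<times> carrier G)) E"
    using \<alpha> unfolding hom_Ker by blast
  have bd3: "bd3 G \<in> hom (chain_group (carrier G \<times> carrier G \<times> carrier G)) (chain_group (carrier G \<times> carrier G))"
    unfolding bd3_eq by (intro chain_ext_hom bar3_in_fin_chains G.is_group)
  have h: "\<alpha> \<circ> bd3 G \<in> hom (chain_group (carrier G \<times> carrier G \<times> carrier G)) E"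
    using hom_compose[OF bd3 \<alpha>E] .
  have one: "(\<lambda>_. \<one>) \<in> hom (chain_group (carrier G \<times> carrier G \<times> carrier G)) E"
    by (rule homI) simp_all
  obtain w where w: "w \<in> chains3 G" "b = bd3 G w"
    using b by (auto simp: bounds2_def)
  have "(\<alpha> \<circ> bd3 G) w = \<one>"
  proof (rule chain_hom_eq[OF E.is_group h one])
    show "w \<in> fin_chains (carrier G \<times> carrier G \<times> carrier G)"
      using w by (simp add: chains3_eq)
    fix q
    assume "q \<in> carrier G \<times> carrier G \<times> carrier G"
    then obtain x y z where q: "q = (x, y, z)" and xyz: "x \<in> carrier G" "y \<in> carrier G" "z \<in> carrier G"
      by auto
    let ?a = "\<lambda>g h. \<alpha> (single (g, h))"
    have a: "?a g h \<in> carrier E" "\<pi> (?a g h) = \<one>\<^bsub>G\<^esub>" if "g \<in> carrier G" "h \<in> carrier G" for g h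
      using \<alpha> that unfolding hom_Ker by (auto simp: hom_def Pi_def)
    note cl = a[OF xyz(1,2)] a[OF xyz(2,3)] a[OF G.m_closed[OF xyz(1,2)] xyz(3)]
      a[OF xyz(1) G.m_closed[OF xyz(2,3)]] s[OF xyz(1)] s[OF xyz(2)] s[OF xyz(3)]
      s[OF G.m_closed[OF xyz(1,2)]] s[OF G.m_closed[OF xyz(2,3)]]
      s[OF G.m_closed[OF xyz(1) G.m_closed[OF xyz(2,3)]]]
    have "?a x y \<otimes> ?a (x \<otimes>\<^bsub>G\<^esub> y) z \<otimes> s (x \<otimes>\<^bsub>G\<^esub> (y \<otimes>\<^bsub>G\<^esub> z)) = ?a x y \<otimes> (s (x \<otimes>\<^bsub>G\<^esub> y) \<otimes> s z)"
      using cl \<alpha>_s[OF G.m_closed[OF xyz(1,2)] xyz(3)] xyz by (simp add: E.m_assoc G.m_assoc)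
    also have "\<dots> = (s x \<otimes> s y) \<otimes> s z"
      using cl \<alpha>_s[OF xyz(1,2)] by (simp add: E.m_assoc[symmetric])
    also have "\<dots> = s x \<otimes> (?a y z \<otimes> s (y \<otimes>\<^bsub>G\<^esub> z))"
      using cl \<alpha>_s[OF xyz(2,3)] by (simp add: E.m_assoc)
    also have "\<dots> = (?a y z \<otimes> s x) \<otimes> s (y \<otimes>\<^bsub>G\<^esub> z)"
      using cl central[of "?a y z" "s x"] by (simp add: E.m_assoc)
    also have "\<dots> = ?a y z \<otimes> ?a x (y \<otimes>\<^bsub>G\<^esub> z) \<otimes> s (x \<otimes>\<^bsub>G\<^esub> (y \<otimes>\<^bsub>G\<^esub> z))"
      using cl \<alpha>_s[OF xyz(1) G.m_closed[OF xyz(2,3)]] by (simp add: E.m_assoc)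
    finally have eq: "?a x y \<otimes> ?a (x \<otimes>\<^bsub>G\<^esub> y) z = ?a y z \<otimes> ?a x (y \<otimes>\<^bsub>G\<^esub> z)"
      using cl by (simp add: E.right_cancel)
    let ?p = "single (y, z) + single (x, y \<otimes>\<^bsub>G\<^esub> z)" and ?m = "single (x, y) + single (x \<otimes>\<^bsub>G\<^esub> y, z)"
    have pm: "?p \<in> fin_chains (carrier G \<times> carrier G)" "?m \<in> fin_chains (carrier G \<times> carrier G)"
      using xyz by simp_all
    have "\<alpha> ?p = ?a y z \<otimes> ?a x (y \<otimes>\<^bsub>G\<^esub> z)" "\<alpha> ?m = ?a x y \<otimes> ?a (x \<otimes>\<^bsub>G\<^esub> y) z"
      using chain_hom_add[OF \<alpha>E] xyz by simp_all
    moreover have "\<alpha> (?p - ?m) = \<alpha> ?p \<otimes> inv (\<alpha> ?m)"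
      by (rule chain_hom_diff[OF E.is_group \<alpha>E pm])
    moreover have "bar3 G q = ?p - ?m"
      by (simp add: bar3_def q algebra_simps)
    ultimately show "(\<alpha> \<circ> bd3 G) (single q) = \<one>"
      using eq cl by (simp add: bd3_single)
  qed
  then show ?thesis
    using w by simp
qed

text \<open>Pulled back to \<open>E\<close>, the section \<open>s \<circ> \<pi>\<close> differs from
  the identity, a homomorphism, by the central factor \<open>t\<close>. So the pulled-back factor
  set is the coboundary of \<open>t\<close>: with \<open>\<beta>\<close> extending \<open>t\<close>,
  it equals \<open>\<beta> \<circ> bd2 E\<close> and vanishes on cycles.\<close>

lemma factor_set_trivial_on_push2:
  assumes s: "\<And>g. g \<in> carrier G \<Longrightarrow> s g \<in> carrier E" "\<And>g. g \<in> carrier G \<Longrightarrow> \<pi> (s g) = g"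
    and \<alpha>: "\<alpha> \<in> hom (chain_group (carrier G \<times> carrier G)) Ker"
    and \<alpha>_s: "\<And>g h. g \<in> carrier G \<Longrightarrow> h \<in> carrier G \<Longrightarrow> \<alpha> (single (g, h)) \<otimes> s (g \<otimes>\<^bsub>G\<^esub> h) = s g \<otimes> s h"
    and z: "z \<in> cycles2 E"
  shows "\<alpha> (push2 \<pi> z) = \<one>"
proof -
  interpret Ker: comm_group Ker by (rule comm_group_Ker)
  define t where "t x = s (\<pi> x) \<otimes> inv x" for x
  have t: "t x \<in> carrier E" "\<pi> (t x) = \<one>\<^bsub>G\<^esub>" if "x \<in> carrier E" for x
    using that s by (simp_all add: t_def)
  have st: "s (\<pi> x) = t x \<otimes> x" if "x \<in> carrier E" for x
    using that s by (simp add: t_def E.m_assoc)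
  obtain \<beta> where \<beta>: "\<beta> \<in> hom (chain_group (carrier E)) Ker" "\<And>x. x \<in> carrier E \<Longrightarrow> \<beta> (single x) = t x"
    using Ker.ex_chain_hom[of "carrier E" t] t by auto
  have \<beta>E: "\<beta> \<in> hom (chain_group (carrier E)) E"
    using \<beta>(1) unfolding hom_Ker by blast
  have \<alpha>E: "\<alpha> \<in> hom (chain_group (carrier G \<times> carrier G)) E"
    using \<alpha> unfolding hom_Ker by blast
  have h1: "\<alpha> \<circ> push2 \<pi> \<in> hom (chain_group (carrier E \<times> carrier E)) E"
    using hom_compose[OF push2_hom[where f=\<pi> and K=E and G=G] \<alpha>E] by simp
  have h2: "\<beta> \<circ> bd2 E \<in> hom (chain_group (carrier E \<times> carrier E)) E"
    using hom_compose[OF bd2_hom[OF E.is_group] \<beta>E] .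
  have "(\<alpha> \<circ> push2 \<pi>) z = (\<beta> \<circ> bd2 E) z"
  proof (rule chain_hom_eq[OF E.is_group h1 h2])
    show "z \<in> fin_chains (carrier E \<times> carrier E)"
      using z by (simp add: cycles2_eq chains2_eq)
    fix p
    assume "p \<in> carrier E \<times> carrier E"
    then obtain x y where p: "p = (x, y)" and xy: "x \<in> carrier E" "y \<in> carrier E"
      by auto
    let ?a = "\<alpha> (single (\<pi> x, \<pi> y))"
    have a: "?a \<in> carrier E"
      using hom_in_carrier[OF \<alpha>E] xy by simp
    note cl = a t[OF xy(1)] t[OF xy(2)] t[OF E.m_closed[OF xy]] xy
    have "?a \<otimes> t (x \<otimes> y) \<otimes> (x \<otimes> y) = ?a \<otimes> s (\<pi> x \<otimes>\<^bsub>G\<^esub> \<pi> y)"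
      using cl st[OF E.m_closed[OF xy]] by (simp add: E.m_assoc)
    also have "\<dots> = t x \<otimes> x \<otimes> (t y \<otimes> y)"
      using \<alpha>_s[of "\<pi> x" "\<pi> y"] st xy by simp
    also have "\<dots> = t x \<otimes> (t y \<otimes> x) \<otimes> y"
      using central[of "t y" x] cl by (simp add: E.m_assoc)
    also have "\<dots> = t x \<otimes> t y \<otimes> (x \<otimes> y)"
      using cl by (simp add: E.m_assoc)
    finally have "?a \<otimes> t (x \<otimes> y) = t x \<otimes> t y"
      using cl by (simp add: E.right_cancel)
    then have eq: "?a = t x \<otimes> t y \<otimes> inv (t (x \<otimes> y))"
      using cl by (simp add: E.inv_solve_right)
    let ?p = "single x + single y" and ?m = "single (x \<otimes> y)"
    have "\<beta> (?p - ?m) = t x \<otimes> t y \<otimes> inv (t (x \<otimes> y))"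
      using chain_hom_diff[OF E.is_group \<beta>E, of ?p ?m] chain_hom_add[OF \<beta>E, of "single x" "single y"] \<beta>(2)
        xy by simp
    moreover have "bar2 E p = ?p - ?m"
      by (simp add: bar2_def p algebra_simps)
    ultimately show "(\<alpha> \<circ> push2 \<pi>) (single p) = (\<beta> \<circ> bd2 E) (single p)"
      using eq by (simp add: bd2_single p)
  qed
  then show ?thesis
    using z chain_hom_zero[OF E.is_group \<beta>E] by (simp add: cycles2_eq)
qed

text \<open>A cycle pushed forward from \<open>K\<close> agrees up to a boundary with one pushed
  forward from \<open>E\<close>. The factor set kills both kinds of contribution, so the obstruction
  to lifting vanishes.\<close>

lemma lift_if_H2image_subset:
  assumes "group K" "perfect K" and c: "c \<in> hom K G"
    and sub: "H2image K G c \<subseteq> H2image E G \<pi>"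
  shows "\<exists>f\<in>hom K E. \<forall>x\<in>carrier K. \<pi> (f x) = c x"
proof -
  interpret Ker: comm_group Ker by (rule comm_group_Ker)
  have "\<forall>g\<in>carrier G. \<exists>x\<in>carrier E. \<pi> x = g"
    using \<pi>_surj by (metis imageE)
  then obtain s where s: "\<And>g. g \<in> carrier G \<Longrightarrow> s g \<in> carrier E" "\<And>g. g \<in> carrier G \<Longrightarrow> \<pi> (s g) = g"
    by metis
  let ?a = "\<lambda>p. s (fst p) \<otimes> s (snd p) \<otimes> inv (s (fst p \<otimes>\<^bsub>G\<^esub> snd p))"
  obtain \<alpha> where \<alpha>: "\<alpha> \<in> hom (chain_group (carrier G \<times> carrier G)) Ker"
    and \<alpha>a: "\<And>p. p \<in> carrier G \<times> carrier G \<Longrightarrow> \<alpha> (single p) = ?a p"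
    using Ker.ex_chain_hom[of "carrier G \<times> carrier G" ?a] s by auto
  have \<alpha>_s: "\<alpha> (single (g, h)) \<otimes> s (g \<otimes>\<^bsub>G\<^esub> h) = s g \<otimes> s h" if "g \<in> carrier G" "h \<in> carrier G" for g h
    using \<alpha>a[of "(g, h)"] that s by (simp add: E.m_assoc)
  have \<alpha>E: "\<alpha> \<in> hom (chain_group (carrier G \<times> carrier G)) E"
    using \<alpha> unfolding hom_Ker by blast
  show ?thesis
  proof (rule lift_if_factor_set_trivial[OF assms(1-3) s \<alpha> \<alpha>_s])
    fix z
    assume z: "z \<in> cycles2 K"
    have "hclass G (push2 c z) \<in> H2image E G \<pi>"
      using sub z unfolding H2image_eq[OF assms(1) G.is_group c] by blast
    then obtain w where w: "w \<in> cycles2 E" "hclass G (push2 c z) = hclass G (push2 \<pi> w)"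
      unfolding H2image_eq[OF E.is_group G.is_group \<pi>_hom] by blast
    note cz = push2_cycles2[OF assms(1) G.is_group c z] and pw = push2_cycles2[OF E.is_group G.is_group \<pi>_hom w(1)]
    have b: "push2 c z - push2 \<pi> w \<in> bounds2 G"
      using w hclass_eq_iff[OF G.is_group cz pw] by simp
    have "\<alpha> (push2 c z) = \<alpha> ((push2 c z - push2 \<pi> w) + push2 \<pi> w)"
      by simp
    also have "\<dots> = \<alpha> (push2 c z - push2 \<pi> w) \<otimes> \<alpha> (push2 \<pi> w)"
      using cz pw by (intro chain_hom_add[OF \<alpha>E]) (simp_all add: cycles2_eq chains2_eq)
    also have "\<dots> = \<one>"
      using factor_set_trivial_on_bounds2[OF s \<alpha> \<alpha>_s b] factor_set_trivial_on_push2[OF s \<alpha> \<alpha>_s w(1)]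
      by simp
    finally show "\<alpha> (push2 c z) = \<one>" .
  qed
qed

end

section \<open>Homomorphisms from abelian groups of bounded exponent\<close>

text \<open>The quotient by \<open>M\<close> is cyclic of order \<open>p\<close>, generated by the
  class of \<open>w\<close>; \<open>\<theta>\<close> is the quotient map followed by the
  homomorphism that sends this generator to \<open>u\<close>.\<close>

lemma (in comm_group) ex_mod_hom:
  assumes M: "subgroup M G" and p: "Factorial_Ring.prime p" and w: "w \<in> carrier G" "w \<notin> M"
    and M_pow: "\<And>x. x \<in> carrier G \<Longrightarrow> x [^] p \<in> M"
    and cover: "\<And>x. x \<in> carrier G \<Longrightarrow> \<exists>i::int. x \<otimes> w [^] i \<in> M"
    and u: "u \<in> carrier G" "u [^] (p::nat) = \<one>"
  shows "\<exists>\<theta>\<in>hom G G. (\<forall>x\<in>M. \<theta> x = \<one>) \<and> \<theta> w = u"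
proof -
  interpret M: subgroup M G by fact
  \<comment> \<open>If \<open>p\<close> did not divide \<open>i\<close>, Bezout would express
    \<open>w\<close> through powers of \<open>w [^] p\<close> and \<open>w [^] i\<close>, both in
    \<open>M\<close>.\<close>
  have w_pow: "int p dvd i" if i: "w [^] i \<in> M" for i :: int
  proof (rule ccontr)
    assume "\<not> int p dvd i"
    then have "coprime (int p) i"
      using p by (simp add: prime_imp_coprime)
    then obtain a b where "a * int p + b * i = 1"
      by (metis bezout_int coprime_imp_gcd_eq_1)
    then have "w = w [^] (int p * a + i * b)"
      using w by (simp add: algebra_simps)
    also have "\<dots> = (w [^] p) [^] a \<otimes> (w [^] i) [^] b"
      using w by (simp add: int_pow_mult int_pow_pow flip: int_pow_int)
    also have "\<dots> \<in> M"
      using i M_pow[OF w(1)] subgroup_int_pow_closed[OF M] by simp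
    finally show False
      using w by simp
  qed
  define e where "e x = (SOME i::int. x \<otimes> w [^] (- i) \<in> M)" for x
  \<comment> \<open>The chosen exponent is determined modulo \<open>p\<close>, and
    \<open>u [^] p\<close> is trivial, so any valid exponent may replace it.\<close>
  have e: "u [^] e x = u [^] i" if x: "x \<in> carrier G" and i: "x \<otimes> w [^] (- i) \<in> M" for x and i :: int
  proof -
    have "x \<otimes> w [^] (- e x) \<in> M"
      unfolding e_def by (rule someI[of "\<lambda>i. x \<otimes> w [^] (- i) \<in> M", OF i])
    then have "inv (x \<otimes> w [^] (- e x)) \<otimes> (x \<otimes> w [^] (- i)) \<in> M"
      using i by simp
    also have "inv (x \<otimes> w [^] (- e x)) \<otimes> (x \<otimes> w [^] (- i)) = w [^] (e x - i)"
      using x w m_assoc[of "inv x" x "w [^] (- i)", symmetric]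
      by (simp add: inv_mult_group m_assoc int_pow_diff int_pow_neg)
    finally have "int p dvd e x - i"
      by (rule w_pow)
    then obtain k where "e x = i + int p * k"
      by (metis dvd_def diff_eq_eq add.commute)
    moreover have "u [^] (int p * k) = \<one>"
      using int_pow_pow[OF u(1), of "int p" k] u by (simp add: int_pow_int)
    ultimately show ?thesis
      using u by (simp add: int_pow_mult)
  qed
  show ?thesis
  proof (intro bexI conjI ballI)
    fix x
    assume "x \<in> M"
    then show "u [^] e x = \<one>"
      using e[of x 0] by simp
  next
    show "u [^] e w = u"
      using e[of w 1] w u by (simp add: int_pow_neg)
  next
    show "(\<lambda>x. u [^] e x) \<in> hom G G"
    proof (rule homI)
      fix x y
      assume xy: "x \<in> carrier G" "y \<in> carrier G"
      obtain i' j' :: int where "x \<otimes> w [^] i' \<in> M" "y \<otimes> w [^] j' \<in> M"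
        using cover xy by blast
      moreover define i j where "i = - i'" and "j = - j'"
      ultimately have ij: "x \<otimes> w [^] (- i) \<in> M" "y \<otimes> w [^] (- j) \<in> M"
        by simp_all
      have "(x \<otimes> w [^] (- i)) \<otimes> (y \<otimes> w [^] (- j)) = x \<otimes> y \<otimes> w [^] (- (i + j))"
        using xy w int_pow_mult[of w "- i" "- j"] by (simp add: m_ac)
      then have "x \<otimes> y \<otimes> w [^] (- (i + j)) \<in> M"
        using M.m_closed[OF ij] by simp
      then show "u [^] e (x \<otimes> y) = u [^] e x \<otimes> u [^] e y"
        using e[OF xy(1) ij(1)] e[OF xy(2) ij(2)] e[of "x \<otimes> y" "i + j"] xy u by (simp add: int_pow_mult)
    qed (use u in simp)
  qed
qed

text \<open>For the least \<open>m\<close> with \<open>x [^] m \<in> B\<close> for all \<open>x\<close> and a prime \<open>p\<close> dividing \<open>m\<close>, the subgroup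
  \<open>L\<close> below has elementary abelian quotient; a subgroup \<open>M \<supseteq> L\<close> maximal with respect to avoiding
  some \<open>w \<notin> L\<close> has index \<open>p\<close>, and the order of \<open>w\<close> is divisible by \<open>p\<close>.\<close>

lemma (in comm_group) ex_hom_killing_subgroup:
  assumes exp: "n > 0" "\<And>x. x \<in> carrier G \<Longrightarrow> x [^] (n::nat) = \<one>"
    and B: "subgroup B G" "B \<noteq> carrier G"
  shows "\<exists>\<theta>\<in>hom G G. (\<forall>x\<in>B. \<theta> x = \<one>) \<and> (\<exists>x\<in>carrier G. \<theta> x \<noteq> \<one>)"
proof -
  interpret B: subgroup B G by fact
  define Q where "Q m \<longleftrightarrow> m > 0 \<and> (\<forall>x\<in>carrier G. x [^] m \<in> B)" for m :: nat
  define m where "m = (LEAST m. Q m)"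
  have "Q n"
    using exp by (simp add: Q_def)
  then have m: "Q m" "\<And>k. k < m \<Longrightarrow> \<not> Q k"
    unfolding m_def by (auto intro: LeastI dest: not_less_Least)
  have "m \<noteq> 1"
  proof
    assume "m = 1"
    then have "carrier G \<subseteq> B"
      using m(1) by (auto simp: Q_def)
    then show False
      using B.subset B(2) by blast
  qed
  then obtain p where p: "Factorial_Ring.prime p" "p dvd m"
    using prime_factor_nat by blast
  then obtain m' where m': "m = m' * p"
    by (metis dvd_def mult.commute)
  then have "0 < m'" "m' < m"
    using m(1) prime_gt_1_nat[OF p(1)] by (auto simp: Q_def)
  then obtain w where w: "w \<in> carrier G" "w [^] m' \<notin> B"
    using m(2)[of m'] by (auto simp: Q_def)
  define L where "L = {x \<in> carrier G. x [^] m' \<in> B}"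
  have L: "subgroup L G"
    by (rule subgroupI) (auto simp: L_def nat_pow_distrib nat_pow_inv intro!: exI[of _ \<one>])
  have L_pow: "x [^] p \<in> L" if "x \<in> carrier G" for x
    using that m(1) by (simp add: L_def Q_def m' nat_pow_pow mult.commute)
  define A where "A = {M. subgroup M G \<and> L \<subseteq> M \<and> w \<notin> M}"
  \<comment> \<open>The group may be infinite, so a maximal subgroup avoiding \<open>w\<close> has
    to come from Zorn's lemma.\<close>
  have "\<exists>M\<in>A. \<forall>M'\<in>A. M \<subseteq> M' \<longrightarrow> M' = M"
  proof (rule subset_Zorn_nonempty)
    show "A \<noteq> {}"
      using L w by (auto simp: A_def L_def)
    fix C
    assume C: "C \<noteq> {}" "subset.chain A C"
    then have CA: "C \<subseteq> A" and tot: "\<And>M N. M \<in> C \<Longrightarrow> N \<in> C \<Longrightarrow> M \<subseteq> N \<or> N \<subseteq> M"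
      by (auto simp: subset_chain_def)
    have sub: "subgroup M G" if "M \<in> C" for M
      using that CA by (auto simp: A_def)
    have "subgroup (\<Union> C) G"
    proof (rule subgroupI)
      show "\<Union> C \<subseteq> carrier G"
        using sub subgroup.subset by blast
      show "\<Union> C \<noteq> {}"
        using C(1) sub subgroup.one_closed by blast
      show "inv x \<in> \<Union> C" if "x \<in> \<Union> C" for x
        using that sub subgroup.m_inv_closed by fast
      show "x \<otimes> y \<in> \<Union> C" if xy: "x \<in> \<Union> C" "y \<in> \<Union> C" for x y
      proof -
        obtain M N where MN: "M \<in> C" "N \<in> C" "x \<in> M" "y \<in> N"
          using xy by blast
        from tot[OF MN(1,2)] have "x \<otimes> y \<in> M \<or> x \<otimes> y \<in> N"
          using subgroup.m_closed[OF sub[OF MN(1)], of x y] subgroup.m_closed[OF sub[OF MN(2)], of x y] MN(3,4)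
          by auto
        then show ?thesis
          using MN(1,2) by blast
      qed
    qed
    then show "\<Union> C \<in> A"
      using CA C(1) by (auto simp: A_def)
  qed
  then obtain M where M: "subgroup M G" "L \<subseteq> M" "w \<notin> M"
    and max: "\<And>M'. subgroup M' G \<Longrightarrow> w \<notin> M' \<Longrightarrow> M \<subseteq> M' \<Longrightarrow> M' = M"
    by (auto simp: A_def)
  interpret M: subgroup M G by fact
  \<comment> \<open>By maximality, adjoining \<open>x\<close> to \<open>M\<close> captures
    \<open>w\<close>, say as \<open>a \<otimes> x [^] j\<close>. Since \<open>x [^] p\<close> lies
    in \<open>M\<close> and \<open>w\<close> does not, \<open>p\<close> does not divide
    \<open>j\<close>, and Bezout solves for \<open>x\<close> as a power of \<open>w\<close> modulo
    \<open>M\<close>.\<close>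
  have cover: "\<exists>i::int. x \<otimes> w [^] i \<in> M" if x: "x \<in> carrier G" for x
  proof (cases "x \<in> M")
    case True
    then show ?thesis
      by (intro exI[of _ 0]) simp
  next
    case False
    define M' where "M' = {a \<otimes> x [^] j | a j. a \<in> M \<and> j \<in> (UNIV :: int set)}"
    have M'I: "a \<otimes> x [^] j \<in> M'" if "a \<in> M" for a and j :: int
      using that by (auto simp: M'_def)
    have "subgroup M' G"
    proof (rule subgroupI)
      show "M' \<subseteq> carrier G"
        using x by (auto simp: M'_def)
      show "M' \<noteq> {}"
        using M'I[OF M.one_closed] by blast
      fix y z
      assume "y \<in> M'" "z \<in> M'"
      then obtain a i b j where y: "y = a \<otimes> x [^] (i::int)" "a \<in> M" and z: "z = b \<otimes> x [^] (j::int)" "b \<in> M"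
        by (auto simp: M'_def)
      have "y \<otimes> z = (a \<otimes> b) \<otimes> x [^] (i + j)"
        using x y z by (simp add: int_pow_mult m_ac)
      then show "y \<otimes> z \<in> M'"
        using M'I y z by simp
      have "inv y = inv a \<otimes> x [^] (- i)"
        using x y by (simp add: inv_mult int_pow_neg)
      then show "inv y \<in> M'"
        using M'I[of "inv a" "- i"] y by simp
    qed
    moreover have "M \<subseteq> M'"
      using M'I[of _ 0] by auto
    moreover have "x \<in> M'"
      using M'I[of \<one> 1] x by simp
    ultimately have "w \<in> M'"
      using max[of M'] False by blast
    then obtain a j where a: "w = a \<otimes> x [^] (j::int)" "a \<in> M"
      by (auto simp: M'_def)
    have xp: "x [^] int p \<in> M"
      using L_pow[OF x] M(2) by (auto simp: int_pow_int)
    have "\<not> int p dvd j"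
    proof
      assume "int p dvd j"
      then obtain k where "j = int p * k" ..
      then have "x [^] j = (x [^] int p) [^] k"
        using x by (simp add: int_pow_pow)
      then have "w \<in> M"
        using a xp subgroup_int_pow_closed[OF M(1) xp] by simp
      then show False
        using M by simp
    qed
    then have "coprime (int p) j"
      using p by (simp add: prime_imp_coprime)
    then obtain s t where st: "s * int p + t * j = 1"
      by (metis bezout_int coprime_imp_gcd_eq_1)
    have "x = x [^] (int p * s + j * t)"
      using x st by (simp add: algebra_simps)
    also have "\<dots> = (x [^] int p) [^] s \<otimes> (inv a \<otimes> w) [^] t"
      using x a by (simp add: int_pow_mult int_pow_pow inv_solve_left m_assoc[symmetric])
    also have "\<dots> = (x [^] int p) [^] s \<otimes> (inv a) [^] t \<otimes> w [^] t"
      using x a w by (simp add: int_pow_distrib m_assoc)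
    finally have "x \<otimes> w [^] (- t) = (x [^] int p) [^] s \<otimes> (inv a) [^] t"
      using x a w by (simp add: int_pow_neg inv_solve_right')
    also have "\<dots> \<in> M"
      using xp a subgroup_int_pow_closed[OF M(1)] by simp
    finally show ?thesis ..
  qed
  have "ord w \<noteq> 0"
    using exp w pow_eq_id[of w n] by auto
  \<comment> \<open>Otherwise \<open>w\<close> would be a power of \<open>w [^] p\<close>, which
    lies in \<open>L\<close> and hence in \<open>M\<close>.\<close>
  moreover have "p dvd ord w"
  proof (rule ccontr)
    assume "\<not> p dvd ord w"
    then have "coprime (int p) (int (ord w))"
      using p by (simp add: prime_imp_coprime)
    then obtain s t where st: "s * int p + t * int (ord w) = 1"
      by (metis bezout_int coprime_imp_gcd_eq_1)
    have "w = w [^] (int p * s + int (ord w) * t)"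
      using w st by (simp add: algebra_simps)
    also have "\<dots> = (w [^] p) [^] s \<otimes> (w [^] ord w) [^] t"
      using w by (simp add: int_pow_mult int_pow_pow flip: int_pow_int)
    also have "\<dots> = (w [^] p) [^] s"
      using w by simp
    also have "\<dots> \<in> M"
      using L_pow[OF w(1)] M(2) subgroup_int_pow_closed[OF M(1)] by blast
    finally show False
      using M by simp
  qed
  then obtain k where k: "ord w = k * p"
    by (metis dvd_def mult.commute)
  ultimately have "0 < k" "k < ord w"
    using prime_gt_1_nat[OF p(1)] by auto
  then have "\<not> ord w dvd k"
    by (auto dest: dvd_imp_le)
  \<comment> \<open>With \<open>k\<close> the order of \<open>w\<close> divided by \<open>p\<close>,
    the power \<open>w [^] k\<close> has order \<open>p\<close> and can serve as the image of
    \<open>w\<close>.\<close>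
  then have u: "w [^] k \<noteq> \<one>"
    using pow_eq_id[OF w(1), of k] by simp
  have "(w [^] k) [^] p = \<one>"
    using w k by (simp add: nat_pow_pow flip: k)
  then obtain \<theta> where \<theta>: "\<theta> \<in> hom G G" "\<forall>x\<in>M. \<theta> x = \<one>" "\<theta> w = w [^] k"
    using ex_mod_hom[OF M(1) p(1) w(1) M(3) _ cover, of "w [^] k"] w L_pow M(2) by blast
  moreover have "B \<subseteq> M"
  proof -
    have "x [^] m' \<in> B" if "x \<in> B" for x
      using that by (induction m') auto
    then show ?thesis
      using M(2) B.subset by (auto simp: L_def)
  qed
  ultimately show ?thesis
    using u w by (intro bexI[of _ \<theta>] conjI bexI[of _ w]) auto
qed

section \<open>Generalized subgroups onto finite simple groups\<close>

lemma gen_subgroupD: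
  assumes "gen_subgroup K G c" "f \<in> hom K K" "g \<in> hom K K"
    and "\<And>x. x \<in> carrier K \<Longrightarrow> c (f x) = c (g x)" "x \<in> carrier K"
  shows "f x = g x"
  using assms unfolding gen_subgroup_def by blast

lemma central_ext_if_gen_subgroup:
  assumes "group K" "group G" "gen_subgroup K G c" "c ` carrier K = carrier G"
  shows "central_ext K G c"
proof -
  interpret K: group K by fact
  interpret G: group G by fact
  have c: "c \<in> hom K G"
    using assms(3) by (simp add: gen_subgroup_def)
  interpret c: group_hom K G c
    using c by unfold_locales
  show ?thesis
  proof
    fix n x
    assume n: "n \<in> carrier K" "c n = \<one>\<^bsub>G\<^esub>" and x: "x \<in> carrier K"
    let ?f = "\<lambda>x. n \<otimes>\<^bsub>K\<^esub> x \<otimes>\<^bsub>K\<^esub> inv\<^bsub>K\<^esub> n"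
    have "?f \<in> hom K K"
    proof (rule homI)
      fix x y
      assume xy: "x \<in> carrier K" "y \<in> carrier K"
      then have "?f x \<otimes>\<^bsub>K\<^esub> ?f y = n \<otimes>\<^bsub>K\<^esub> x \<otimes>\<^bsub>K\<^esub> ((inv\<^bsub>K\<^esub> n \<otimes>\<^bsub>K\<^esub> n) \<otimes>\<^bsub>K\<^esub> (y \<otimes>\<^bsub>K\<^esub> inv\<^bsub>K\<^esub> n))"
        using n by (simp only: K.m_assoc K.m_closed K.inv_closed)
      then show "?f (x \<otimes>\<^bsub>K\<^esub> y) = ?f x \<otimes>\<^bsub>K\<^esub> ?f y"
        using xy n by (simp add: K.m_assoc)
    qed (use n in simp)
    moreover have "(\<lambda>x. x) \<in> hom K K"
      by (rule homI) simp_all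
    ultimately have "?f x = x"
      by (rule gen_subgroupD[OF assms(3) _ _ _ x]) (use n in simp)
    then show "n \<otimes>\<^bsub>K\<^esub> x = x \<otimes>\<^bsub>K\<^esub> n"
      using K.inv_solve_right'[of x "n \<otimes>\<^bsub>K\<^esub> x" n] n x by simp
  qed (use assms c in auto)
qed

section \<open>Rigidity over the base: trivial maps to the kernel, exponent, perfectness\<close>

context central_ext
begin

lemma gen_subgroup_if_perfect: "perfect E \<Longrightarrow> gen_subgroup E G \<pi>"
  unfolding gen_subgroup_def using \<pi>_hom lifts_unique[OF E.is_group] by blast

text \<open>The endomorphisms \<open>\<theta> x \<otimes> x\<close> and \<open>x\<close> have the
  same composite with \<open>\<pi>\<close>, so they coincide.\<close>

lemma hom_Ker_trivial:
  assumes "gen_subgroup E G \<pi>" "\<theta> \<in> hom E Ker" "x \<in> carrier E"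
  shows "\<theta> x = \<one>"
proof -
  have \<theta>: "\<theta> \<in> hom E E" "\<And>x. x \<in> carrier E \<Longrightarrow> \<pi> (\<theta> x) = \<one>\<^bsub>G\<^esub>"
    using assms(2) unfolding hom_Ker by auto
  have id: "(\<lambda>x. x) \<in> hom E E"
    by (rule homI) simp_all
  have f: "(\<lambda>x. \<theta> x \<otimes> x) \<in> hom E E"
    using hom_E_of_central[OF id \<theta>] .
  have tc: "\<theta> x \<in> carrier E" if "x \<in> carrier E" for x
    using hom_in_carrier[OF \<theta>(1) that] .
  have "\<theta> x \<otimes> x = x"
    by (rule gen_subgroupD[OF assms(1) f id _ assms(3)]) (use \<theta>(2) tc in simp)
  then show ?thesis
    using assms(3) tc by simp
qed

text \<open>The transfer to the central subgroup is the homomorphism \<open>T\<close>, which is the power map on the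
  kernel and is trivial.\<close>

lemma kernel_exponent:
  assumes "gen_subgroup E G \<pi>" "n \<in> carrier E" "\<pi> n = \<one>\<^bsub>G\<^esub>"
  shows "n [^] card (carrier G) = \<one>"
proof -
  interpret Ker: comm_group Ker by (rule comm_group_Ker)
  have "\<forall>g\<in>carrier G. \<exists>x\<in>carrier E. \<pi> x = g"
    using \<pi>_surj by (metis imageE)
  then obtain s where s: "\<And>g. g \<in> carrier G \<Longrightarrow> s g \<in> carrier E" "\<And>g. g \<in> carrier G \<Longrightarrow> \<pi> (s g) = g"
    by metis
  \<comment> \<open>Right multiplication by \<open>x\<close> moves the representative
    \<open>s g\<close> into the fibre of \<open>s (g \<otimes> \<pi> x)\<close>;
    \<open>\<tau> x g\<close> is the kernel element by which it misses that representative.\<close>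
  define \<tau> where "\<tau> x g = s g \<otimes> x \<otimes> inv (s (g \<otimes>\<^bsub>G\<^esub> \<pi> x))" for x g
  define T where "T x = finprod Ker (\<tau> x) (carrier G)" for x
  have \<tau>: "\<tau> x g \<in> carrier E" "\<pi> (\<tau> x g) = \<one>\<^bsub>G\<^esub>" if "x \<in> carrier E" "g \<in> carrier G" for x g
    using that s by (simp_all add: \<tau>_def)
  have \<tau>_mult: "\<tau> (x \<otimes> y) g = \<tau> x g \<otimes> \<tau> y (g \<otimes>\<^bsub>G\<^esub> \<pi> x)"
    if "x \<in> carrier E" "y \<in> carrier E" "g \<in> carrier G" for x y g
  proof -
    let ?h = "s (g \<otimes>\<^bsub>G\<^esub> \<pi> x)" and ?k = "inv (s (g \<otimes>\<^bsub>G\<^esub> \<pi> x \<otimes>\<^bsub>G\<^esub> \<pi> y))"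
    have c: "s g \<in> carrier E" "?h \<in> carrier E" "?k \<in> carrier E"
      using that s by simp_all
    have "\<tau> x g \<otimes> \<tau> y (g \<otimes>\<^bsub>G\<^esub> \<pi> x) = s g \<otimes> x \<otimes> ((inv ?h \<otimes> ?h) \<otimes> (y \<otimes> ?k))"
      using c that by (simp only: \<tau>_def E.m_assoc E.m_closed E.inv_closed)
    also have "\<dots> = s g \<otimes> (x \<otimes> y) \<otimes> ?k"
      using c that by (simp add: E.m_assoc)
    finally show ?thesis
      using that by (simp add: \<tau>_def G.m_assoc)
  qed
  have "T \<in> hom E Ker"
  proof (rule homI)
    fix x
    assume "x \<in> carrier E"
    then show "T x \<in> carrier Ker"
      unfolding T_def by (intro Ker.finprod_closed) (simp add: \<tau>)
  next
    fix x y
    assume xy: "x \<in> carrier E" "y \<in> carrier E"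
    \<comment> \<open>Right translation by \<open>\<pi> x\<close> permutes \<open>G\<close>, so the
      shifted factors from \<open>\<tau>_mult\<close> reassemble to \<open>T y\<close>.\<close>
    have im: "(\<lambda>g. g \<otimes>\<^bsub>G\<^esub> \<pi> x) ` carrier G = carrier G"
    proof safe
      fix g
      assume g: "g \<in> carrier G"
      then show "g \<in> (\<lambda>g. g \<otimes>\<^bsub>G\<^esub> \<pi> x) ` carrier G"
        using xy by (intro image_eqI[of _ _ "g \<otimes>\<^bsub>G\<^esub> inv\<^bsub>G\<^esub> \<pi> x"]) (simp_all add: G.m_assoc)
    qed (use xy in simp)
    have "T (x \<otimes> y) = finprod Ker (\<lambda>g. \<tau> x g \<otimes>\<^bsub>Ker\<^esub> \<tau> y (g \<otimes>\<^bsub>G\<^esub> \<pi> x)) (carrier G)"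
      unfolding T_def using xy by (intro Ker.finprod_cong') (simp_all add: \<tau> \<tau>_mult)
    also have "\<dots> = T x \<otimes>\<^bsub>Ker\<^esub> finprod Ker (\<lambda>g. \<tau> y (g \<otimes>\<^bsub>G\<^esub> \<pi> x)) (carrier G)"
      unfolding T_def using xy by (intro Ker.finprod_multf) (simp_all add: \<tau>)
    also have "finprod Ker (\<lambda>g. \<tau> y (g \<otimes>\<^bsub>G\<^esub> \<pi> x)) (carrier G) = T y"
      unfolding T_def using xy im G.inj_on_multc[of "\<pi> x"]
        Ker.finprod_reindex[of "\<tau> y" "\<lambda>g. g \<otimes>\<^bsub>G\<^esub> \<pi> x" "carrier G"]
      by (simp add: \<tau>)
    finally show "T (x \<otimes> y) = T x \<otimes>\<^bsub>Ker\<^esub> T y" .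
  qed
  then have "T n = \<one>"
    using hom_Ker_trivial assms by blast
  moreover have "T n = finprod Ker (\<lambda>_. n) (carrier G)"
  proof -
    have "\<tau> n g = n" if "g \<in> carrier G" for g
    proof -
      have "\<tau> n g = n \<otimes> s g \<otimes> inv s g"
        using that assms s by (simp add: \<tau>_def central[OF assms(2,3)])
      then show ?thesis
        using that assms s by (simp add: E.m_assoc)
    qed
    then show ?thesis
      unfolding T_def using assms by (intro Ker.finprod_cong') simp_all
  qed
  \<comment> \<open>This holds by convention also for infinite \<open>G\<close>: the product then
    defaults to the unit and the cardinality to 0.\<close>
  moreover have "finprod Ker (\<lambda>_. n) (carrier G) = n [^] card (carrier G)"
    using Ker.finprod_const[of n "carrier G"] assms by (simp add: E.nat_pow_consistent[symmetric])
  ultimately show ?thesis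
    by simp
qed

text \<open>Since \<open>\<pi>\<close> maps the derived subgroup \<open>D\<close> onto the perfect
  group \<open>G\<close>, every element is a product of an element of \<open>D\<close> and one of
  the kernel. An endomorphism of the kernel that kills \<open>B\<close> extends to \<open>E\<close>
  by acting on the kernel component, against \<open>hom_Ker_trivial\<close>.\<close>

lemma perfect_if_gen_subgroup:
  assumes gen: "gen_subgroup E G \<pi>" and "perfect G" "finite (carrier G)"
  shows "perfect E"
proof (rule ccontr)
  assume not_perfect: "\<not> perfect E"
  interpret Ker: comm_group Ker by (rule comm_group_Ker)
  define D where "D = derived E (carrier E)"
  have D: "subgroup D E"
    unfolding D_def by (rule E.derived_is_subgroup) simp
  interpret D: subgroup D E by fact
  have "\<pi> ` D = carrier G"
    using \<pi>.derived_img[of "carrier E"] assms(2) \<pi>_surj by (simp add: D_def)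
  then have cover: "\<exists>n\<in>kernel E G \<pi>. x \<otimes> inv n \<in> D" if x: "x \<in> carrier E" for x
  proof -
    from \<open>\<pi> ` D = carrier G\<close> x obtain d where d: "d \<in> D" "\<pi> d = \<pi> x"
      by (metis \<pi>.hom_closed imageE)
    then have "x \<otimes> inv (inv d \<otimes> x) = d"
      using x by (simp add: E.inv_mult_group E.m_assoc[symmetric])
    then show ?thesis
      using d x by (intro bexI[of _ "inv d \<otimes> x"]) auto
  qed
  define B where "B = D \<inter> kernel E G \<pi>"
  have B: "subgroup B Ker"
    unfolding B_def
    using E.subgroup_incl[OF E.subgroups_Inter_pair[OF D \<pi>.subgroup_kernel] \<pi>.subgroup_kernel] by simp
  have "B \<noteq> carrier Ker"
  proof
    assume "B = carrier Ker"
    then have sub: "kernel E G \<pi> \<subseteq> D"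
      by (auto simp: B_def)
    have "x \<in> D" if x: "x \<in> carrier E" for x
    proof -
      obtain n where n: "n \<in> kernel E G \<pi>" "x \<otimes> inv n \<in> D"
        using cover[OF x] by blast
      then have "(x \<otimes> inv n) \<otimes> n \<in> D"
        using sub by blast
      then show ?thesis
        using x n by (simp add: E.m_assoc)
    qed
    then have "perfect E"
      using D.subset unfolding D_def by blast
    with not_perfect show False ..
  qed
  moreover have "x [^]\<^bsub>Ker\<^esub> card (carrier G) = \<one>\<^bsub>Ker\<^esub>" if "x \<in> carrier Ker" for x
    using kernel_exponent[OF gen] that by (simp add: E.nat_pow_consistent[symmetric])
  moreover have "card (carrier G) > 0"
    using assms(3) by (simp add: card_gt_0_iff) (use G.one_closed in blast)
  ultimately obtain \<theta> where \<theta>: "\<theta> \<in> hom Ker Ker" "\<And>x. x \<in> B \<Longrightarrow> \<theta> x = \<one>"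
    and nontriv: "\<exists>x\<in>carrier Ker. \<theta> x \<noteq> \<one>"
    using Ker.ex_hom_killing_subgroup[of "card (carrier G)" B] B by auto
  define \<nu> where "\<nu> x = (SOME n. n \<in> kernel E G \<pi> \<and> x \<otimes> inv n \<in> D)" for x
  have \<theta>_mult: "\<theta> (m \<otimes> n) = \<theta> m \<otimes> \<theta> n" if "m \<in> kernel E G \<pi>" "n \<in> kernel E G \<pi>" for m n
    using hom_mult[OF \<theta>(1), of m n] that by simp
  have \<theta>_car: "\<theta> n \<in> kernel E G \<pi>" if "n \<in> kernel E G \<pi>" for n
    using hom_in_carrier[OF \<theta>(1), of n] that by simp
  \<comment> \<open>Two kernel components of \<open>x\<close> differ by an element of the kernel
    that also lies in \<open>D\<close>, hence in \<open>B\<close>, where \<open>\<theta>\<close> is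
    trivial.\<close>
  have key: "\<theta> (\<nu> x) = \<theta> n" if x: "x \<in> carrier E" and n: "n \<in> kernel E G \<pi>" "x \<otimes> inv n \<in> D" for x n
  proof -
    have "\<nu> x \<in> kernel E G \<pi> \<and> x \<otimes> inv (\<nu> x) \<in> D"
      unfolding \<nu>_def by (rule someI[of "\<lambda>n. n \<in> kernel E G \<pi> \<and> x \<otimes> inv n \<in> D" n]) (use n in simp)
    then have \<nu>: "\<nu> x \<in> kernel E G \<pi>" "x \<otimes> inv (\<nu> x) \<in> D"
      by auto
    have "inv (x \<otimes> inv (\<nu> x)) \<otimes> (x \<otimes> inv n) = \<nu> x \<otimes> (inv x \<otimes> x) \<otimes> inv n"
      using x \<nu>(1) n(1) by (simp only: in_Ker E.m_assoc E.inv_mult_group E.inv_inv E.m_closed E.inv_closed)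
    also have "\<dots> = \<nu> x \<otimes> inv n"
      using x \<nu>(1) n(1) by simp
    finally have "\<nu> x \<otimes> inv n \<in> D"
      using \<nu> n D.m_closed D.m_inv_closed by metis
    then have b: "\<nu> x \<otimes> inv n \<in> B"
      using \<nu>(1) n(1) by (simp add: B_def)
    have "\<theta> (\<nu> x) = \<theta> ((\<nu> x \<otimes> inv n) \<otimes> n)"
      using \<nu>(1) n(1) by (simp add: E.m_assoc)
    also have "\<dots> = \<theta> (\<nu> x \<otimes> inv n) \<otimes> \<theta> n"
      using \<nu>(1) n(1) by (intro \<theta>_mult) simp_all
    also have "\<dots> = \<theta> n"
      using \<theta>(2)[OF b] \<theta>_car[OF n(1)] by simp
    finally show ?thesis .
  qed
  have "(\<lambda>x. \<theta> (\<nu> x)) \<in> hom E Ker"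
  proof (rule homI)
    fix x
    assume x: "x \<in> carrier E"
    then show "\<theta> (\<nu> x) \<in> carrier Ker"
      using cover[OF x] key[OF x] \<theta>_car by auto
  next
    fix x y
    assume xy: "x \<in> carrier E" "y \<in> carrier E"
    obtain m n where m: "m \<in> kernel E G \<pi>" "x \<otimes> inv m \<in> D" and n: "n \<in> kernel E G \<pi>" "y \<otimes> inv n \<in> D"
      using cover xy by blast
    have "x \<otimes> y \<otimes> inv (m \<otimes> n) = x \<otimes> ((y \<otimes> inv n) \<otimes> inv m)"
      using xy m n by (simp add: E.m_assoc E.inv_mult_group)
    also have "(y \<otimes> inv n) \<otimes> inv m = inv m \<otimes> (y \<otimes> inv n)"
      using xy m n by (intro central[symmetric]) auto
    also have "x \<otimes> (inv m \<otimes> (y \<otimes> inv n)) = (x \<otimes> inv m) \<otimes> (y \<otimes> inv n)"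
      using xy m n by (simp add: E.m_assoc)
    finally have "x \<otimes> y \<otimes> inv (m \<otimes> n) \<in> D"
      using D.m_closed[OF m(2) n(2)] by simp
    then have "\<theta> (\<nu> (x \<otimes> y)) = \<theta> (m \<otimes> n)"
      using xy m n by (intro key) simp_all
    then show "\<theta> (\<nu> (x \<otimes> y)) = \<theta> (\<nu> x) \<otimes>\<^bsub>Ker\<^esub> \<theta> (\<nu> y)"
      using key[OF xy(1) m] key[OF xy(2) n] \<theta>_mult m n by simp
  qed
  then have "\<theta> (\<nu> x) = \<one>" if "x \<in> carrier E" for x
    using hom_Ker_trivial[OF gen _ that] by blast
  moreover have "\<theta> (\<nu> n) = \<theta> n" if "n \<in> kernel E G \<pi>" for n
    using that by (intro key) auto
  ultimately show False
    using nontriv by auto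
qed

text \<open>Simplicity makes \<open>\<pi>\<close> trivial on the kernel of \<open>\<phi>\<close>, so
  it is \<open>\<pi>\<close> that factors through \<open>\<phi>\<close>, as
  \<open>k \<circ> \<phi>\<close>. Counting shows that \<open>\<phi>\<close> is onto and that
  \<open>k\<close> is an automorphism; the required one is its inverse.\<close>

lemma hom_factors_through_iso:
  assumes "simple_group G" "finite (carrier G)" "perfect E"
    and \<phi>: "\<phi> \<in> hom E G" and nontriv: "\<exists>x\<in>carrier E. \<phi> x \<noteq> \<one>\<^bsub>G\<^esub>"
  shows "\<exists>h\<in>iso G G. \<forall>x\<in>carrier E. \<phi> x = h (\<pi> x)"
proof -
  interpret \<phi>: group_hom E G \<phi>
    using \<phi> by unfold_locales
  let ?M = "kernel E G \<phi>"
  have "\<pi> ` ?M \<lhd> G"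
    using normal.surj_hom_normal_subgroup[OF \<phi>.normal_kernel \<pi>.group_hom_axioms \<pi>_surj] .
  then have "\<pi> ` ?M = carrier G \<or> \<pi> ` ?M = {\<one>\<^bsub>G\<^esub>}"
    using simple_group.no_real_normal_subgroup[OF assms(1)] by blast
  moreover have "\<pi> ` ?M \<noteq> carrier G"
  proof
    assume M: "\<pi> ` ?M = carrier G"
    \<comment> \<open>If \<open>\<pi>\<close> maps the kernel of \<open>\<phi>\<close> onto
      \<open>G\<close>, every value of \<open>\<phi>\<close> is attained at a central element. The
      values then commute, which is impossible for a nontrivial \<open>\<phi>\<close> on a perfect
      group.\<close>
    have dec: "\<exists>n\<in>carrier E. \<pi> n = \<one>\<^bsub>G\<^esub> \<and> \<phi> n = \<phi> x" if x: "x \<in> carrier E" for x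
    proof -
      have "\<pi> x \<in> \<pi> ` ?M"
        unfolding M using x by simp
      then obtain m where m: "m \<in> ?M" "\<pi> x = \<pi> m"
        by (rule imageE)
      then have "m \<in> carrier E" "\<phi> m = \<one>\<^bsub>G\<^esub>"
        by (simp_all add: kernel_def)
      with m(2) show ?thesis
        using x by (intro bexI[of _ "inv m \<otimes> x"]) simp_all
    qed
    have "\<phi> x = \<one>\<^bsub>G\<^esub>" if "x \<in> carrier E" for x
    proof (rule perfect_hom_trivial[OF E.is_group G.is_group \<phi> assms(3) that])
      fix x y
      assume xy: "x \<in> carrier E" "y \<in> carrier E"
      then obtain n where n: "n \<in> carrier E" "\<pi> n = \<one>\<^bsub>G\<^esub>" "\<phi> n = \<phi> x"
        using dec by blast
      then show "\<phi> x \<otimes>\<^bsub>G\<^esub> \<phi> y = \<phi> y \<otimes>\<^bsub>G\<^esub> \<phi> x"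
        using central[OF n(1,2) xy(2)] xy by (metis \<phi>.hom_mult)
    qed
    with nontriv show False
      by blast
  qed
  ultimately have M: "\<pi> x = \<one>\<^bsub>G\<^esub>" if "x \<in> carrier E" "\<phi> x = \<one>\<^bsub>G\<^esub>" for x
    using that by (auto simp: kernel_def)
  have \<pi>_\<phi>: "\<pi> x = \<pi> y" if "x \<in> carrier E" "y \<in> carrier E" "\<phi> x = \<phi> y" for x y
  proof -
    have "\<pi> (x \<otimes> inv y) = \<one>\<^bsub>G\<^esub>"
      using that by (intro M) simp_all
    then show ?thesis
      using that by (simp add: G.inv_solve_right')
  qed
  define r where "r g = (SOME x. x \<in> carrier E \<and> \<phi> x = g)" for g
  have r: "r (\<phi> x) \<in> carrier E" "\<phi> (r (\<phi> x)) = \<phi> x" if "x \<in> carrier E" for x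
    using someI[of "\<lambda>y. y \<in> carrier E \<and> \<phi> y = \<phi> x" x] that by (auto simp: r_def)
  define k where "k g = \<pi> (r g)" for g
  have k: "k (\<phi> x) = \<pi> x" if "x \<in> carrier E" for x
    using \<pi>_\<phi>[OF r(1)] r(2) that by (simp add: k_def)
  have "k ` (\<phi> ` carrier E) = carrier G"
    using k \<pi>_surj by (simp add: image_image)
  then have "card (carrier G) \<le> card (\<phi> ` carrier E)"
    using assms(2) by (metis \<phi>.hom_closed card_image_le finite_subset image_subsetI)
  then have \<phi>_surj: "\<phi> ` carrier E = carrier G"
    using assms(2) by (intro card_seteq) auto
  have k_surj: "k ` carrier G = carrier G"
    using \<open>k ` (\<phi> ` carrier E) = carrier G\<close> \<phi>_surj by simp
  then have k_bij: "bij_betw k (carrier G) (carrier G)"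
    using assms(2) by (simp add: bij_betw_def finite_surj_inj)
  have "k \<in> hom G G"
  proof (rule homI)
    fix g h
    assume "g \<in> carrier G" "h \<in> carrier G"
    then obtain x y where xy: "x \<in> carrier E" "g = \<phi> x" "y \<in> carrier E" "h = \<phi> y"
      unfolding \<phi>_surj[symmetric] by blast
    then show "k (g \<otimes>\<^bsub>G\<^esub> h) = k g \<otimes>\<^bsub>G\<^esub> k h"
      using k[of "x \<otimes> y"] k by simp
  qed (use k_surj in blast)
  then have "k \<in> iso G G"
    using k_bij by (simp add: iso_def)
  then have "inv_into (carrier G) k \<in> iso G G"
    by (rule G.iso_set_sym)
  moreover have "\<phi> x = inv_into (carrier G) k (\<pi> x)" if "x \<in> carrier E" for x
    using inv_into_f_f[of k "carrier G" "\<phi> x"] k[OF that] k_bij that by (simp add: bij_betw_def)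
  ultimately show ?thesis
    by blast
qed

lemma cellular_cover_iff_Aut_invariant:
  assumes "simple_group G" "finite (carrier G)" "perfect E"
  shows "cellular_cover E G \<pi> \<longleftrightarrow> Aut_invariant G (H2image E G \<pi>)"
proof -
  let ?S = "H2image E G \<pi>"
  have comp: "(\<lambda>x. h (\<pi> x)) \<in> hom E G" if "h \<in> iso G G" for h
    using hom_compose[OF \<pi>_hom iso_imp_homomorphism[OF that]] by (simp add: o_def)
  have S_map: "H2map G h ` ?S = H2image E G (\<lambda>x. h (\<pi> x))" if "h \<in> iso G G" for h
    using that by (intro H2map_H2image E.is_group G.is_group \<pi>_hom) (simp add: iso_def)
  show ?thesis
  proof
    assume cell: "cellular_cover E G \<pi>"
    have sub: "H2map G h ` ?S \<subseteq> ?S" if h: "h \<in> iso G G" for h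
    proof -
      obtain f where "f \<in> hom E E" "\<And>x. x \<in> carrier E \<Longrightarrow> \<pi> (f x) = h (\<pi> x)"
        using cell comp[OF h] unfolding cellular_cover_def by meson
      then show ?thesis
        unfolding S_map[OF h] by (intro H2image_factor E.is_group G.is_group \<pi>_hom comp[OF h])
    qed
    \<comment> \<open>Equality of images follows by applying the inclusion \<open>sub\<close> to the
      inverse automorphism \<open>?k\<close> and then mapping by \<open>h\<close>.\<close>
    have "?S \<subseteq> H2map G h ` ?S" if h: "h \<in> iso G G" for h
    proof -
      let ?k = "inv_into (carrier G) h"
      have k: "?k \<in> iso G G"
        using G.iso_set_sym[OF h] .
      have hk: "h (?k g) = g" if "g \<in> carrier G" for g
        using h that by (auto simp: iso_def bij_betw_def intro: f_inv_into_f)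
      have h': "h \<in> hom G G"
        using h by (simp add: iso_def)
      have hkc: "(\<lambda>x. h (?k (\<pi> x))) \<in> hom E G"
        using hom_compose[OF comp[OF k] h'] by (simp add: o_def)
      have "?S \<subseteq> H2image E G (\<lambda>x. h (?k (\<pi> x)))"
        by (rule H2image_factor[OF E.is_group E.is_group G.is_group \<pi>_hom hkc, of "\<lambda>x. x"])
          (simp_all add: hk hom_def)
      also have "\<dots> = H2map G h ` H2map G ?k ` ?S"
        unfolding S_map[OF k] using H2map_H2image[OF E.is_group G.is_group G.is_group comp[OF k] h'] ..
      also have "\<dots> \<subseteq> H2map G h ` ?S"
        using sub[OF k] by blast
      finally show ?thesis .
    qed
    with sub show "Aut_invariant G ?S"
      unfolding Aut_invariant_def by blast
  next
    assume inv: "Aut_invariant G ?S"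
    have "\<exists>f\<in>hom E E. \<forall>x\<in>carrier E. \<pi> (f x) = \<phi> x" if \<phi>: "\<phi> \<in> hom E G" for \<phi>
    proof (cases "\<exists>x\<in>carrier E. \<phi> x \<noteq> \<one>\<^bsub>G\<^esub>")
      case True
      then obtain h where h: "h \<in> iso G G" "\<forall>x\<in>carrier E. \<phi> x = h (\<pi> x)"
        using hom_factors_through_iso[OF assms \<phi>] by blast
      have "H2image E G (\<lambda>x. h (\<pi> x)) \<subseteq> ?S"
        using inv h(1) S_map[OF h(1)] by (simp add: Aut_invariant_def)
      then show ?thesis
        using lift_if_H2image_subset[OF E.is_group assms(3) comp[OF h(1)]] h(2) by simp
    next
      case False
      then show ?thesis
        by (intro bexI[of _ "\<lambda>_. \<one>"]) (auto simp: hom_def)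
    qed
    then show "cellular_cover E G \<pi>"
      using gen_subgroup_if_perfect[OF assms(3)] by (simp add: cellular_cover_def)
  qed
qed

end

section \<open>Cyclic groups\<close>

lemma (in group) bar3_in_bounds2:
  "x \<in> carrier G \<Longrightarrow> y \<in> carrier G \<Longrightarrow> z \<in> carrier G \<Longrightarrow> bar3 G (x, y, z) \<in> bounds2 G"
  unfolding bounds2_def bd3_single[symmetric] by (intro imageI) (simp add: chains3_eq)

text \<open>In terms of \<open>T i = (\<Sum>k<i. [g ^ k, g])\<close>, the class of \<open>[g ^ i, g ^ j]\<close> modulo boundaries is
  \<open>[1, 1] + T (i + j) - T i - T j\<close>, and \<open>T (i + n) = T i + T n\<close> for the order \<open>n\<close> of \<open>g\<close>. Thus
  modulo boundaries a chain is \<open>- T\<close> applied to its \<open>bd2\<close>, up to multiples \<open>a\<close> of \<open>[1, 1]\<close> and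
  \<open>b\<close> of \<open>T n\<close>, both of which are detected by \<open>bd2\<close> as well.\<close>

lemma (in group) cyclic_cycles2_subset_bounds2:
  assumes fin: "finite (carrier G)" and g: "g \<in> carrier G" "generate G {g} = carrier G"
  shows "cycles2 G \<subseteq> bounds2 G"
proof
  define n where "n = ord g"
  have n: "n > 0"
    using ord_ge_1[OF fin g(1)] by (simp add: n_def)
  have gn: "g [^] n = \<one>"
    using g by (simp add: n_def)
  let ?e = "single (\<one>, \<one>)"
  define T where "T i = (\<Sum>k<i. single (g [^] k, g))" for i :: nat
  have T0: "T 0 = 0" and TS: "T (Suc i) = T i + single (g [^] i, g)" for i
    by (simp_all add: T_def)
  \<comment> \<open>The summands of \<open>T\<close> are periodic with period \<open>n\<close>
    because \<open>g [^] n\<close> is the unit.\<close>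
  have Tn: "T (n + i) = T n + T i" for i
    by (induction i) (simp_all add: T0 TS gn g algebra_simps flip: nat_pow_mult)
  \<comment> \<open>Induction on \<open>j\<close>: adding the boundary
    \<open>bar3 G (g [^] i, g [^] j, g)\<close> raises the second exponent by one, and its other two
    terms update \<open>T\<close>.\<close>
  have cls: "single (g [^] i, g [^] j) - ?e - T (i + j) + T i + T j \<in> bounds2 G" for i j
  proof (induction j)
    case 0
    have "single (g [^] i, \<one>) - ?e = - bar3 G (g [^] i, \<one>, \<one>)"
      using g by (simp add: bar3_def)
    then show ?case
      using bounds2_closed(3)[OF bar3_in_bounds2[of "g [^] i" \<one> \<one>]] g by (simp add: T0)
  next
    case (Suc j)
    have eq: "single (g [^] i, g [^] Suc j) - ?e - T (i + Suc j) + T i + T (Suc j) =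
      (single (g [^] i, g [^] j) - ?e - T (i + j) + T i + T j) + bar3 G (g [^] i, g [^] j, g)"
      using g by (simp add: bar3_def TS nat_pow_mult)
    show ?case
      unfolding eq using g by (intro bounds2_closed(2) Suc bar3_in_bounds2) simp_all
  qed
  have ex: "\<exists>i<n. x = g [^] i" if x: "x \<in> carrier G" for x
  proof -
    obtain i :: nat where "x = g [^] i"
      using x generate_pow_on_finite_carrier[OF fin g(1)] g(2) by auto
    then have "x = g [^] (i mod n)"
      using g gn by (metis (no_types) mult_div_mod_eq nat_pow_mult nat_pow_pow nat_pow_one l_one nat_pow_closed)
    then show ?thesis
      using n by (intro exI[of _ "i mod n"]) simp
  qed
  define lg where "lg x = (SOME i. i < n \<and> x = g [^] i)" for x
  have lg: "lg x < n" "g [^] lg x = x" if "x \<in> carrier G" for x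
    using someI_ex[OF ex[OF that, unfolded Bex_def]] by (simp_all add: lg_def)
  have lg_unique: "lg (g [^] i) = i" if "i < n" for i
    using ord_inj[OF g(1)] lg[of "g [^] i"] that g n
    by (auto simp: n_def dest!: inj_onD[of _ _ "lg (g [^] i)" i])
  let ?L = "chain_ext (\<lambda>x. T (lg x))"
  \<comment> \<open>Functions on \<open>unit\<close> stand for integers. On the boundary of a basis
    element \<open>(x, y)\<close>, \<open>?aug\<close> is 1 and \<open>?wt\<close> is
    \<open>lg x + lg y - lg (x \<otimes> y)\<close>, a multiple of \<open>n\<close>; so they recover
    the coefficients \<open>a\<close> and \<open>n * b\<close>.\<close>
  let ?aug = "chain_ext (\<lambda>x (_ :: unit). 1)"
  let ?wt = "chain_ext (\<lambda>x (_ :: unit). int (lg x))"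
  define P where "P z \<longleftrightarrow> (\<exists>a b. z - of_int a * ?e - of_int b * T n + ?L (bd2 G z) \<in> bounds2 G \<and>
      ?aug (bd2 G z) = (\<lambda>_. a) \<and> ?wt (bd2 G z) = (\<lambda>_. int n * b))" for z
  have P: "P z" if "z \<in> chains2 G" for z
    using that unfolding chains2_eq
  proof (induction rule: chain_induct)
    case zero
    show ?case
      unfolding P_def using bounds2_closed(1)[of G]
      by (intro exI[of _ 0]) (simp add: zero_fun_def[symmetric])
  next
    case (single p)
    then obtain x y where p: "p = (x, y)" and xy: "x \<in> carrier G" "y \<in> carrier G"
      by auto
    have xyc: "x \<otimes> y \<in> carrier G"
      using xy by simp
    \<comment> \<open>The carry when the exponents of \<open>x\<close> and \<open>y\<close> are
      added modulo \<open>n\<close>.\<close>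
    define b where "b = (if lg x + lg y < n then 0 else 1 :: int)"
    have prod: "x \<otimes> y = g [^] (lg x + lg y)"
      using lg(2)[OF xy(1)] lg(2)[OF xy(2)] g nat_pow_mult by metis
    have b: "int (lg x) + int (lg y) = int (lg (x \<otimes> y)) + int n * b \<and>
        T (lg x + lg y) = T (lg (x \<otimes> y)) + of_int b * T n"
    proof (cases "lg x + lg y < n")
      case True
      then show ?thesis
        using lg_unique[OF True] prod by (simp add: b_def)
    next
      case False
      define k where "k = lg x + lg y - n"
      have k: "lg x + lg y = n + k" "k < n"
        using False lg(1)[OF xy(1)] lg(1)[OF xy(2)] by (simp_all add: k_def)
      have "x \<otimes> y = g [^] k"
        using prod k(1) gn g by (simp flip: nat_pow_mult)
      then have "lg (x \<otimes> y) = k"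
        using lg_unique[OF k(2)] by simp
      then show ?thesis
        using k False by (simp add: b_def Tn)
    qed
    have bd: "bd2 G (single p) = single y - single (x \<otimes> y) + single x"
      by (simp add: bd2_single bar2_def p)
    have ext: "chain_ext E (bd2 G (single p)) = E y - E (x \<otimes> y) + E x" for E :: "'a \<Rightarrow> 'q \<Rightarrow> int"
      unfolding bd by (simp add: chain_ext_add[where S=UNIV] chain_ext_diff[where S=UNIV])
    have "single p - of_int 1 * ?e - of_int b * T n + ?L (bd2 G (single p)) =
        single (g [^] lg x, g [^] lg y) - ?e - T (lg x + lg y) + T (lg x) + T (lg y)"
      unfolding ext using b lg xy by (simp add: p)
    also have "\<dots> \<in> bounds2 G"
      by (rule cls)
    finally have "single p - of_int 1 * ?e - of_int b * T n + ?L (bd2 G (single p)) \<in> bounds2 G" .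
    moreover have "?aug (bd2 G (single p)) = (\<lambda>_. 1)" "?wt (bd2 G (single p)) = (\<lambda>_. int n * b)"
      unfolding ext using b by (simp_all add: fun_eq_iff fun_apply)
    ultimately show ?case
      unfolding P_def by blast
  next
    case (add z w)
    then obtain a b c d where
      z: "z - of_int a * ?e - of_int b * T n + ?L (bd2 G z) \<in> bounds2 G"
        "?aug (bd2 G z) = (\<lambda>_. a)" "?wt (bd2 G z) = (\<lambda>_. int n * b)" and
      w: "w - of_int c * ?e - of_int d * T n + ?L (bd2 G w) \<in> bounds2 G"
        "?aug (bd2 G w) = (\<lambda>_. c)" "?wt (bd2 G w) = (\<lambda>_. int n * d)"
      unfolding P_def by blast
    have zw: "z \<in> chains2 G" "w \<in> chains2 G"
      using add by (simp_all add: chains2_eq)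
    have ext: "chain_ext E (bd2 G (z + w)) = chain_ext E (bd2 G z) + chain_ext E (bd2 G w)"
      for E :: "'a \<Rightarrow> 'q \<Rightarrow> int"
      using bd2_in_fin_chains[OF is_group] zw
      by (simp add: bd2_add chain_ext_add[where S="carrier G"])
    show ?case
      unfolding P_def ext
    proof (rule exI[of _ "a + c"], rule exI[of _ "b + d"], intro conjI)
      show "z + w - of_int (a + c) * ?e - of_int (b + d) * T n + (?L (bd2 G z) + ?L (bd2 G w)) \<in> bounds2 G"
        using bounds2_closed(2)[OF z(1) w(1)] by (simp add: algebra_simps)
    qed (simp_all add: z w fun_eq_iff fun_apply algebra_simps)
  next
    case (uminus z)
    then obtain a b where
      z: "z - of_int a * ?e - of_int b * T n + ?L (bd2 G z) \<in> bounds2 G"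
        "?aug (bd2 G z) = (\<lambda>_. a)" "?wt (bd2 G z) = (\<lambda>_. int n * b)"
      unfolding P_def by blast
    show ?case
      unfolding P_def bd2_uminus chain_ext_uminus
    proof (rule exI[of _ "- a"], rule exI[of _ "- b"], intro conjI)
      show "- z - of_int (- a) * ?e - of_int (- b) * T n + - ?L (bd2 G z) \<in> bounds2 G"
        using bounds2_closed(3)[OF z(1)] by (simp add: algebra_simps)
    qed (simp_all add: z fun_eq_iff fun_apply)
  qed
  fix z
  assume "z \<in> cycles2 G"
  then have z: "z \<in> chains2 G" "bd2 G z = 0"
    by (simp_all add: cycles2_eq)
  then obtain a b where ab: "z - of_int a * ?e - of_int b * T n \<in> bounds2 G"
    "(0 :: unit \<Rightarrow> int) = (\<lambda>_. a)" "(0 :: unit \<Rightarrow> int) = (\<lambda>_. int n * b)"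
    using P[OF z(1)] unfolding P_def by auto
  then have "a = 0" "b = 0"
    using n by (auto simp: fun_eq_iff fun_apply)
  then show "z \<in> bounds2 G"
    using ab(1) by simp
qed

text \<open>The order of \<open>m\<close> divides that of \<open>g\<close> by
  \<open>kernel_exponent\<close>, so sending \<open>x\<close> to \<open>m [^] i\<close> whenever
  \<open>\<pi> x\<close> is the power of \<open>g\<close> with exponent \<open>i\<close> is a
  well-defined homomorphism into the kernel. It is trivial, yet takes the value \<open>m\<close> at
  a preimage of \<open>g\<close>.\<close>

lemma (in central_ext) inj_if_cyclic:
  assumes gen: "gen_subgroup E G \<pi>" and fin: "finite (carrier G)"
    and g: "g \<in> carrier G" "generate G {g} = carrier G"
    and m: "m \<in> carrier E" "\<pi> m = \<one>\<^bsub>G\<^esub>"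
  shows "m = \<one>"
proof -
  have "m [^] G.ord g = \<one>"
    using kernel_exponent[OF gen m] G.generate_pow_card[OF g(1)] g(2) by simp
  then have ord: "E.ord m dvd G.ord g"
    using E.pow_eq_id[OF m(1)] by blast
  have ex: "\<exists>i::int. \<pi> x = g [^]\<^bsub>G\<^esub> i" if "x \<in> carrier E" for x
    using \<pi>.hom_closed[OF that] G.generate_pow[OF g(1)] g(2) by auto
  define e where "e x = (SOME i::int. \<pi> x = g [^]\<^bsub>G\<^esub> i)" for x
  have e: "\<pi> x = g [^]\<^bsub>G\<^esub> e x" if "x \<in> carrier E" for x
    unfolding e_def by (rule someI_ex[OF ex[OF that]])
  have key: "m [^] e x = m [^] i" if x: "x \<in> carrier E" "\<pi> x = g [^]\<^bsub>G\<^esub> i" for x and i :: int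
  proof -
    have "g [^]\<^bsub>G\<^esub> (e x - i) = \<one>\<^bsub>G\<^esub>"
      using e[OF x(1)] x g by (simp add: G.int_pow_diff)
    then have "int (G.ord g) dvd e x - i"
      using G.int_pow_eq_id[OF g(1)] by simp
    then have "m [^] (e x - i) = \<one>"
      using ord E.int_pow_eq_id[OF m(1)] by (meson dvd_trans int_dvd_int_iff)
    then show ?thesis
      using m by (simp add: E.int_pow_diff E.inv_solve_right' )
  qed
  have Ker_pow: "m [^] i \<in> carrier E" "\<pi> (m [^] i) = \<one>\<^bsub>G\<^esub>" for i :: int
    using m by (simp_all add: \<pi>.hom_int_pow)
  have "(\<lambda>x. m [^] e x) \<in> hom E Ker"
  proof (rule homI)
    fix x y
    assume xy: "x \<in> carrier E" "y \<in> carrier E"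
    have "\<pi> (x \<otimes> y) = g [^]\<^bsub>G\<^esub> (e x + e y)"
      using xy g by (simp add: e[symmetric] G.int_pow_mult)
    then have "m [^] e (x \<otimes> y) = m [^] (e x + e y)"
      using xy by (intro key) simp_all
    then show "m [^] e (x \<otimes> y) = m [^] e x \<otimes>\<^bsub>Ker\<^esub> m [^] e y"
      using m by (simp add: E.int_pow_mult)
  qed (simp add: Ker_pow)
  then have triv: "m [^] e x = \<one>" if "x \<in> carrier E" for x
    using hom_Ker_trivial[OF gen _ that] by blast
  obtain k where k: "k \<in> carrier E" "\<pi> k = g"
    using \<pi>_surj g(1) by (metis imageE)
  have "m [^] e k = m [^] (1::int)"
    using k g by (intro key) simp_all
  then show ?thesis
    using triv[OF k(1)] m by simp
qed

lemma (in simple_group) perfect_or_cyclic: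
  "perfect G \<or> (\<exists>g\<in>carrier G. generate G {g} = carrier G)"
proof (cases "perfect G")
  case False
  have "derived G (carrier G) \<lhd> G"
    by (rule derived_is_normal[OF normal_self])
  then have triv: "derived G (carrier G) = {\<one>}"
    using no_real_normal_subgroup False by blast
  have "x \<otimes> y = y \<otimes> x" if xy: "x \<in> carrier G" "y \<in> carrier G" for x y
  proof -
    have "x \<otimes> y \<otimes> inv x \<otimes> inv y \<in> derived G (carrier G)"
      unfolding derived_def using xy by (intro generate.incl) blast
    then have "x \<otimes> y \<otimes> inv (y \<otimes> x) = \<one>"
      using xy triv by (simp add: inv_mult_group m_assoc)
    then show ?thesis
      using xy inv_solve_right'[of \<one> "x \<otimes> y" "y \<otimes> x"] by simp
  qed
  then interpret comm_group G
    by (rule group_comm_groupI)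
  obtain g where g: "g \<in> carrier G" "g \<noteq> \<one>"
    using simple_not_triv one_closed by blast
  have "generate G {g} \<lhd> G"
    by (rule subgroup_imp_normal[OF generate_is_subgroup]) (use g in simp)
  moreover have "generate G {g} \<noteq> {\<one>}"
    using g generate.incl[of g "{g}" G] by blast
  ultimately show ?thesis
    using no_real_normal_subgroup g(1) by blast
qed simp

section \<open>Perfect central extensions realizing subgroups of the multiplier\<close>

text \<open>The extension of \<open>G\<close> by the abelian group \<open>Q\<close> with factor set
  \<open>a\<close>. The chosen unit is neutral because only normalized factor sets are used.\<close>

definition ext_group ::
    "('q, 'm) monoid_scheme \<Rightarrow> ('a, 'n) monoid_scheme \<Rightarrow> ('a \<Rightarrow> 'a \<Rightarrow> 'q) \<Rightarrow> ('q \<times> 'a) monoid" where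
  "ext_group Q G a = \<lparr>carrier = carrier Q \<times> carrier G,
     monoid.mult = (\<lambda>(u, g) (v, h). (u \<otimes>\<^bsub>Q\<^esub> v \<otimes>\<^bsub>Q\<^esub> a g h, g \<otimes>\<^bsub>G\<^esub> h)),
     one = (\<one>\<^bsub>Q\<^esub>, \<one>\<^bsub>G\<^esub>)\<rparr>"

lemma ext_group_simps [simp]:
  "carrier (ext_group Q G a) = carrier Q \<times> carrier G"
  "(u, g) \<otimes>\<^bsub>ext_group Q G a\<^esub> (v, h) = (u \<otimes>\<^bsub>Q\<^esub> v \<otimes>\<^bsub>Q\<^esub> a g h, g \<otimes>\<^bsub>G\<^esub> h)"
  "\<one>\<^bsub>ext_group Q G a\<^esub> = (\<one>\<^bsub>Q\<^esub>, \<one>\<^bsub>G\<^esub>)"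
  by (simp_all add: ext_group_def)

locale normalized_cocycle = Q: comm_group Q + G: group G for Q and G +
  fixes a
  assumes cocycle_closed: "g \<in> carrier G \<Longrightarrow> h \<in> carrier G \<Longrightarrow> a g h \<in> carrier Q"
    and cocycle: "g \<in> carrier G \<Longrightarrow> h \<in> carrier G \<Longrightarrow> k \<in> carrier G \<Longrightarrow>
      a g h \<otimes>\<^bsub>Q\<^esub> a (g \<otimes>\<^bsub>G\<^esub> h) k = a h k \<otimes>\<^bsub>Q\<^esub> a g (h \<otimes>\<^bsub>G\<^esub> k)"
    and cocycle_one: "g \<in> carrier G \<Longrightarrow> a \<one>\<^bsub>G\<^esub> g = \<one>\<^bsub>Q\<^esub>" "g \<in> carrier G \<Longrightarrow> a g \<one>\<^bsub>G\<^esub> = \<one>\<^bsub>Q\<^esub>"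
begin

lemma group_ext_group: "group (ext_group Q G a)"
proof (rule groupI)
  fix x y z
  assume "x \<in> carrier (ext_group Q G a)" "y \<in> carrier (ext_group Q G a)" "z \<in> carrier (ext_group Q G a)"
  then obtain u g v h w k where x: "x = (u, g)" "y = (v, h)" "z = (w, k)"
    and c: "u \<in> carrier Q" "v \<in> carrier Q" "w \<in> carrier Q" "g \<in> carrier G" "h \<in> carrier G" "k \<in> carrier G"
    by auto
  have "u \<otimes>\<^bsub>Q\<^esub> v \<otimes>\<^bsub>Q\<^esub> a g h \<otimes>\<^bsub>Q\<^esub> w \<otimes>\<^bsub>Q\<^esub> a (g \<otimes>\<^bsub>G\<^esub> h) k =
      u \<otimes>\<^bsub>Q\<^esub> v \<otimes>\<^bsub>Q\<^esub> w \<otimes>\<^bsub>Q\<^esub> (a g h \<otimes>\<^bsub>Q\<^esub> a (g \<otimes>\<^bsub>G\<^esub> h) k)"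
    using c by (simp add: cocycle_closed Q.m_ac)
  also have "\<dots> = u \<otimes>\<^bsub>Q\<^esub> (v \<otimes>\<^bsub>Q\<^esub> w \<otimes>\<^bsub>Q\<^esub> a h k) \<otimes>\<^bsub>Q\<^esub> a g (h \<otimes>\<^bsub>G\<^esub> k)"
    unfolding cocycle[OF c(4-6)] using c by (simp add: cocycle_closed Q.m_ac)
  finally show "x \<otimes>\<^bsub>ext_group Q G a\<^esub> y \<otimes>\<^bsub>ext_group Q G a\<^esub> z =
      x \<otimes>\<^bsub>ext_group Q G a\<^esub> (y \<otimes>\<^bsub>ext_group Q G a\<^esub> z)"
    using c by (simp add: x G.m_assoc)
next
  fix x
  assume "x \<in> carrier (ext_group Q G a)"
  then obtain u g where x: "x = (u, g)" "u \<in> carrier Q" "g \<in> carrier G"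
    by auto
  let ?y = "(inv\<^bsub>Q\<^esub> u \<otimes>\<^bsub>Q\<^esub> inv\<^bsub>Q\<^esub> a (inv\<^bsub>G\<^esub> g) g, inv\<^bsub>G\<^esub> g)"
  have a: "a (inv\<^bsub>G\<^esub> g) g \<in> carrier Q"
    using x by (simp add: cocycle_closed)
  have "inv\<^bsub>Q\<^esub> u \<otimes>\<^bsub>Q\<^esub> inv\<^bsub>Q\<^esub> a (inv\<^bsub>G\<^esub> g) g \<otimes>\<^bsub>Q\<^esub> u \<otimes>\<^bsub>Q\<^esub> a (inv\<^bsub>G\<^esub> g) g =
      (inv\<^bsub>Q\<^esub> u \<otimes>\<^bsub>Q\<^esub> u) \<otimes>\<^bsub>Q\<^esub> (inv\<^bsub>Q\<^esub> a (inv\<^bsub>G\<^esub> g) g \<otimes>\<^bsub>Q\<^esub> a (inv\<^bsub>G\<^esub> g) g)"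
    using x a by (simp only: Q.m_ac Q.inv_closed Q.m_closed)
  then have "?y \<otimes>\<^bsub>ext_group Q G a\<^esub> x = \<one>\<^bsub>ext_group Q G a\<^esub>"
    using x a by simp
  moreover have "?y \<in> carrier (ext_group Q G a)"
    using x a by simp
  ultimately show "\<exists>y\<in>carrier (ext_group Q G a). y \<otimes>\<^bsub>ext_group Q G a\<^esub> x = \<one>\<^bsub>ext_group Q G a\<^esub>"
    by blast
  show "\<one>\<^bsub>ext_group Q G a\<^esub> \<otimes>\<^bsub>ext_group Q G a\<^esub> x = x"
    using x by (simp add: cocycle_one)
qed (auto simp: cocycle_closed)

lemma central_ext_ext_group: "central_ext (ext_group Q G a) G snd"
proof -
  interpret E: group "ext_group Q G a"
    by (rule group_ext_group)
  show ?thesis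
  proof
    show "snd \<in> hom (ext_group Q G a) G"
      by (rule homI) auto
    show "snd ` carrier (ext_group Q G a) = carrier G"
      by (auto intro!: image_eqI[of _ snd "(\<one>\<^bsub>Q\<^esub>, _)"])
  qed (auto simp: cocycle_one Q.m_ac)
qed

end

section \<open>The cover attached to a group of cycles containing the boundaries\<close>

declare mult_FactGroup [simp del] one_FactGroup [simp del]

text \<open>A section of \<open>bd2\<close> given on the basis of the 1-chains. Extended additively,
  it splits the 2-chains into the cycles and the span of the \<open>\<sigma> g\<close>.\<close>

locale bd2_section = G: group G for G (structure) +
  fixes \<sigma> :: "'a \<Rightarrow> 'a \<times> 'a \<Rightarrow> int"
  assumes \<sigma>: "g \<in> carrier G \<Longrightarrow> \<sigma> g \<in> chains2 G" "g \<in> carrier G \<Longrightarrow> bd2 G (\<sigma> g) = single g"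
    and \<sigma>_one: "\<sigma> \<one> = single (\<one>, \<one>)"
    and perf: "perfect G"
begin

text \<open>\<open>\<rho>\<close> retracts the 2-chains onto the cycles. The choice of \<open>\<sigma> \<one>\<close> makes it kill \<open>[1, 1]\<close>, so that
  the factor sets below are normalized.\<close>

definition \<rho> :: "('a \<times> 'a \<Rightarrow> int) \<Rightarrow> ('a \<times> 'a \<Rightarrow> int)" where
  "\<rho> z = z - chain_ext \<sigma> (bd2 G z)"

lemma ext_\<sigma>: "c \<in> fin_chains (carrier G) \<Longrightarrow> chain_ext \<sigma> c \<in> chains2 G"
  unfolding chains2_eq by (erule chain_ext_in_fin_chains) (use \<sigma> in \<open>simp add: chains2_eq\<close>)

lemma bd2_ext_\<sigma>:
  assumes c: "c \<in> fin_chains (carrier G)"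
  shows "bd2 G (chain_ext \<sigma> c) = c"
proof -
  have "bd2 G (chain_ext \<sigma> c) = chain_ext (\<lambda>g. bd2 G (\<sigma> g)) c"
    unfolding bd2_eq by (rule chain_ext_comp[OF c \<sigma>(1)[unfolded chains2_eq]])
  also have "\<dots> = chain_ext single c"
    by (rule chain_ext_cong[OF c \<sigma>(2)])
  also have "\<dots> = c"
    by (rule chain_ext_id[OF c])
  finally show ?thesis .
qed

lemma \<rho>_cycles: "z \<in> chains2 G \<Longrightarrow> \<rho> z \<in> cycles2 G"
  using ext_\<sigma>[OF bd2_in_fin_chains[OF G.is_group]] bd2_ext_\<sigma>[OF bd2_in_fin_chains[OF G.is_group]]
  by (simp add: \<rho>_def cycles2_eq bd2_diff) (simp add: chains2_eq)

lemma \<rho>_id: "z \<in> cycles2 G \<Longrightarrow> \<rho> z = z"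
  by (simp add: \<rho>_def cycles2_eq)

lemma \<rho>_add: "z \<in> chains2 G \<Longrightarrow> w \<in> chains2 G \<Longrightarrow> \<rho> (z + w) = \<rho> z + \<rho> w"
  using bd2_in_fin_chains[OF G.is_group]
  by (simp add: \<rho>_def bd2_add chain_ext_add[where S="carrier G"])

definition quot :: "('a \<times> 'a \<Rightarrow> int) set \<Rightarrow> ('a \<times> 'a \<Rightarrow> int) \<Rightarrow> ('a \<times> 'a \<Rightarrow> int) set" where
  "quot B z = B #>\<^bsub>Z2grp G\<^esub> z"

text \<open>Since \<open>\<rho>\<close> fixes cycles, the linear extension of this factor set
  restricts to the quotient map on cycles. It represents the class that universal coefficients
  assign to that quotient map.\<close>

definition factor_set :: "('a \<times> 'a \<Rightarrow> int) set \<Rightarrow> 'a \<Rightarrow> 'a \<Rightarrow> ('a \<times> 'a \<Rightarrow> int) set" where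
  "factor_set B g h = quot B (\<rho> (single (g, h)))"

abbreviation cover :: "('a \<times> 'a \<Rightarrow> int) set \<Rightarrow> (('a \<times> 'a \<Rightarrow> int) set \<times> 'a) monoid" where
  "cover B \<equiv> ext_group (Z2grp G Mod B) G (factor_set B)"

end

locale multiplier_quotient = bd2_section +
  fixes B
  assumes B: "subgroup B (Z2grp G)" "bounds2 G \<subseteq> B"
begin

abbreviation "Q \<equiv> Z2grp G Mod B"

sublocale Q: comm_group Q
  using comm_group.abelian_FactGroup[OF comm_group_Z2grp B(1)] .

lemma B_normal: "B \<lhd> Z2grp G"
  by (rule comm_group.subgroup_imp_normal[OF comm_group_Z2grp B(1)])

lemma quot_hom: "quot B \<in> hom (Z2grp G) Q"
  unfolding quot_def by (rule normal.r_coset_hom_Mod[OF B_normal])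

lemma quot_closed [simp]: "z \<in> cycles2 G \<Longrightarrow> quot B z \<in> carrier Q"
  using hom_in_carrier[OF quot_hom, of z] by simp

lemma quot_add: "z \<in> cycles2 G \<Longrightarrow> w \<in> cycles2 G \<Longrightarrow> quot B (z + w) = quot B z \<otimes>\<^bsub>Q\<^esub> quot B w"
  using hom_mult[OF quot_hom, of z w] by simp

lemma quot_eq_iff: "z \<in> cycles2 G \<Longrightarrow> w \<in> cycles2 G \<Longrightarrow> quot B z = quot B w \<longleftrightarrow> z - w \<in> B"
  unfolding quot_def by (rule Z2grp_coset_eq_iff[OF B(1)])

lemma quot_zero: "quot B 0 = \<one>\<^bsub>Q\<^esub>"
  using hom_one[OF quot_hom group_Z2grp Q.is_group] by simp

lemma quot_eq_one_iff: "z \<in> cycles2 G \<Longrightarrow> quot B z = \<one>\<^bsub>Q\<^esub> \<longleftrightarrow> z \<in> B"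
  using quot_eq_iff[of z 0] by (simp add: quot_zero cycles2_closed)

lemma carrier_Q: "carrier Q = quot B ` cycles2 G"
  by (simp add: carrier_FactGroup quot_def)

lemma factor_set_closed: "g \<in> carrier G \<Longrightarrow> h \<in> carrier G \<Longrightarrow> factor_set B g h \<in> carrier Q"
  unfolding factor_set_def by (intro quot_closed \<rho>_cycles) (simp add: chains2_eq)

text \<open>The two sides differ by the class of \<open>\<rho> (bar3 G (g, h, k))\<close>. As a
  boundary, \<open>bar3 G (g, h, k)\<close> is a cycle, so \<open>\<rho>\<close> fixes it, and it
  lies in \<open>B\<close>.\<close>

lemma factor_set_cocycle:
  assumes "g \<in> carrier G" "h \<in> carrier G" "k \<in> carrier G"
  shows "factor_set B g h \<otimes>\<^bsub>Q\<^esub> factor_set B (g \<otimes> h) k = factor_set B h k \<otimes>\<^bsub>Q\<^esub> factor_set B g (h \<otimes> k)"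
proof -
  have c: "single (x, y) \<in> chains2 G" if "x \<in> carrier G" "y \<in> carrier G" for x y
    using that by (simp add: chains2_eq)
  let ?p = "single (h, k) + single (g, h \<otimes> k)" and ?m = "single (g, h) + single (g \<otimes> h, k)"
  have pm: "?p \<in> chains2 G" "?m \<in> chains2 G"
    using assms by (simp_all add: chains2_eq)
  have b: "bar3 G (g, h, k) \<in> bounds2 G" "bar3 G (g, h, k) = ?p - ?m"
    using G.bar3_in_bounds2[OF assms] by (simp_all add: bar3_def algebra_simps)
  then have cyc: "bar3 G (g, h, k) \<in> cycles2 G"
    using bounds2_subset_cycles2[OF G.is_group] by blast
  have "\<rho> ?p = \<rho> (?m + bar3 G (g, h, k))"
    using b by (simp add: algebra_simps)
  also have "\<dots> = \<rho> ?m + bar3 G (g, h, k)"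
    using pm cyc \<rho>_id[OF cyc] by (simp add: \<rho>_add cycles2_eq)
  finally have "quot B (\<rho> ?p) = quot B (\<rho> ?m)"
    using quot_eq_iff[OF \<rho>_cycles[OF pm(1)] \<rho>_cycles[OF pm(2)]] b(1) B(2) by auto
  then show ?thesis
    using assms c by (simp add: factor_set_def \<rho>_add quot_add[symmetric] \<rho>_cycles)
qed

text \<open>Modulo boundaries, a basis element with a unit entry equals
  \<open>single (\<one>, \<one>)\<close>, which \<open>\<rho>\<close> kills.\<close>

lemma factor_set_one:
  assumes "g \<in> carrier G"
  shows "factor_set B \<one> g = \<one>\<^bsub>Q\<^esub>" "factor_set B g \<one> = \<one>\<^bsub>Q\<^esub>"
proof -
  have c: "single (x, y) \<in> chains2 G" if "x \<in> carrier G" "y \<in> carrier G" for x y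
    using that by (simp add: chains2_eq)
  have one: "\<rho> (single (\<one>, \<one>)) = 0"
    by (simp add: \<rho>_def bd2_single bar2_def \<sigma>_one)
  have "quot B (\<rho> (single (x, y))) = \<one>\<^bsub>Q\<^esub>"
    if xy: "x \<in> carrier G" "y \<in> carrier G" and b: "single (x, y) - single (\<one>, \<one>) \<in> bounds2 G" for x y
  proof -
    have cyc: "single (x, y) - single (\<one>, \<one>) \<in> cycles2 G"
      using b bounds2_subset_cycles2[OF G.is_group] by blast
    have "\<rho> (single (x, y)) = \<rho> ((single (x, y) - single (\<one>, \<one>)) + single (\<one>, \<one>))"
      by simp
    also have "\<dots> = single (x, y) - single (\<one>, \<one>)"
      using cyc c one \<rho>_id[OF cyc] by (subst \<rho>_add) (simp_all add: cycles2_eq)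
    finally show ?thesis
      using quot_eq_one_iff[OF cyc] b B(2) by auto
  qed
  moreover have "single (\<one>, g) - single (\<one>, \<one>) \<in> bounds2 G"
    using G.bar3_in_bounds2[of \<one> \<one> g] assms by (simp add: bar3_def)
  moreover have "single (g, \<one>) - single (\<one>, \<one>) \<in> bounds2 G"
    using bounds2_closed(3)[OF G.bar3_in_bounds2[of g \<one> \<one>]] assms by (simp add: bar3_def)
  ultimately show "factor_set B \<one> g = \<one>\<^bsub>Q\<^esub>" "factor_set B g \<one> = \<one>\<^bsub>Q\<^esub>"
    using assms by (simp_all add: factor_set_def)
qed

sublocale normalized_cocycle Q G "factor_set B"
  by unfold_locales (fact factor_set_closed factor_set_cocycle factor_set_one)+

sublocale C: central_ext "cover B" G snd
  by (rule central_ext_ext_group)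

text \<open>The linear extension of the factor set, placed in the kernel of the cover; it belongs to
  the section that sends \<open>g\<close> to \<open>(\<one>, g)\<close>. The retraction
  \<open>\<rho>\<close> gives it explicitly on all chains.\<close>

definition \<alpha> where "\<alpha> z = (quot B (\<rho> z), \<one>)"

lemma \<alpha>_hom: "\<alpha> \<in> hom (chain_group (carrier G \<times> carrier G)) C.Ker"
proof (rule homI)
  fix z w
  assume zw: "z \<in> carrier (chain_group (carrier G \<times> carrier G))" "w \<in> carrier (chain_group (carrier G \<times> carrier G))"
  then have zw: "z \<in> chains2 G" "w \<in> chains2 G"
    by (simp_all add: chains2_eq)
  then show "\<alpha> (z \<otimes>\<^bsub>chain_group (carrier G \<times> carrier G)\<^esub> w) = \<alpha> z \<otimes>\<^bsub>C.Ker\<^esub> \<alpha> w"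
    using Q.r_one by (simp add: \<alpha>_def \<rho>_add quot_add \<rho>_cycles factor_set_one)
qed (use \<rho>_cycles in \<open>simp add: \<alpha>_def chains2_eq\<close>)

lemma \<alpha>_section:
  assumes "g \<in> carrier G" "h \<in> carrier G"
  shows "\<alpha> (single (g, h)) \<otimes>\<^bsub>cover B\<^esub> (\<one>\<^bsub>Q\<^esub>, g \<otimes> h) = (\<one>\<^bsub>Q\<^esub>, g) \<otimes>\<^bsub>cover B\<^esub> (\<one>\<^bsub>Q\<^esub>, h)"
  using assms factor_set_closed[OF assms]
  by (simp add: \<alpha>_def factor_set_def[symmetric] factor_set_one)

lemma \<alpha>_cycle: "z \<in> cycles2 G \<Longrightarrow> \<alpha> z = \<one>\<^bsub>cover B\<^esub> \<longleftrightarrow> z \<in> B"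
  by (simp add: \<alpha>_def \<rho>_id quot_eq_one_iff)

lemma lift_to_cover:
  assumes "group K" "perfect K" "c \<in> hom K G" "\<And>z. z \<in> cycles2 K \<Longrightarrow> push2 c z \<in> B"
  shows "\<exists>f\<in>hom K (cover B). \<forall>x\<in>carrier K. snd (f x) = c x"
proof (rule C.lift_if_factor_set_trivial[OF assms(1-3) _ _ \<alpha>_hom \<alpha>_section])
  fix z
  assume z: "z \<in> cycles2 K"
  then show "\<alpha> (push2 c z) = \<one>\<^bsub>cover B\<^esub>"
    using \<alpha>_cycle[OF push2_cycles2[OF assms(1) G.is_group assms(3) z]] assms(4) by blast
qed simp_all

text \<open>\<open>\<alpha>\<close> kills the push-forwards of cycles of the cover, while among the
  cycles of \<open>G\<close> it kills exactly those in \<open>B\<close>.\<close>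

lemma H2image_cover_subset:
  assumes z: "z \<in> cycles2 G" "hclass G z \<in> H2image (cover B) G snd"
  shows "z \<in> B"
proof -
  obtain w where w: "w \<in> cycles2 (cover B)" "hclass G z = hclass G (push2 snd w)"
    using z(2) unfolding H2image_eq[OF C.E.is_group G.is_group C.\<pi>_hom] by blast
  have pw: "push2 snd w \<in> cycles2 G"
    by (rule push2_cycles2[OF C.E.is_group G.is_group C.\<pi>_hom w(1)])
  have "\<alpha> (push2 snd w) = \<one>\<^bsub>cover B\<^esub>"
    by (rule C.factor_set_trivial_on_push2[OF _ _ \<alpha>_hom \<alpha>_section w(1)]) simp_all
  then have "push2 snd w \<in> B"
    using \<alpha>_cycle[OF pw] by blast
  moreover have "z - push2 snd w \<in> B"
    using w(2) hclass_eq_iff[OF G.is_group z(1) pw] B(2) by blast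
  ultimately have "(z - push2 snd w) + push2 snd w \<in> B"
    using B(1) unfolding subgroup_Z2grp_iff by blast
  then show ?thesis
    by simp
qed

text \<open>The abelianization kills the classes \<open>(quot B z, 1)\<close> of cycles because the section turns it into a
  homomorphism on the 1-chains composed with \<open>bd2\<close>; it is then trivial because it factors through \<open>G\<close>.\<close>

lemma perfect_cover: "perfect (cover B)"
proof -
  define D where "D = derived (cover B) (carrier (cover B))"
  have "D \<lhd> cover B"
    unfolding D_def by (rule C.E.derived_is_normal[OF C.E.normal_self])
  then interpret D: normal D "cover B" .
  let ?A = "cover B Mod D"
  interpret A: comm_group ?A
    unfolding D_def by (rule C.E.derived_quot_is_comm_group)
  define q where "q x = D #>\<^bsub>cover B\<^esub> x" for x
  have q: "q \<in> hom (cover B) ?A"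
    unfolding q_def by (rule D.r_coset_hom_Mod)
  interpret q: group_hom "cover B" ?A q
    using q by unfold_locales
  have \<alpha>E: "\<alpha> \<in> hom (chain_group (carrier G \<times> carrier G)) (cover B)"
    using \<alpha>_hom unfolding C.hom_Ker by blast
  obtain \<beta> where \<beta>: "\<beta> \<in> hom (chain_group (carrier G)) ?A"
    "\<And>g. g \<in> carrier G \<Longrightarrow> \<beta> (single g) = q (\<one>\<^bsub>Q\<^esub>, g)"
    using A.ex_chain_hom[of "carrier G" "\<lambda>g. q (\<one>\<^bsub>Q\<^esub>, g)"] q.hom_closed by auto
  have "(q \<circ> \<alpha>) z = (\<beta> \<circ> bd2 G) z" if "z \<in> cycles2 G" for z
  proof (rule chain_hom_eq[OF A.is_group hom_compose[OF \<alpha>E q] hom_compose[OF bd2_hom[OF G.is_group] \<beta>(1)]])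
    show "z \<in> fin_chains (carrier G \<times> carrier G)"
      using that by (simp add: cycles2_eq chains2_eq)
    fix p
    assume "p \<in> carrier G \<times> carrier G"
    then obtain g h where p: "p = (g, h)" and gh: "g \<in> carrier G" "h \<in> carrier G"
      by auto
    have \<alpha>p: "\<alpha> (single (g, h)) \<in> carrier (cover B)"
      using hom_in_carrier[OF \<alpha>E] gh by simp
    have s: "(\<one>\<^bsub>Q\<^esub>, x) \<in> carrier (cover B)" if "x \<in> carrier G" for x
      using that Q.one_closed by simp
    have "q (\<alpha> (single (g, h))) \<otimes>\<^bsub>?A\<^esub> q (\<one>\<^bsub>Q\<^esub>, g \<otimes> h) = q (\<one>\<^bsub>Q\<^esub>, g) \<otimes>\<^bsub>?A\<^esub> q (\<one>\<^bsub>Q\<^esub>, h)"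
      using arg_cong[OF \<alpha>_section[OF gh], of q] q.hom_mult \<alpha>p s gh G.m_closed by metis
    then have "q (\<alpha> (single (g, h))) = q (\<one>\<^bsub>Q\<^esub>, g) \<otimes>\<^bsub>?A\<^esub> q (\<one>\<^bsub>Q\<^esub>, h) \<otimes>\<^bsub>?A\<^esub> inv\<^bsub>?A\<^esub> q (\<one>\<^bsub>Q\<^esub>, g \<otimes> h)"
      using A.inv_solve_right q.hom_closed \<alpha>p s gh G.m_closed A.m_closed by metis
    moreover have "\<beta> (bar2 G p) = \<beta> ((single g + single h) - single (g \<otimes> h))"
      by (simp add: bar2_def p algebra_simps)
    moreover have "\<dots> = \<beta> (single g) \<otimes>\<^bsub>?A\<^esub> \<beta> (single h) \<otimes>\<^bsub>?A\<^esub> inv\<^bsub>?A\<^esub> \<beta> (single (g \<otimes> h))"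
      using gh by (simp only: chain_hom_diff[OF A.is_group \<beta>(1)] chain_hom_add[OF \<beta>(1)]
          single_in_fin_chains add_in_fin_chains G.m_closed)
    ultimately show "(q \<circ> \<alpha>) (single p) = (\<beta> \<circ> bd2 G) (single p)"
      using gh \<beta>(2) by (simp add: bd2_single p)
  qed
  then have "q (\<alpha> z) = \<one>\<^bsub>?A\<^esub>" if "z \<in> cycles2 G" for z
    using that chain_hom_zero[OF A.is_group \<beta>(1)] by (simp add: cycles2_eq)
  then have q_Ker: "q (u, \<one>) = \<one>\<^bsub>?A\<^esub>" if "u \<in> carrier Q" for u
    using that unfolding carrier_Q by (auto simp: \<alpha>_def \<rho>_id)
  have q_split: "q (u, g) = q (\<one>\<^bsub>Q\<^esub>, g)" if "u \<in> carrier Q" "g \<in> carrier G" for u g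
  proof -
    have "(u, g) = (u, \<one>) \<otimes>\<^bsub>cover B\<^esub> (\<one>\<^bsub>Q\<^esub>, g)"
      using that factor_set_one(1)[OF that(2)] by simp
    then have "q (u, g) = q (u, \<one>) \<otimes>\<^bsub>?A\<^esub> q (\<one>\<^bsub>Q\<^esub>, g)"
      using that by (simp add: q.hom_mult del: ext_group_simps(2))
    then show ?thesis
      using q_Ker[OF that(1)] q.hom_closed[of "(\<one>\<^bsub>Q\<^esub>, g)"] that
      by simp
  qed
  have t: "(\<lambda>g. q (\<one>\<^bsub>Q\<^esub>, g)) \<in> hom G ?A"
  proof (rule homI)
    fix g h
    assume gh: "g \<in> carrier G" "h \<in> carrier G"
    have "(\<one>\<^bsub>Q\<^esub>, g) \<otimes>\<^bsub>cover B\<^esub> (\<one>\<^bsub>Q\<^esub>, h) = (factor_set B g h, g \<otimes> h)"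
      using factor_set_closed[OF gh] by simp
    then have "q (\<one>\<^bsub>Q\<^esub>, g) \<otimes>\<^bsub>?A\<^esub> q (\<one>\<^bsub>Q\<^esub>, h) = q (factor_set B g h, g \<otimes> h)"
      using q.hom_mult[of "(\<one>\<^bsub>Q\<^esub>, g)" "(\<one>\<^bsub>Q\<^esub>, h)"] gh
      by (simp del: ext_group_simps(2))
    then show "q (\<one>\<^bsub>Q\<^esub>, g \<otimes> h) = q (\<one>\<^bsub>Q\<^esub>, g) \<otimes>\<^bsub>?A\<^esub> q (\<one>\<^bsub>Q\<^esub>, h)"
      using q_split[OF factor_set_closed[OF gh] G.m_closed[OF gh]] by simp
  qed (use q.hom_closed in simp)
  have q_triv: "q x = \<one>\<^bsub>?A\<^esub>" if x: "x \<in> carrier (cover B)" for x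
  proof -
    obtain u g where ug: "x = (u, g)" "u \<in> carrier Q" "g \<in> carrier G"
      using x by auto
    have "q (\<one>\<^bsub>Q\<^esub>, g) = \<one>\<^bsub>?A\<^esub>"
      by (rule perfect_hom_trivial[OF G.is_group A.is_group t perf ug(3)])
        (intro A.m_comm hom_in_carrier[OF t])
    then show ?thesis
      using q_split[OF ug(2,3)] ug(1) by simp
  qed
  have "carrier (cover B) \<subseteq> D"
  proof
    fix x
    assume x: "x \<in> carrier (cover B)"
    have "x \<in> q x"
      unfolding q_def by (rule C.E.rcos_self[OF x D.subgroup_axioms])
    then show "x \<in> D"
      using q_triv[OF x] by (simp add: one_FactGroup)
  qed
  then show ?thesis
    using D.subset by (simp add: D_def)
qed

end

context bd2_section
begin

text \<open>The inclusion \<open>\<supseteq>\<close>: let \<open>B' \<subseteq> B\<close> be the cycles with class in the image. Then \<open>cover B\<close> lifts to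
  \<open>cover B'\<close>; composed with the projection \<open>cover B' \<rightarrow> cover B\<close> this is the identity
  by uniqueness of lifts from a perfect group, so the projection is injective and \<open>B' = B\<close>.\<close>

lemma H2image_cover:
  assumes B: "subgroup B (Z2grp G)" "bounds2 G \<subseteq> B"
  shows "H2image (cover B) G snd = hclass G ` B"
proof -
  interpret B: multiplier_quotient G \<sigma> B
    by (intro multiplier_quotient.intro multiplier_quotient_axioms.intro bd2_section_axioms B)
  let ?H = "H2image (cover B) G snd"
  have H: "subgroup ?H (H2 G)"
    by (rule subgroup_H2image[OF B.C.E.is_group G.is_group B.C.\<pi>_hom])
  define B' where "B' = {z \<in> cycles2 G. hclass G z \<in> ?H}"
  have sub: "B' \<subseteq> B"
    using B.H2image_cover_subset by (auto simp: B'_def)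
  have B': "subgroup B' (Z2grp G)" "bounds2 G \<subseteq> B'" "hclass G ` B' = ?H"
    unfolding B'_def by (rule subgroup_hclass_vimage[OF G.is_group H])+
  then interpret B': multiplier_quotient G \<sigma> B'
    by (intro multiplier_quotient.intro multiplier_quotient_axioms.intro bd2_section_axioms)
  have "push2 snd z \<in> B'" if z: "z \<in> cycles2 (cover B)" for z
    using push2_cycles2[OF B.C.E.is_group G.is_group B.C.\<pi>_hom z] z
    unfolding B'_def H2image_eq[OF B.C.E.is_group G.is_group B.C.\<pi>_hom] by blast
  then obtain f where f: "f \<in> hom (cover B) (cover B')" "\<And>x. x \<in> carrier (cover B) \<Longrightarrow> snd (f x) = snd x"
    using B'.lift_to_cover[OF B.C.E.is_group B.perfect_cover B.C.\<pi>_hom] by blast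
  \<comment> \<open>The inclusion \<open>B' \<subseteq> B\<close> induces a projection of the
    kernels. Both factor sets come from the same \<open>\<rho>\<close>, so it extends to a
    homomorphism of the covers.\<close>
  have "\<exists>\<kappa>\<in>hom B'.Q B.Q. \<forall>z\<in>cycles2 G. \<kappa> (quot B' z) = quot B z"
  proof (rule FactGroup_universal[OF B.quot_hom B'.B_normal, folded quot_def])
    show "quot B z = quot B w"
      if "z \<in> carrier (Z2grp G)" "w \<in> carrier (Z2grp G)" "quot B' z = quot B' w" for z w
      using that B.quot_eq_iff[of z w] B'.quot_eq_iff[of z w] sub by auto
  qed auto
  then obtain \<kappa> where \<kappa>: "\<kappa> \<in> hom B'.Q B.Q" "\<And>z. z \<in> cycles2 G \<Longrightarrow> \<kappa> (quot B' z) = quot B z"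
    by blast
  define r where "r x = (\<kappa> (fst x), snd x)" for x :: "('a \<times> 'a \<Rightarrow> int) set \<times> 'a"
  have \<kappa>_fs: "\<kappa> (factor_set B' g h) = factor_set B g h" if "g \<in> carrier G" "h \<in> carrier G" for g h
    unfolding factor_set_def using that by (intro \<kappa>(2) \<rho>_cycles) (simp add: chains2_eq)
  have r: "r \<in> hom (cover B') (cover B)"
  proof (rule homI)
    fix x
    assume "x \<in> carrier (cover B')"
    then show "r x \<in> carrier (cover B)"
      using hom_in_carrier[OF \<kappa>(1)] by (auto simp: r_def)
  next
    fix x y
    assume "x \<in> carrier (cover B')" "y \<in> carrier (cover B')"
    then obtain u g v h where "x = (u, g)" "y = (v, h)" "u \<in> carrier B'.Q" "v \<in> carrier B'.Q"
      "g \<in> carrier G" "h \<in> carrier G"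
      by auto
    then show "r (x \<otimes>\<^bsub>cover B'\<^esub> y) = r x \<otimes>\<^bsub>cover B\<^esub> r y"
      using hom_mult[OF \<kappa>(1)] \<kappa>_fs B'.factor_set_closed
      by (simp add: r_def)
  qed
  have fr: "f (r x) = x" if x: "x \<in> carrier (cover B')" for x
  proof (rule B'.C.lifts_unique[OF B'.C.E.is_group B'.perfect_cover _ _ _ x])
    show "(\<lambda>x. f (r x)) \<in> hom (cover B') (cover B')"
      using hom_compose[OF r f(1)] by (simp add: o_def)
    show "(\<lambda>x. x) \<in> hom (cover B') (cover B')"
      by (rule homI) simp_all
    show "snd (f (r y)) = snd y" if "y \<in> carrier (cover B')" for y
      using f(2)[OF hom_in_carrier[OF r that]] by (simp add: r_def)
  qed
  have "B \<subseteq> B'"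
  proof
    fix z
    assume z: "z \<in> B"
    then have cyc: "z \<in> cycles2 G"
      using B(1) unfolding subgroup_Z2grp_iff by blast
    have x: "(quot B' z, \<one>) \<in> carrier (cover B')"
      using cyc B'.quot_closed by simp
    have "r (quot B' z, \<one>) = \<one>\<^bsub>cover B\<^esub>"
      using \<kappa>(2)[OF cyc] B.quot_eq_one_iff[OF cyc] z by (simp add: r_def)
    then have "(quot B' z, \<one>) = \<one>\<^bsub>cover B'\<^esub>"
      using fr[OF x] hom_one[OF f(1) B.C.E.is_group B'.C.E.is_group] by simp
    then show "z \<in> B'"
      using B'.quot_eq_one_iff[OF cyc] by simp
  qed
  with sub have "B = B'"
    by blast
  then show ?thesis
    using B'(3) by simp
qed

end

lemma ex_bd2_section:
  assumes "group G" "perfect G"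
  shows "\<exists>\<sigma>. bd2_section G \<sigma>"
proof -
  interpret group G by fact
  obtain \<sigma> where \<sigma>: "\<And>g. g \<in> carrier G \<Longrightarrow> \<sigma> g \<in> chains2 G" "\<And>g. g \<in> carrier G \<Longrightarrow> bd2 G (\<sigma> g) = single g"
    using perfect_bd2_surj[OF assms] by metis
  have "bd2_section G (\<sigma>(\<one>\<^bsub>G\<^esub> := single (\<one>\<^bsub>G\<^esub>, \<one>\<^bsub>G\<^esub>)))"
    using \<sigma> assms(2) by unfold_locales (simp_all add: chains2_eq bd2_single bar2_def)
  then show ?thesis
    by blast
qed

section \<open>Classification of the surjective cellular covers\<close>

lemma countable_fin_chains: "finite S \<Longrightarrow> countable (fin_chains S)"
proof (induction rule: finite_induct)
  case empty
  have "fin_chains ({} :: 'a set) \<subseteq> {0}"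
    by (auto simp: fin_chains_def fun_eq_iff fun_apply)
  then show ?case
    by (rule countable_subset) simp
next
  case (insert p S)
  have "fin_chains (insert p S) \<subseteq> (\<lambda>(k, z). z(p := k)) ` (UNIV \<times> fin_chains S)"
  proof
    fix z
    assume z: "z \<in> fin_chains (insert p S)"
    have "{q. (z(p := 0)) q \<noteq> 0} \<subseteq> {q. z q \<noteq> 0}"
      by auto
    then have "finite {q. (z(p := 0)) q \<noteq> 0}"
      by (rule finite_subset) (use z in \<open>simp add: fin_chains_def\<close>)
    then have "z(p := 0) \<in> fin_chains S"
      using z unfolding fin_chains_def by auto
    then show "z \<in> (\<lambda>(k, z). z(p := k)) ` (UNIV \<times> fin_chains S)"
      by (intro image_eqI[of _ _ "(z p, z(p := 0))"]) auto
  qed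
  then show ?case
    by (rule countable_subset) (intro countable_image countable_SIGMA insert.IH; simp)
qed

text \<open>\<open>cover B\<close> lives on pairs of a coset and a group element, whereas the set of
  covers is formed over one prescribed type; an injection carries the structure over.\<close>

definition transported :: "('a, 'm) monoid_scheme \<Rightarrow> ('a \<Rightarrow> 'c) \<Rightarrow> 'c monoid" where
  "transported K \<iota> = \<lparr>carrier = \<iota> ` carrier K,
     monoid.mult = (\<lambda>x y. \<iota> (inv_into (carrier K) \<iota> x \<otimes>\<^bsub>K\<^esub> inv_into (carrier K) \<iota> y)),
     one = \<iota> \<one>\<^bsub>K\<^esub>\<rparr>"

lemma transported:
  assumes "group K" "inj_on \<iota> (carrier K)"
  shows "group (transported K \<iota>)" "\<iota> \<in> iso K (transported K \<iota>)"
proof -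
  interpret group K by fact
  have mult: "\<iota> x \<otimes>\<^bsub>transported K \<iota>\<^esub> \<iota> y = \<iota> (x \<otimes>\<^bsub>K\<^esub> y)" if "x \<in> carrier K" "y \<in> carrier K" for x y
    using that assms(2) by (simp add: transported_def)
  have car: "carrier (transported K \<iota>) = \<iota> ` carrier K" "\<one>\<^bsub>transported K \<iota>\<^esub> = \<iota> \<one>\<^bsub>K\<^esub>"
    by (simp_all add: transported_def)
  show "group (transported K \<iota>)"
  proof (rule groupI)
    fix x
    assume "x \<in> carrier (transported K \<iota>)"
    then obtain a where a: "a \<in> carrier K" "x = \<iota> a"
      by (auto simp: car)
    then show "\<exists>y\<in>carrier (transported K \<iota>). y \<otimes>\<^bsub>transported K \<iota>\<^esub> x = \<one>\<^bsub>transported K \<iota>\<^esub>"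
      unfolding car by (intro bexI[of _ "\<iota> (inv\<^bsub>K\<^esub> a)"]) (simp_all add: mult)
  qed (auto simp: car mult m_assoc)
  show "\<iota> \<in> iso K (transported K \<iota>)"
    using assms(2) by (auto simp: iso_def hom_def bij_betw_def car mult)
qed

lemma perfect_surj_image:
  assumes "group K" "group L" "h \<in> hom K L" "h ` carrier K = carrier L" "perfect K"
  shows "perfect L"
proof -
  interpret group_hom K L h
    using assms(1-3) by (simp add: group_hom_def group_hom_axioms_def)
  show ?thesis
    using derived_img[of "carrier K"] assms(4,5) by simp
qed

lemma (in central_ext) central_ext_comp_iso:
  assumes "group K" "\<kappa> \<in> iso K E"
  shows "central_ext K G (\<lambda>x. \<pi> (\<kappa> x))"
proof -
  interpret K: group K by fact
  have \<kappa>: "\<kappa> \<in> hom K E" "inj_on \<kappa> (carrier K)" "\<kappa> ` carrier K = carrier E"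
    using assms(2) by (auto simp: iso_def bij_betw_def)
  interpret \<kappa>: group_hom K E \<kappa>
    using \<kappa>(1) by unfold_locales
  show ?thesis
  proof
    show "(\<lambda>x. \<pi> (\<kappa> x)) \<in> hom K G"
      using hom_compose[OF \<kappa>(1) \<pi>_hom] by (simp add: o_def)
    show "(\<lambda>x. \<pi> (\<kappa> x)) ` carrier K = carrier G"
      using \<kappa>(3) \<pi>_surj by (simp flip: image_image)
    fix n x
    assume nx: "n \<in> carrier K" "\<pi> (\<kappa> n) = \<one>\<^bsub>G\<^esub>" "x \<in> carrier K"
    then have "\<kappa> (n \<otimes>\<^bsub>K\<^esub> x) = \<kappa> (x \<otimes>\<^bsub>K\<^esub> n)"
      using central[of "\<kappa> n" "\<kappa> x"] by simp
    then show "n \<otimes>\<^bsub>K\<^esub> x = x \<otimes>\<^bsub>K\<^esub> n"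
      using nx by (intro inj_onD[OF \<kappa>(2)]) simp_all
  qed
qed

lemma H2image_comp_iso:
  assumes "group K" "group E" "group G" "\<kappa> \<in> iso K E" "c \<in> hom E G"
  shows "H2image K G (\<lambda>x. c (\<kappa> x)) = H2image E G c"
proof -
  interpret K: group K by fact
  interpret E: group E by fact
  have \<kappa>: "\<kappa> \<in> hom K E" "inv_into (carrier K) \<kappa> \<in> hom E K"
    using assms(4) K.iso_set_sym[OF assms(4)] by (simp_all add: iso_def)
  have im: "\<kappa> ` carrier K = carrier E"
    using assms(4) by (simp add: iso_def bij_betw_def)
  have c\<kappa>: "(\<lambda>x. c (\<kappa> x)) \<in> hom K G"
    using hom_compose[OF \<kappa>(1) assms(5)] by (simp add: o_def)
  show ?thesis
  proof
    show "H2image K G (\<lambda>x. c (\<kappa> x)) \<subseteq> H2image E G c"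
      by (rule H2image_factor[OF assms(1-3) c\<kappa> assms(5) \<kappa>(1)]) simp
    show "H2image E G c \<subseteq> H2image K G (\<lambda>x. c (\<kappa> x))"
      by (rule H2image_factor[OF assms(2,1,3,5) c\<kappa> \<kappa>(2)]) (use im in \<open>simp add: f_inv_into_f\<close>)
  qed
qed

lemma H2image_cong:
  assumes "group K" "group G" "c \<in> hom K G" "d \<in> hom K G" "\<And>x. x \<in> carrier K \<Longrightarrow> c x = d x"
  shows "H2image K G c = H2image K G d"
proof -
  have id: "(\<lambda>x. x) \<in> hom K K"
    by (simp add: hom_def)
  show ?thesis
    using H2image_factor[OF assms(1,1,2,3,4) id] H2image_factor[OF assms(1,1,2,4,3) id] assms(5)
    by auto
qed

lemma iso_cellular_cover:
  assumes "group K" "group G" "c \<in> iso K G"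
  shows "cellular_cover K G c"
proof -
  interpret K: group K by fact
  have c: "c \<in> hom K G" "inj_on c (carrier K)" "c ` carrier K = carrier G"
    using assms(3) by (auto simp: iso_def bij_betw_def)
  have inv: "inv_into (carrier K) c \<in> hom G K"
    using K.iso_set_sym[OF assms(3)] by (simp add: iso_def)
  have "gen_subgroup K G c"
    unfolding gen_subgroup_def using c(1) inj_onD[OF c(2)] by (auto intro: hom_in_carrier)
  moreover have "\<exists>f\<in>hom K K. \<forall>x\<in>carrier K. c (f x) = \<phi> x" if \<phi>: "\<phi> \<in> hom K G" for \<phi>
    using hom_compose[OF \<phi> inv] hom_in_carrier[OF \<phi>] c(3)
    by (intro bexI[of _ "inv_into (carrier K) c \<circ> \<phi>"]) (auto simp: f_inv_into_f)
  ultimately show ?thesis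
    by (simp add: cellular_cover_def)
qed

text \<open>The form needed for \<open>class_image\<close>, which evaluates at a chosen member of
  each class: when the relation is equality of \<open>F\<close>, the classes are the fibres and the
  choice is immaterial.\<close>

lemma bij_betw_fibres:
  assumes "R = {(p, q). p \<in> C \<and> q \<in> C \<and> F p = F q}"
  shows "bij_betw (\<lambda>P. F (SOME p. p \<in> P)) (C // R) (F ` C)"
proof -
  have val: "F (SOME q. q \<in> R `` {p}) = F p" if "p \<in> C" for p
    using someI[of "\<lambda>q. q \<in> R `` {p}" p] that unfolding assms by auto
  have "inj_on (\<lambda>P. F (SOME p. p \<in> P)) (C // R)"
  proof (rule inj_onI, elim quotientE)
    fix P P' p p'
    assume eq: "F (SOME p. p \<in> P) = F (SOME p. p \<in> P')"
      and P: "p \<in> C" "P = R `` {p}" "p' \<in> C" "P' = R `` {p'}"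
    then have "F p = F p'"
      using val by simp
    then show "P = P'"
      unfolding P using P(1,3) by (auto simp: assms)
  qed
  moreover have "(\<lambda>P. F (SOME p. p \<in> P)) ` (C // R) = F ` C"
    using val by (force simp: quotient_def)
  ultimately show ?thesis
    by (simp add: bij_betw_def)
qed

section \<open>Finite simple groups: the perfect and the cyclic case together\<close>

locale finite_simple_group = simple_group G for G (structure) +
  assumes finite_carrier: "finite (carrier G)"
begin

lemma not_perfect_cyclic:
  assumes "\<not> perfect G"
  obtains g where "g \<in> carrier G" "generate G {g} = carrier G"
  using perfect_or_cyclic assms by blast

lemma gen_subgroup_iso_if_not_perfect:
  assumes "\<not> perfect G" "group K" "gen_subgroup K G c" "c ` carrier K = carrier G"
  shows "c \<in> iso K G"
proof -
  interpret central_ext K G c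
    by (rule central_ext_if_gen_subgroup[OF assms(2) is_group assms(3,4)])
  obtain g where g: "g \<in> carrier G" "generate G {g} = carrier G"
    using not_perfect_cyclic[OF assms(1)] .
  show ?thesis
    unfolding \<pi>.iso_iff using assms(4) inj_if_cyclic[OF assms(3) finite_carrier g] by blast
qed

lemma carrier_H2_if_not_perfect:
  assumes "\<not> perfect G"
  shows "carrier (H2 G) = {hclass G 0}"
proof -
  obtain g where g: "g \<in> carrier G" "generate G {g} = carrier G"
    using not_perfect_cyclic[OF assms] .
  have "hclass G z = hclass G 0" if "z \<in> cycles2 G" for z
    using cyclic_cycles2_subset_bounds2[OF finite_carrier g] that
      hclass_eq_iff[OF is_group that cycles2_closed(1)] by auto
  then show ?thesis
    unfolding carrier_H2 using cycles2_closed(1)[of G] by blast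
qed

lemma subgroup_H2_if_not_perfect:
  assumes "\<not> perfect G" "subgroup S (H2 G)"
  shows "S = {hclass G 0}"
  using subgroup.subset[OF assms(2)] subgroup.one_closed[OF assms(2)]
  unfolding carrier_H2_if_not_perfect[OF assms(1)] by (auto simp only: subset_singleton_iff)

lemma cellular_cover_iff:
  assumes K: "group K" "gen_subgroup K G c" "c ` carrier K = carrier G"
  shows "cellular_cover K G c \<longleftrightarrow> Aut_invariant G (H2image K G c)"
proof (cases "perfect G")
  case True
  interpret central_ext K G c
    by (rule central_ext_if_gen_subgroup[OF K(1) is_group K(2,3)])
  show ?thesis
    by (rule cellular_cover_iff_Aut_invariant[OF is_simple_group finite_carrier
          perfect_if_gen_subgroup[OF K(2) True finite_carrier]])
next
  case False
  have c: "c \<in> hom K G"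
    using K(2) by (simp add: gen_subgroup_def)
  have S: "H2image K G c = {hclass G 0}"
    by (rule subgroup_H2_if_not_perfect[OF False subgroup_H2image[OF K(1) is_group c]])
  have "H2map G h (hclass G 0) = hclass G 0" if "h \<in> iso G G" for h
    using H2map_hclass[OF is_group is_group iso_imp_homomorphism[OF that] cycles2_closed(1)] by simp
  then have "Aut_invariant G (H2image K G c)"
    unfolding S by (simp add: Aut_invariant_def)
  moreover have "cellular_cover K G c"
    by (rule iso_cellular_cover[OF K(1) is_group gen_subgroup_iso_if_not_perfect[OF False K]])
  ultimately show ?thesis
    by blast
qed

lemma ex_lift:
  assumes K: "group K" "gen_subgroup K G c" "c ` carrier K = carrier G"
    and L: "group L" "gen_subgroup L G d" "d ` carrier L = carrier G"
    and sub: "H2image K G c \<subseteq> H2image L G d"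
  shows "\<exists>f\<in>hom K L. \<forall>x\<in>carrier K. d (f x) = c x"
proof -
  have c: "c \<in> hom K G"
    using K(2) by (simp add: gen_subgroup_def)
  show ?thesis
  proof (cases "perfect G")
    case True
    interpret K: central_ext K G c
      by (rule central_ext_if_gen_subgroup[OF K(1) is_group K(2,3)])
    interpret L: central_ext L G d
      by (rule central_ext_if_gen_subgroup[OF L(1) is_group L(2,3)])
    show ?thesis
      by (rule L.lift_if_H2image_subset[OF K(1) K.perfect_if_gen_subgroup[OF K(2) True finite_carrier] c sub])
  next
    case False
    have d: "inv_into (carrier L) d \<in> hom G L"
      using group.iso_set_sym[OF L(1) gen_subgroup_iso_if_not_perfect[OF False L]] by (simp add: iso_def)
    show ?thesis
      using Group.hom_compose[OF c d] hom_in_carrier[OF c] L(3)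
      by (intro bexI[of _ "inv_into (carrier L) d \<circ> c"]) (auto simp: f_inv_into_f)
  qed
qed

text \<open>Equal images give lifts in both directions. Their composites are endomorphisms over
  \<open>G\<close>, so injectivity for generalized subgroups makes them identities.\<close>

lemma cover_equiv_iff:
  assumes K: "group K" "gen_subgroup K G c" "c ` carrier K = carrier G"
    and L: "group L" "gen_subgroup L G d" "d ` carrier L = carrier G"
  shows "cover_equiv (K, c) (L, d) \<longleftrightarrow> H2image K G c = H2image L G d"
proof -
  have c: "c \<in> hom K G" and d: "d \<in> hom L G"
    using K(2) L(2) by (simp_all add: gen_subgroup_def)
  show ?thesis
  proof
    assume "cover_equiv (K, c) (L, d)"
    then obtain h where h: "h \<in> iso K L" "\<And>x. x \<in> carrier K \<Longrightarrow> d (h x) = c x"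
      by (auto simp: cover_equiv_def)
    have dh: "(\<lambda>x. d (h x)) \<in> hom K G"
      using Group.hom_compose[OF iso_imp_homomorphism[OF h(1)] d] by (simp add: o_def)
    show "H2image K G c = H2image L G d"
      using H2image_comp_iso[OF K(1) L(1) is_group h(1) d] H2image_cong[OF K(1) is_group dh c h(2)]
      by simp
  next
    assume eq: "H2image K G c = H2image L G d"
    obtain f where f: "f \<in> hom K L" "\<And>x. x \<in> carrier K \<Longrightarrow> d (f x) = c x"
      using ex_lift[OF K L] eq by auto
    obtain g where g: "g \<in> hom L K" "\<And>x. x \<in> carrier L \<Longrightarrow> c (g x) = d x"
      using ex_lift[OF L K] eq by auto
    have gf: "g (f x) = x" if "x \<in> carrier K" for x
      by (rule gen_subgroupD[OF K(2) _ _ _ that, of "\<lambda>x. g (f x)" "\<lambda>x. x"])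
        (use Group.hom_compose[OF f(1) g(1)] f(2) g(2) hom_in_carrier[OF f(1)] in \<open>simp_all add: o_def hom_def Pi_def\<close>)
    have fg: "f (g x) = x" if "x \<in> carrier L" for x
      by (rule gen_subgroupD[OF L(2) _ _ _ that, of "\<lambda>x. f (g x)" "\<lambda>x. x"])
        (use Group.hom_compose[OF g(1) f(1)] f(2) g(2) hom_in_carrier[OF g(1)] in \<open>simp_all add: o_def hom_def Pi_def\<close>)
    have "bij_betw f (carrier K) (carrier L)"
      by (rule bij_betw_byWitness[of _ g]) (use gf fg hom_in_carrier[OF f(1)] hom_in_carrier[OF g(1)] in auto)
    then have "f \<in> iso K L"
      using f(1) by (simp add: iso_def)
    then show "cover_equiv (K, c) (L, d)"
      using f(2) by (auto simp: cover_equiv_def)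
  qed
qed

text \<open>The carriers are countable, so the covers can be copied to any infinite type.\<close>

lemma ex_cover_with_H2image:
  assumes inf: "infinite (UNIV :: 'c set)" and S: "subgroup S (H2 G)" "Aut_invariant G S"
  shows "\<exists>(K :: 'c monoid) c. group K \<and> cellular_cover K G c \<and> c ` carrier K = carrier G \<and> H2image K G c = S"
proof -
  have inj: "\<exists>\<iota> :: 'e \<Rightarrow> 'c. inj_on \<iota> A" if A: "countable A" for A :: "'e set"
  proof -
    obtain e :: "nat \<Rightarrow> 'c" where e: "inj e"
      using infinite_countable_subset[OF inf] by blast
    show ?thesis
      using comp_inj_on[OF inj_on_to_nat_on[OF A] inj_on_subset[OF e subset_UNIV]] by blast
  qed
  show ?thesis
  proof (cases "perfect G")
    case True
    obtain \<sigma> where "bd2_section G \<sigma>"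
      using ex_bd2_section[OF is_group True] by blast
    then interpret bd2_section G \<sigma> .
    define B where "B = {z \<in> cycles2 G. hclass G z \<in> S}"
    have B: "subgroup B (Z2grp G)" "bounds2 G \<subseteq> B" "hclass G ` B = S"
      unfolding B_def by (rule subgroup_hclass_vimage[OF is_group S(1)])+
    interpret B: multiplier_quotient G \<sigma> B
      by (intro multiplier_quotient.intro multiplier_quotient_axioms.intro bd2_section_axioms B)
    have "cycles2 G \<subseteq> fin_chains (carrier G \<times> carrier G)"
      by (auto simp: cycles2_eq chains2_eq)
    then have "countable (cycles2 G)"
      using countable_fin_chains[of "carrier G \<times> carrier G"] finite_carrier countable_subset by blast
    then have "countable (carrier (cover B))"
      using finite_carrier by (simp add: B.carrier_Q countable_finite)
    then obtain \<iota> :: "_ \<Rightarrow> 'c" where \<iota>: "inj_on \<iota> (carrier (cover B))"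
      using inj by blast
    let ?K = "transported (cover B) \<iota>" and ?\<kappa> = "inv_into (carrier (cover B)) \<iota>"
    let ?c = "\<lambda>x. snd (?\<kappa> x)"
    note K = transported[OF B.C.E.is_group \<iota>]
    have \<kappa>: "?\<kappa> \<in> iso ?K (cover B)"
      by (rule B.C.E.iso_set_sym[OF K(2)])
    interpret K: central_ext ?K G ?c
      by (rule B.C.central_ext_comp_iso[OF K(1) \<kappa>])
    have perfK: "perfect ?K"
      by (rule perfect_surj_image[OF B.C.E.is_group K(1) iso_imp_homomorphism[OF K(2)] _ B.perfect_cover])
        (use K(2) in \<open>simp add: iso_def bij_betw_def\<close>)
    have im: "H2image ?K G ?c = S"
      using H2image_comp_iso[OF K(1) B.C.E.is_group is_group \<kappa> B.C.\<pi>_hom] H2image_cover[OF B(1,2)] B(3)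
      by simp
    have "cellular_cover ?K G ?c"
      using K.cellular_cover_iff_Aut_invariant[OF is_simple_group finite_carrier perfK] S(2) im by simp
    then show ?thesis
      using K(1) K.\<pi>_surj im by blast
  next
    case False
    \<comment> \<open>Here \<open>H2 G\<close> is trivial, so \<open>S\<close> is its only subgroup
      and a copy of \<open>G\<close> itself realizes it.\<close>
    obtain \<iota> :: "'a \<Rightarrow> 'c" where \<iota>: "inj_on \<iota> (carrier G)"
      using inj[of "carrier G"] countable_finite[OF finite_carrier] by blast
    let ?K = "transported G \<iota>" and ?c = "inv_into (carrier G) \<iota>"
    note K = transported[OF is_group \<iota>]
    have c: "?c \<in> iso ?K G"
      by (rule iso_set_sym[OF K(2)])
    have "H2image ?K G ?c = S"
      using subgroup_H2_if_not_perfect[OF False subgroup_H2image[OF K(1) is_group iso_imp_homomorphism[OF c]]]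
        subgroup_H2_if_not_perfect[OF False S(1)] by simp
    then show ?thesis
      using K(1) iso_cellular_cover[OF K(1) is_group c] c
      by (intro exI[of _ ?K] exI[of _ ?c]) (simp add: iso_def bij_betw_def)
  qed
qed

lemma bij_betw_class_image:
  assumes inf: "infinite (UNIV :: 'c set)"
  shows "bij_betw (class_image G)
    ((surj_cellular_covers G :: ('c monoid \<times> ('c \<Rightarrow> 'a)) set) // cover_equiv_rel G) (invariant_subgroups G)"
proof -
  let ?C = "surj_cellular_covers G :: ('c monoid \<times> ('c \<Rightarrow> 'a)) set"
  let ?F = "\<lambda>p :: 'c monoid \<times> ('c \<Rightarrow> 'a). H2image (fst p) G (snd p)"
  have C: "group (fst p)" "gen_subgroup (fst p) G (snd p)" "snd p ` carrier (fst p) = carrier G"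
    "cellular_cover (fst p) G (snd p)" if "p \<in> ?C" for p
    using that by (auto simp: surj_cellular_covers_def cellular_cover_def)
  have R: "cover_equiv_rel G = {(p, q). p \<in> ?C \<and> q \<in> ?C \<and> ?F p = ?F q}"
    using cover_equiv_iff[OF C(1-3) C(1-3)] by (auto simp: cover_equiv_rel_def)
  have "?F ` ?C = invariant_subgroups G"
  proof
    show "?F ` ?C \<subseteq> invariant_subgroups G"
    proof (rule image_subsetI)
      fix p
      assume p: "p \<in> ?C"
      have "snd p \<in> hom (fst p) G"
        using C(2)[OF p] by (simp add: gen_subgroup_def)
      then show "?F p \<in> invariant_subgroups G"
        using subgroup_H2image[OF C(1)[OF p] is_group] cellular_cover_iff[OF C(1-3)[OF p]] C(4)[OF p]
        by (simp add: invariant_subgroups_def)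
    qed
    show "invariant_subgroups G \<subseteq> ?F ` ?C"
    proof
      fix S
      assume "S \<in> invariant_subgroups G"
      then obtain K :: "'c monoid" and c where "group K" "cellular_cover K G c" "c ` carrier K = carrier G"
        and S: "H2image K G c = S"
        using ex_cover_with_H2image[OF inf, of S] by (auto simp: invariant_subgroups_def)
      then have "(K, c) \<in> ?C"
        by (simp add: surj_cellular_covers_def)
      then show "S \<in> ?F ` ?C"
        using S by (intro image_eqI[of _ _ "(K, c)"]) simp_all
    qed
  qed
  moreover have "class_image G = (\<lambda>P. ?F (SOME p. p \<in> P))"
    by (simp add: fun_eq_iff class_image_def Let_def)
  ultimately show ?thesis
    using bij_betw_fibres[OF R] by simp
qed

end

theorem theorem8p1:
  fixes G :: "'a monoid"
  assumes "simple_group G" and "finite (carrier G)"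
  shows "(\<forall>(K :: 'b monoid) c. group K \<and> gen_subgroup K G c \<and> c ` carrier K = carrier G \<longrightarrow>
            (cellular_cover K G c \<longleftrightarrow> Aut_invariant G (H2image K G c)))
       \<and> (infinite (UNIV :: 'c set) \<longrightarrow>
            bij_betw (class_image G)
              ((surj_cellular_covers G :: ('c monoid \<times> ('c \<Rightarrow> 'a)) set) // cover_equiv_rel G)
              (invariant_subgroups G))"
proof -
  interpret finite_simple_group G
    using assms by (simp add: finite_simple_group_def finite_simple_group_axioms_def)
  show ?thesis
    using cellular_cover_iff bij_betw_class_image by blast
qed

end
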